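(* Let $\Lambda=\Lambda_0\oplus\Lambda_1$ be a finite-dimensional real commutative superalgebra satisfying conditions $(A_0)$ and $(A_1)$. Let $D\subset\Lambda_0^n\times\Lambda_1^m$ be open and let $f:D\to\Lambda$ be qS-differentiable on $D$. For every $(b,\beta)=(b_1,\dots,b_n,\beta_1,\dots,\beta_m)\in D$ there exist $\rho>0$ and elements $A_{I,J}\in\Lambda$, indexed by $I\in\mathbb N^n$ and $J=(J_1,\dots,J_r)\in(\mathbb N^m)^r$, such that for $\|y_j-b_j\|<\rho$ $(j=1,\dots,n)$ and $\|\theta_j-\beta_j\|<\rho$ $(j=1,\dots,m)$, $$f(y,\theta)=\sum_{I,J_1,\dots,J_r}A_{I,J}\,(y-b)^I\,(Z_1(\theta-\beta))^{J_1}\cdots(Z_r(\theta-\beta))^{J_r}\qquad( * )$$ with absolute convergence of the series. Moreover $$I!\,J_1!\cdots J_r!\,A_{I,J}=\frac{\partial^{|I|+|J_1|+\dots+|J_r|}f}{\partial y^I\,\partial(Z_1\theta)^{J_1}\cdots\partial(Z_r\theta)^{J_r}}(b,\beta).$$ The expansion $( * )$ is valid on every polydisc $P$ centred at $(b,\beta)$ and relatively compact in $D$. Conversely, every function of the form $( * )$ is qS-differentiable on the domain of convergence of the series.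
   Context: A real commutative superalgebra (CSA) is an associative unital real algebra with a grading $\Lambda=\Lambda_0\oplus\Lambda_1$, $\Lambda_i\Lambda_j\subset\Lambda_{i+j \bmod 2}$, such that $ab=(-1)^{\sigma(a)\sigma(b)}ba$ for homogeneous $a,b$, where $\sigma(a)=i$ for $a\in\Lambda_i$. Condition $(A_0)$: there is a basis $(e_0=1,e_1,\dots,e_p)$ of $\Lambda_0$ with $\sum_{k=0}^p e_k^2=0$. Condition $(A_1)$: there are a basis $(\varepsilon_1,\dots,\varepsilon_q)$ of $\Lambda_1$, integers $1=s_1<s_2<\dots<s_r<s_{r+1}=q+1$ and elements $a_1,\dots,a_q\in\Lambda_0$ such that $\varepsilon_j=a_j\varepsilon_{s_k}$ whenever $s_k\le j<s_{k+1}$, $a_{s_1}=\dots=a_{s_r}=e_0$, and $\sum_{j=s_k}^{s_{k+1}-1}a_j^2=0$ for every $k=1,\dots,r$. Such bases and elements are fixed; norms are Euclidean with these bases orthonormal. A point of $\Lambda_0^n\times\Lambda_1^m$ is written $(y,\theta)=(y_1,\dots,y_n,\theta_1,\dots,\theta_m)$ with $y_i=\sum_{k=0}^p y_i^k e_k$, $\theta_i=\sum_{l=1}^q\theta_i^l\varepsilon_l$, where $y_i^k,\theta_i^l$ are real coordinates. For a Fréchet-differentiable (over $\mathbb R$) function $f$ with values in $\Lambda$ put $$d''f=\sum_{i=1}^n\sum_{j=1}^p \Big(\frac{\partial f}{\partial y_i^j}-e_j\frac{\partial f}{\partial y_i^0}\Big)dy_i^j+\sum_{i=1}^m\sum_{k=1}^r\sum_{t=s_k+1}^{s_{k+1}-1}\Big(\frac{\partial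 f}{\partial\theta_i^t}-a_t\frac{\partial f}{\partial\theta_i^{s_k}}\Big)d\theta_i^t .$$ A function is qS-differentiable on an open set if it is Fréchet-differentiable there and $d''f\equiv0$. Notation. $(y-b)^I=(y_1-b_1)^{i_1}\cdots(y_n-b_n)^{i_n}$ for $I=(i_1,\dots,i_n)$. For $\theta_j\in\Lambda_1$, $Z_k(\theta_j)=\sum_{i=s_k}^{s_{k+1}-1}\theta_j^i a_i\in\Lambda_0$. For $J_k=(j_k^1,\dots,j_k^m)\in\mathbb N^m$, $(Z_k(\theta-\beta))^{J_k}=(Z_k(\theta_1-\beta_1))^{j_k^1}\cdots(Z_k(\theta_m-\beta_m))^{j_k^m}$. Derivatives: $\partial^{|I|}/\partial y^I=\partial^{|I|}/\partial(y_1^0)^{i_1}\cdots\partial(y_n^0)^{i_n}$ and $\partial^{|J_k|}/\partial(Z_k\theta)^{J_k}=\partial^{|J_k|}/\partial(\theta_1^{s_k})^{j_k^1}\cdots\partial(\theta_m^{s_k})^{j_k^m}$. A polydisc is a product of open balls, one in each factor $\Lambda_0$ or $\Lambda_1$. The domain of convergence is the interior of the set of points where the series converges absolutely. *)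

theory Defs
  imports "HOL-Analysis.Analysis"
begin

text \<open>The grading is given by \<open>L :: nat \<Rightarrow> 'a set\<close>, of which only \<open>L 0\<close> and \<open>L 1\<close> matter.\<close>

definition comm_superalgebra :: "(nat \<Rightarrow> 'a::real_algebra_1 set) \<Rightarrow> bool" where
  "comm_superalgebra L \<longleftrightarrow>
     subspace (L 0) \<and> subspace (L 1) \<and>
     L 0 \<inter> L 1 = {0} \<and> (\<forall>x. \<exists>u\<in>L 0. \<exists>v\<in>L 1. x = u + v) \<and>
     (\<forall>i\<in>{0,1}. \<forall>j\<in>{0,1}. \<forall>x\<in>L i. \<forall>y\<in>L j.
        x * y \<in> L ((i + j) mod 2) \<and> x * y = (-1) ^ (i * j) * (y * x))"

definition basis_family :: "(nat \<Rightarrow> 'a::real_vector) \<Rightarrow> nat set \<Rightarrow> 'a set \<Rightarrow> bool" where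
  "basis_family B K S \<longleftrightarrow> inj_on B K \<and> independent (B ` K) \<and> span (B ` K) = S"

definition cond_A0 :: "(nat \<Rightarrow> 'a::real_algebra_1 set) \<Rightarrow> nat \<Rightarrow> (nat \<Rightarrow> 'a) \<Rightarrow> bool" where
  "cond_A0 L p e \<longleftrightarrow>
     basis_family e {0..p} (L 0) \<and> e 0 = 1 \<and> (\<Sum>k=0..p. e k ^ 2) = 0"

text \<open>The case \<open>q = 0\<close>, \<open>r = 0\<close> of a purely even algebra is included.\<close>

definition cond_A1 ::
  "(nat \<Rightarrow> 'a::real_algebra_1 set) \<Rightarrow> nat \<Rightarrow> (nat \<Rightarrow> 'a) \<Rightarrow> nat \<Rightarrow> (nat \<Rightarrow> nat) \<Rightarrow> (nat \<Rightarrow> 'a) \<Rightarrow> bool"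
where
  "cond_A1 L q \<epsilon> r s a \<longleftrightarrow>
     basis_family \<epsilon> {1..q} (L 1) \<and>
     s 1 = 1 \<and> s (r + 1) = q + 1 \<and> (\<forall>k\<in>{1..r}. s k < s (k + 1)) \<and>
     (\<forall>j\<in>{1..q}. a j \<in> L 0) \<and>
     (\<forall>k\<in>{1..r}. a (s k) = 1 \<and>
        (\<forall>j\<in>{s k..<s (k + 1)}. \<epsilon> j = a j * \<epsilon> (s k)) \<and>
        (\<Sum>j\<in>{s k..<s (k + 1)}. a j ^ 2) = 0)"

definition orthonormal_bases ::
  "nat \<Rightarrow> (nat \<Rightarrow> 'a::real_inner) \<Rightarrow> nat \<Rightarrow> (nat \<Rightarrow> 'a) \<Rightarrow> bool" where
  "orthonormal_bases p e q \<epsilon> \<longleftrightarrow>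
     (\<forall>j\<in>{0..p}. \<forall>k\<in>{0..p}. inner (e j) (e k) = (if j = k then 1 else 0)) \<and>
     (\<forall>j\<in>{1..q}. \<forall>k\<in>{1..q}. inner (\<epsilon> j) (\<epsilon> k) = (if j = k then 1 else 0)) \<and>
     (\<forall>j\<in>{0..p}. \<forall>k\<in>{1..q}. inner (e j) (\<epsilon> k) = 0)"

type_synonym ('a, 'n, 'm) superpoint = "('a, 'n) vec \<times> ('a, 'm) vec"

text \<open>
  Index types are never empty. In order to allow \<open>n = 0\<close> or \<open>m = 0\<close>, the even variables are
  indexed by a subset \<open>N\<close> and the odd ones by a subset \<open>M\<close> of a finite linearly ordered type, with
  \<open>n = card N\<close> and \<open>m = card M\<close>; the components outside \<open>N\<close> and \<open>M\<close> vanish.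
\<close>

definition superspace ::
  "(nat \<Rightarrow> 'a::real_vector set) \<Rightarrow> 'n set \<Rightarrow> 'm set \<Rightarrow> ('a, 'n::finite, 'm::finite) superpoint set"
where
  "superspace L N M =
     {(y, \<theta>). (\<forall>i. y $ i \<in> (if i \<in> N then L 0 else {0})) \<and>
              (\<forall>j. \<theta> $ j \<in> (if j \<in> M then L 1 else {0}))}"

definition polydisc ::
  "(nat \<Rightarrow> 'a::real_normed_vector set) \<Rightarrow> 'n set \<Rightarrow> 'm set \<Rightarrow> ('a, 'n::finite, 'm::finite) superpoint
     \<Rightarrow> ('n \<Rightarrow> real) \<Rightarrow> ('m \<Rightarrow> real) \<Rightarrow> ('a, 'n, 'm) superpoint set"
where
  "polydisc L N M c R S =
     {x \<in> superspace L N M. (\<forall>i\<in>N. norm (fst x $ i - fst c $ i) < R i) \<and>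
                             (\<forall>j\<in>M. norm (snd x $ j - snd c $ j) < S j)}"

definition coord :: "(nat \<Rightarrow> 'a::real_vector) \<Rightarrow> nat set \<Rightarrow> 'a \<Rightarrow> nat \<Rightarrow> real" where
  "coord B K v k = representation (B ` K) v (B k)"

definition even_dir :: "(nat \<Rightarrow> 'a::real_vector) \<Rightarrow> 'n \<Rightarrow> nat \<Rightarrow> ('a, 'n::finite, 'm::finite) superpoint" where
  "even_dir e i k = (axis i (e k), 0)"

definition odd_dir :: "(nat \<Rightarrow> 'a::real_vector) \<Rightarrow> 'm \<Rightarrow> nat \<Rightarrow> ('a, 'n::finite, 'm::finite) superpoint" where
  "odd_dir \<epsilon> j l = (0, axis j (\<epsilon> l))"

text \<open>
  \<open>\<partial>f/\<partial>y\<^sub>i\<^sup>k\<close> and \<open>\<partial>f/\<partial>\<theta>\<^sub>j\<^sup>l\<close> are the directional derivatives along \<open>even_dir e i k\<close> and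
  \<open>odd_dir \<epsilon> j l\<close>. Since these lie in the superspace, only the values of \<open>f\<close> on the (relatively
  open) domain enter.
\<close>

definition dir_deriv ::
  "'v::real_normed_vector \<Rightarrow> ('v \<Rightarrow> 'a::real_normed_vector) \<Rightarrow> 'v \<Rightarrow> 'a" where
  "dir_deriv v f x = vector_derivative (\<lambda>t. f (x + t *\<^sub>R v)) (at 0)"

text \<open>The \<open>\<Lambda>\<close>-valued one-form \<open>d''f\<close> at \<open>x\<close>, evaluated at the tangent vector \<open>h\<close>.\<close>

definition d_second ::
  "nat \<Rightarrow> (nat \<Rightarrow> 'a::{real_algebra_1,euclidean_space}) \<Rightarrow> nat \<Rightarrow> (nat \<Rightarrow> 'a) \<Rightarrow> nat \<Rightarrow> (nat \<Rightarrow> nat)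
     \<Rightarrow> (nat \<Rightarrow> 'a) \<Rightarrow> 'n set \<Rightarrow> 'm set
     \<Rightarrow> (('a, 'n::finite, 'm::finite) superpoint \<Rightarrow> 'a) \<Rightarrow> ('a, 'n, 'm) superpoint \<Rightarrow> ('a, 'n, 'm) superpoint \<Rightarrow> 'a"
where
  "d_second p e q \<epsilon> r s a N M f x h =
     (\<Sum>i\<in>N. \<Sum>j\<in>{1..p}.
        coord e {0..p} (fst h $ i) j *\<^sub>R
          (dir_deriv (even_dir e i j) f x - e j * dir_deriv (even_dir e i 0) f x)) +
     (\<Sum>i\<in>M. \<Sum>k\<in>{1..r}. \<Sum>t\<in>{s k<..<s (k + 1)}.
        coord \<epsilon> {1..q} (snd h $ i) t *\<^sub>R
          (dir_deriv (odd_dir \<epsilon> i t) f x - a t * dir_deriv (odd_dir \<epsilon> i (s k)) f x))"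

text \<open>
  For \<open>D\<close> relatively open in the superspace, \<open>f differentiable_on D\<close> is Frechet differentiability
  at every point of \<open>D\<close> of \<open>f\<close> as a function on an open subset of the superspace.
\<close>

definition qS_differentiable_on ::
  "(nat \<Rightarrow> 'a set) \<Rightarrow> nat \<Rightarrow> (nat \<Rightarrow> 'a::{real_algebra_1,euclidean_space}) \<Rightarrow> nat \<Rightarrow> (nat \<Rightarrow> 'a) \<Rightarrow> nat
     \<Rightarrow> (nat \<Rightarrow> nat) \<Rightarrow> (nat \<Rightarrow> 'a) \<Rightarrow> 'n set \<Rightarrow> 'm set
     \<Rightarrow> (('a, 'n::finite, 'm::finite) superpoint \<Rightarrow> 'a) \<Rightarrow> ('a, 'n, 'm) superpoint set \<Rightarrow> bool"
where
  "qS_differentiable_on L p e q \<epsilon> r s a N M f D \<longleftrightarrow>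
     openin (top_of_set (superspace L N M)) D \<and>
     f differentiable_on D \<and>
     (\<forall>x\<in>D. \<forall>h\<in>superspace L N M. d_second p e q \<epsilon> r s a N M f x h = 0)"

definition Z_map ::
  "nat \<Rightarrow> (nat \<Rightarrow> 'a::real_algebra_1) \<Rightarrow> (nat \<Rightarrow> nat) \<Rightarrow> (nat \<Rightarrow> 'a) \<Rightarrow> nat \<Rightarrow> 'a \<Rightarrow> 'a" where
  "Z_map q \<epsilon> s a k v = (\<Sum>i\<in>{s k..<s (k + 1)}. coord \<epsilon> {1..q} v i *\<^sub>R a i)"

text \<open>Products are taken over lists because multiplication in \<open>'a\<close> is not commutative.\<close>

definition multi_power ::
  "'i::{finite,linorder} set \<Rightarrow> ('i \<Rightarrow> 'a::monoid_mult) \<Rightarrow> ('i \<Rightarrow> nat) \<Rightarrow> 'a" where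
  "multi_power K x I = prod_list (map (\<lambda>i. x i ^ I i) (sorted_list_of_set K))"

text \<open>
  A multi-index is a pair \<open>(I, J)\<close> with \<open>I i\<close> the exponent of the \<open>i\<close>-th even variable and
  \<open>J k j\<close> the \<open>j\<close>-th component of \<open>J\<^sub>k\<close>; entries without meaning are 0.
\<close>

definition multi_indices ::
  "nat \<Rightarrow> 'n set \<Rightarrow> 'm set \<Rightarrow> (('n \<Rightarrow> nat) \<times> (nat \<Rightarrow> 'm \<Rightarrow> nat)) set" where
  "multi_indices r N M =
     {(I, J). (\<forall>i. i \<notin> N \<longrightarrow> I i = 0) \<and> (\<forall>k j. \<not> (k \<in> {1..r} \<and> j \<in> M) \<longrightarrow> J k j = 0)}"

definition super_term ::
  "nat \<Rightarrow> (nat \<Rightarrow> 'a::{real_algebra_1,euclidean_space}) \<Rightarrow> nat \<Rightarrow> (nat \<Rightarrow> nat) \<Rightarrow> (nat \<Rightarrow> 'a)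
     \<Rightarrow> 'n set \<Rightarrow> 'm set \<Rightarrow> (('n \<Rightarrow> nat) \<times> (nat \<Rightarrow> 'm \<Rightarrow> nat) \<Rightarrow> 'a)
     \<Rightarrow> ('a, 'n::{finite,linorder}, 'm::{finite,linorder}) superpoint \<Rightarrow> ('a, 'n, 'm) superpoint
     \<Rightarrow> ('n \<Rightarrow> nat) \<times> (nat \<Rightarrow> 'm \<Rightarrow> nat) \<Rightarrow> 'a"
where
  "super_term q \<epsilon> r s a N M A c x = (\<lambda>(I, J).
     A (I, J) * multi_power N (\<lambda>i. fst x $ i - fst c $ i) I *
     prod_list (map (\<lambda>k. multi_power M (\<lambda>j. Z_map q \<epsilon> s a k (snd x $ j - snd c $ j)) (J k))
                    [1..<r + 1]))"

definition converges_absolutely_at ::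
  "nat \<Rightarrow> (nat \<Rightarrow> 'a::{real_algebra_1,euclidean_space}) \<Rightarrow> nat \<Rightarrow> (nat \<Rightarrow> nat) \<Rightarrow> (nat \<Rightarrow> 'a)
     \<Rightarrow> 'n set \<Rightarrow> 'm set \<Rightarrow> (('n \<Rightarrow> nat) \<times> (nat \<Rightarrow> 'm \<Rightarrow> nat) \<Rightarrow> 'a)
     \<Rightarrow> ('a, 'n::{finite,linorder}, 'm::{finite,linorder}) superpoint \<Rightarrow> ('a, 'n, 'm) superpoint \<Rightarrow> bool"
where
  "converges_absolutely_at q \<epsilon> r s a N M A c x \<longleftrightarrow>
     (\<lambda>IJ. norm (super_term q \<epsilon> r s a N M A c x IJ)) summable_on multi_indices r N M"

definition domain_of_convergence ::
  "(nat \<Rightarrow> 'a set) \<Rightarrow> nat \<Rightarrow> (nat \<Rightarrow> 'a::{real_algebra_1,euclidean_space}) \<Rightarrow> nat \<Rightarrow> (nat \<Rightarrow> nat)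
     \<Rightarrow> (nat \<Rightarrow> 'a) \<Rightarrow> 'n set \<Rightarrow> 'm set \<Rightarrow> (('n \<Rightarrow> nat) \<times> (nat \<Rightarrow> 'm \<Rightarrow> nat) \<Rightarrow> 'a)
     \<Rightarrow> ('a, 'n::{finite,linorder}, 'm::{finite,linorder}) superpoint \<Rightarrow> ('a, 'n, 'm) superpoint set"
where
  "domain_of_convergence L q \<epsilon> r s a N M A c =
     top_of_set (superspace L N M) interior_of
       {x \<in> superspace L N M. converges_absolutely_at q \<epsilon> r s a N M A c x}"

text \<open>
  \<open>has_iter_deriv D [v\<^sub>1, \<dots>, v\<^sub>l] f g\<close>: on \<open>D\<close> the iterated derivative
  \<open>\<partial>\<^bsub>v\<^sub>1\<^esub> (\<dots> (\<partial>\<^bsub>v\<^sub>l\<^esub> f))\<close> and all the intermediate ones exist, and the former is \<open>g\<close>.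
\<close>

primrec has_iter_deriv ::
  "'v::real_normed_vector set \<Rightarrow> 'v list \<Rightarrow> ('v \<Rightarrow> 'a::real_normed_vector) \<Rightarrow> ('v \<Rightarrow> 'a) \<Rightarrow> bool"
where
  "has_iter_deriv D [] f g \<longleftrightarrow> (\<forall>x\<in>D. g x = f x)"
| "has_iter_deriv D (v # vs) f g \<longleftrightarrow>
     (\<exists>h. has_iter_deriv D vs f h \<and>
          (\<forall>x\<in>D. ((\<lambda>t. h (x + t *\<^sub>R v)) has_vector_derivative g x) (at 0)))"

definition deriv_dirs ::
  "(nat \<Rightarrow> 'a::real_vector) \<Rightarrow> (nat \<Rightarrow> 'a) \<Rightarrow> nat \<Rightarrow> (nat \<Rightarrow> nat) \<Rightarrow> 'n set \<Rightarrow> 'm set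
     \<Rightarrow> ('n \<Rightarrow> nat) \<Rightarrow> (nat \<Rightarrow> 'm \<Rightarrow> nat)
     \<Rightarrow> ('a, 'n::{finite,linorder}, 'm::{finite,linorder}) superpoint list"
where
  "deriv_dirs e \<epsilon> r s N M I J =
     concat (map (\<lambda>i. replicate (I i) (even_dir e i 0)) (sorted_list_of_set N)) @
     concat (map (\<lambda>k. concat (map (\<lambda>j. replicate (J k j) (odd_dir \<epsilon> j (s k)))
                                  (sorted_list_of_set M)))
                 [1..<r + 1])"

definition multi_fact :: "'i set \<Rightarrow> ('i \<Rightarrow> nat) \<Rightarrow> real" where
  "multi_fact K I = (\<Prod>i\<in>K. fact (I i))"

end

theory Submission
  imports Defs "HOL-Complex_Analysis.Complex_Analysis"
begin

text \<open>
  Since \<open>\<Sum> e\<^sub>k\<^sup>2 = 0\<close> with \<open>e\<^sub>0 = 1\<close>, no algebra homomorphism \<open>\<omega> : \<Lambda>\<^sub>0 \<rightarrow> \<complex>\<close> (a character) is real-valued,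
  and every nonzero \<open>\<Lambda>\<^sub>0\<close>-submodule \<open>S\<close> of \<open>\<Lambda>\<close> carries a nonzero functional \<open>\<phi>\<close> with
  \<open>\<phi>(b x) = \<omega>(b) \<phi>(x)\<close>. For an \<open>S\<close>-valued qS-differentiable \<open>f\<close> the function \<open>\<phi> \<circ> f\<close> depends only on the
  complex numbers \<open>\<omega>(Z\<^sub>\<beta> h)\<close>, one for every block \<open>\<beta>\<close> of real variables (an even variable, or
  one \<open>Z\<^sub>k(\<theta>\<^sub>j)\<close>), and is holomorphic in each of them. Because \<open>\<Sum> a\<^sub>j\<^sup>2 = 0\<close> in the block, \<open>\<omega> \<circ> Z\<^sub>\<beta>\<close> maps
  balls to discs, so the power series of \<open>\<phi> \<circ> f\<close> converges on the whole polydisc. An idempotent of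
  \<open>\<Lambda>\<^sub>0\<close> that isolates \<open>\<omega>\<close> lifts its coefficients to \<open>S\<close> without spoiling convergence; subtracting the
  lifted series leaves a function with values in the smaller submodule \<open>S \<inter> ker \<phi>\<close>.

  For the converse, absolute convergence at a point \<open>h\<^sub>1\<close> near \<open>h\<^sub>0\<close> at which all characters of all
  \<open>Z\<^sub>\<beta>\<close> are larger in modulus than at \<open>h\<^sub>0\<close> makes \<open>Z\<^sub>\<beta>(h) / Z\<^sub>\<beta>(h\<^sub>1)\<close> have spectral radius less than 1 for
  \<open>h\<close> near \<open>h\<^sub>0\<close>, hence the series and its derivatives converge uniformly there.
\<close>

section \<open>Characters of the even part\<close>

text \<open>The obstacle is the sharp domain. Estimating powers of Z in the norm of \<Lambda> would
  lose a constant factor in the radius, because the Euclidean norm need not be submultiplicative.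
  Characters lose nothing, but they see \<Lambda>_0 only modulo nilpotent elements; therefore one
  component is expanded at a time and the remainder is treated again in lower dimension. Nilpotent
  parts cost only polynomial factors in the powers, which is why bounds have the form C * \<rho>^n
  with \<rho> strictly above the character values. Frechet differentiability supplies continuity,
  hence bounds on compact sets, and together with separate holomorphy these carry the expansion in
  several complex variables. Finally, power series live on products, while a Euclidean ball in
  \<Lambda>_1 is not a product over its blocks. So the expansion is proved on products of block
  balls, every point of the polydisc is put into such a product around the centre, and the
  coefficients are identified through iterated derivatives at the centre.\<close>

lemma bounded_bilinear_times:
  "bounded_bilinear ((*) :: 'a::{real_algebra_1,euclidean_space} \<Rightarrow> 'a \<Rightarrow> 'a)"
proof -
  have "bilinear ((*) :: 'a \<Rightarrow> 'a \<Rightarrow> 'a)"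
    unfolding bilinear_def by (auto intro!: linearI simp: algebra_simps)
  then show ?thesis by (simp add: bilinear_conv_bounded_bilinear)
qed

text \<open>The Euclidean norm need not be submultiplicative, so the product estimates below carry
  this constant; \<open>B \<ge> 1\<close> makes it safe to multiply inequalities by it.\<close>

lemma mult_norm_bound:
  obtains B :: real where "B \<ge> 1"
    "\<And>x y :: 'a::{real_algebra_1,euclidean_space}. norm (x * y) \<le> B * norm x * norm y"
proof -
  obtain K where K: "\<And>x y :: 'a. norm (x * y) \<le> norm x * norm y * K" "K \<ge> 0"
    using bounded_bilinear.nonneg_bounded[OF bounded_bilinear_times] by blast
  show ?thesis
  proof (rule that[of "max 1 K"])
    fix x y :: 'a
    have "norm x * norm y * K \<le> norm x * norm y * max 1 K"
      by (intro mult_left_mono) auto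
    with K(1)[of x y] show "norm (x * y) \<le> max 1 K * norm x * norm y"
      by (simp add: mult_ac)
  qed simp
qed

lemma linear_mult_right: "linear (\<lambda>x. x * b)" for b :: "'a::real_algebra_1"
  by (auto intro!: linearI simp: algebra_simps)

text \<open>\<open>poly_act b p \<phi>\<close> is \<open>p(T) \<phi>\<close> for the operator \<open>T \<phi> = \<phi> \<circ> (b *)\<close> on functionals.\<close>

definition poly_act :: "'a::real_algebra_1 \<Rightarrow> complex poly \<Rightarrow> ('a \<Rightarrow> complex) \<Rightarrow> 'a \<Rightarrow> complex" where
  "poly_act b p \<phi> x = (\<Sum>i\<le>degree p. coeff p i * \<phi> (b ^ i * x))"

lemma poly_act_bound:
  assumes "degree p \<le> n"
  shows "poly_act b p \<phi> x = (\<Sum>i\<le>n. coeff p i * \<phi> (b ^ i * x))"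
  unfolding poly_act_def using assms
  by (intro sum.mono_neutral_left) (auto simp: coeff_eq_0 not_le)

text \<open>Used to read off eigenfunctionals: if (T - z) q(T) annihilates \<phi>, then q(T) \<phi>
  is an eigenfunctional of T for z. Applying T raises each power of b by one, which shifts the
  coefficients to \<open>pCons 0 q\<close>.\<close>

lemma poly_act_linear_factor:
  "poly_act b ([:- z, 1:] * q) \<phi> x = poly_act b q \<phi> (b * x) - z * poly_act b q \<phi> x"
proof -
  have "degree ([:- z, 1:] * q) \<le> Suc (degree q)"
    using degree_mult_le[of "[:- z, 1:]" q] by simp
  then have "poly_act b ([:- z, 1:] * q) \<phi> x =
      (\<Sum>i\<le>Suc (degree q). coeff ([:- z, 1:] * q) i * \<phi> (b ^ i * x))"
    by (rule poly_act_bound)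
  also have "\<dots> = (\<Sum>i\<le>Suc (degree q). coeff (pCons 0 q) i * \<phi> (b ^ i * x)) -
      z * (\<Sum>i\<le>Suc (degree q). coeff q i * \<phi> (b ^ i * x))"
    by (simp add: sum_subtractf sum_distrib_left algebra_simps sum.distrib)
  also have "(\<Sum>i\<le>Suc (degree q). coeff (pCons 0 q) i * \<phi> (b ^ i * x)) = poly_act b q \<phi> (b * x)"
    unfolding poly_act_def
    by (subst sum.atMost_Suc_shift) (simp add: mult.assoc power_commutes[symmetric] del: sum.atMost_Suc)
  also have "(\<Sum>i\<le>Suc (degree q). coeff q i * \<phi> (b ^ i * x)) = poly_act b q \<phi> x"
    by (rule poly_act_bound[symmetric]) simp
  finally show ?thesis .
qed

lemma linear_poly_act:
  assumes "linear \<phi>"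
  shows "linear (poly_act b p \<phi>)"
proof -
  interpret linear \<phi> by fact
  show ?thesis
    unfolding poly_act_def
    by (rule linearI) (simp_all add: algebra_simps add scale sum.distrib sum_distrib_left scaleR_sum_right)
qed

text \<open>The powers of b cannot all be independent in finite dimension; the first one that
  depends on its predecessors supplies p. As the relation holds inside the algebra, one p serves all
  functionals and all x.\<close>

lemma annihilating_polynomial:
  fixes b :: "'a::{real_algebra_1,euclidean_space}"
  obtains p where "p \<noteq> 0" "\<And>\<phi> x. linear \<phi> \<Longrightarrow> poly_act b p \<phi> x = 0"
proof -
  have "\<exists>n. b ^ n \<in> span ((^) b ` {..<n})"
  proof (rule ccontr)
    assume "\<nexists>n. b ^ n \<in> span ((^) b ` {..<n})"
    then have *: "b ^ n \<notin> span ((^) b ` {..<n})" for n by blast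
    have "independent ((^) b ` {..<n}) \<and> card ((^) b ` {..<n}) = n" for n
    proof (induction n)
      case 0
      then show ?case using independent_empty by simp
    next
      case (Suc n)
      have "b ^ n \<notin> (^) b ` {..<n}" using *[of n] by (metis span_base)
      moreover have "independent (insert (b ^ n) ((^) b ` {..<n}))"
        by (rule independent_insertI[OF *]) (rule conjunct1[OF Suc])
      moreover have "card ((^) b ` {..<n}) = n" by (rule conjunct2[OF Suc])
      ultimately show ?case
        unfolding lessThan_Suc image_insert by (subst card_insert_disjoint) auto
    qed
    from this[of "Suc DIM('a)"] show False
      using independent_bound[of "(^) b ` {..<Suc DIM('a)}"] by linarith
  qed
  then have ex: "\<exists>n. b ^ n \<in> span ((^) b ` {..<n})" .
  define n where "n = (LEAST n. b ^ n \<in> span ((^) b ` {..<n}))"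
  have n: "b ^ n \<in> span ((^) b ` {..<n})"
    unfolding n_def using ex by (rule LeastI_ex)
  \<comment> \<open>Minimality of n: a power equal to an earlier one would lie in the span of its
    predecessors. Injectivity turns the combination over the set of powers into one over
    exponents.\<close>
  have inj: "inj_on ((^) b) {..<n}"
  proof (rule linorder_inj_onI')
    fix i j assume "i \<in> {..<n}" "j \<in> {..<n}" "i < j"
    then have "b ^ j \<notin> span ((^) b ` {..<j})"
      using not_less_Least[of j "\<lambda>n. b ^ n \<in> span ((^) b ` {..<n})"] by (auto simp: n_def)
    with \<open>i < j\<close> show "b ^ i \<noteq> b ^ j"
      using span_base[of "b ^ i" "(^) b ` {..<j}"] by auto
  qed
  from n obtain u where "b ^ n = (\<Sum>v\<in>(^) b ` {..<n}. u v *\<^sub>R v)"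
    by (subst (asm) span_finite) auto
  then have bn: "b ^ n = (\<Sum>i<n. u (b ^ i) *\<^sub>R b ^ i)"
    by (simp add: sum.reindex[OF inj])
  define p :: "complex poly" where "p = monom 1 n - (\<Sum>i<n. monom (of_real (u (b ^ i))) i)"
  have cf: "coeff p i = (if i = n then 1 else if i < n then - of_real (u (b ^ i)) else 0)" for i
    by (auto simp: p_def coeff_sum sum.delta)
  have deg: "degree p \<le> n" by (rule degree_le) (auto simp: cf)
  show ?thesis
  proof (rule that)
    show "p \<noteq> 0" using cf[of n] by auto
    fix \<phi> :: "'a \<Rightarrow> complex" and x assume "linear \<phi>"
    then interpret linear \<phi> .
    have "poly_act b p \<phi> x = (\<Sum>i<n. - of_real (u (b ^ i)) * \<phi> (b ^ i * x)) + \<phi> (b ^ n * x)"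
      by (simp add: poly_act_bound[OF deg] cf atMost_Suc lessThan_Suc_atMost[symmetric])
    also have "\<phi> (b ^ n * x) = (\<Sum>i<n. of_real (u (b ^ i)) * \<phi> (b ^ i * x))"
      unfolding bn by (simp add: sum_distrib_right sum scale scaleR_conv_of_real[of _ "_ :: complex"])
    finally show "poly_act b p \<phi> x = 0"
      by (simp add: sum_negf)
  qed
qed

lemma complex_poly_linear_factor:
  assumes "degree p = Suc d"
  obtains z q where "p = [:- z, 1 :: complex:] * q" "degree q = d"
proof -
  have "coeff p (Suc d) \<noteq> 0" using assms by (metis leading_coeff_neq_0 degree_0 nat.distinct(1))
  then have "\<exists>i\<in>{1..Suc d}. coeff p i \<noteq> 0" by (intro bexI[of _ "Suc d"]) auto
  then obtain z where "(\<Sum>i\<le>Suc d. coeff p i * z ^ i) = 0"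
    using fundamental_theorem_of_algebra[of "coeff p" "Suc d"] by metis
  then have "poly p z = 0" by (simp add: poly_altdef assms del: sum.atMost_Suc)
  then obtain q where q: "p = [:- z, 1:] * q" by (auto simp: poly_eq_0_iff_dvd dvd_def)
  moreover have "q \<noteq> 0" using assms q by auto
  then have "degree p = Suc (degree q)" unfolding q by (subst degree_mult_eq) auto
  ultimately show ?thesis using that assms by auto
qed

text \<open>Strip linear factors off p as long as the quotient still annihilates \<phi> on S. This
  stops before degree 0, where the action is multiplication by a nonzero constant and
  \<open>\<phi> x0 \<noteq> 0\<close>. At the first quotient that does not annihilate, the factor X
  - z just removed gives the eigenvalue.\<close>

lemma eigenfunctional:
  assumes "linear \<phi>" "p \<noteq> 0" "\<And>x. x \<in> S \<Longrightarrow> poly_act b p \<phi> x = 0" "x0 \<in> S" "\<phi> x0 \<noteq> 0"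
    and S: "\<And>x. x \<in> S \<Longrightarrow> b * x \<in> S"
  shows "\<exists>z q. (\<exists>x\<in>S. poly_act b q \<phi> x \<noteq> 0) \<and>
    (\<forall>x\<in>S. poly_act b q \<phi> (b * x) = z * poly_act b q \<phi> x)"
  using assms(2,3)
proof (induction "degree p" arbitrary: p)
  case 0
  then have "poly_act b p \<phi> x0 = coeff p 0 * \<phi> x0" by (simp add: poly_act_def)
  moreover have "coeff p 0 \<noteq> 0" using 0(1,2) by (metis leading_coeff_0_iff)
  ultimately show ?case using 0 assms(4,5) by auto
next
  case (Suc d)
  obtain z q where q: "p = [:- z, 1:] * q" and dq: "degree q = d"
    using complex_poly_linear_factor[OF Suc(2)[symmetric]] .
  have eq: "\<forall>x\<in>S. poly_act b q \<phi> (b * x) = z * poly_act b q \<phi> x"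
    using Suc(4) unfolding q poly_act_linear_factor by simp
  show ?case
  proof (cases "\<exists>x\<in>S. poly_act b q \<phi> x \<noteq> 0")
    case True
    with eq show ?thesis by blast
  next
    case False
    have "q \<noteq> 0" using Suc(3) q by auto
    with Suc(1)[OF dq[symmetric]] False show ?thesis by blast
  qed
qed

text \<open>Elements of \<open>L0\<close> commute with the whole algebra and not only with each
  other. This makes \<Lambda> a module over the commutative ring \<open>L0\<close>, with
  \<Lambda>-valued coefficients that can be moved past elements of \<open>L0\<close>.\<close>

locale even_algebra =
  fixes L0 :: "'a::{real_algebra_1,euclidean_space} set"
  assumes subspace_L0: "subspace L0" and one_L0: "1 \<in> L0"
    and mult_L0: "\<And>x y. x \<in> L0 \<Longrightarrow> y \<in> L0 \<Longrightarrow> x * y \<in> L0"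
    and central: "\<And>x y. x \<in> L0 \<Longrightarrow> x * y = y * x"
    and isotropic: "\<exists>(e :: nat \<Rightarrow> 'a) p. (\<forall>k\<in>{0..p}. e k \<in> L0) \<and> e 0 = 1 \<and> (\<Sum>k=0..p. e k ^ 2) = 0"
begin

section \<open>Submodules, characters and common eigenfunctionals\<close>

lemma power_L0: "x \<in> L0 \<Longrightarrow> x ^ n \<in> L0"
  by (induction n) (auto intro: one_L0 mult_L0)

definition submodule :: "'a set \<Rightarrow> bool" where
  "submodule S \<longleftrightarrow> subspace S \<and> (\<forall>b\<in>L0. \<forall>x\<in>S. b * x \<in> S)"

text \<open>Real-linear on all of \<open>'a\<close>, so that linearity can be used without side
  conditions; only the values on \<open>L0\<close> carry meaning, and multiplicativity is required
  there alone.\<close>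

definition character :: "('a \<Rightarrow> complex) \<Rightarrow> bool" where
  "character \<omega> \<longleftrightarrow> linear \<omega> \<and> \<omega> 1 = 1 \<and> (\<forall>x\<in>L0. \<forall>y\<in>L0. \<omega> (x * y) = \<omega> x * \<omega> y)"

lemma character_power: "character \<omega> \<Longrightarrow> x \<in> L0 \<Longrightarrow> \<omega> (x ^ n) = \<omega> x ^ n"
  by (induction n) (auto simp: character_def power_L0)

text \<open>Commuting operators have a common eigenvector, here among the functionals on the
  quotient of S by \<open>S0\<close>. One element b at a time, \<phi> is replaced by q(T) \<phi>.
  This still vanishes on the submodule \<open>S0\<close>, and it keeps the earlier eigenvalues
  because multiplications by elements of \<open>L0\<close> commute.\<close>

lemma common_eigenfunctional:
  assumes "finite B" "B \<subseteq> L0" "submodule S" "submodule S0" "S0 \<subseteq> S" "S0 \<noteq> S"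
  shows "\<exists>\<psi> :: 'a \<Rightarrow> complex. linear \<psi> \<and> (\<exists>x\<in>S. \<psi> x \<noteq> 0) \<and> (\<forall>x\<in>S0. \<psi> x = 0) \<and>
    (\<forall>b\<in>B. \<exists>z. \<forall>x\<in>S. \<psi> (b * x) = z * \<psi> x)"
  using assms(1,2)
proof (induction rule: finite_induct)
  case empty
  obtain s where s: "s \<in> S" "s \<notin> S0" using assms by blast
  have span: "span S0 = S0" using assms(4) by (simp add: submodule_def)
  \<comment> \<open>The component of s orthogonal to \<open>S0\<close> defines, through the inner
    product, a functional that vanishes on \<open>S0\<close> but not at s.\<close>
  obtain y z where yz: "y \<in> S0" "\<And>w. w \<in> S0 \<Longrightarrow> orthogonal z w" "s = y + z"
    using orthogonal_subspace_decomp_exists[of S0 s] unfolding span by blast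
  have "z \<noteq> 0" using yz s by auto
  define \<psi> where "\<psi> x = complex_of_real (z \<bullet> x)" for x
  have "\<psi> s \<noteq> 0" using yz \<open>z \<noteq> 0\<close> by (auto simp: \<psi>_def inner_add_right orthogonal_def)
  moreover have "linear \<psi>" unfolding \<psi>_def
    by (auto intro!: linearI simp: inner_add_right scaleR_conv_of_real[of _ "_ :: complex"])
  moreover have "\<forall>x\<in>S0. \<psi> x = 0" using yz by (auto simp: \<psi>_def orthogonal_def)
  ultimately show ?case using s(1) by (intro exI[of _ \<psi>] conjI bexI[of _ s]) auto
next
  case (insert b B)
  then obtain \<phi> :: "'a \<Rightarrow> complex" and x0 where \<phi>: "linear \<phi>" "x0 \<in> S" "\<phi> x0 \<noteq> 0" "\<forall>x\<in>S0. \<phi> x = 0"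
    "\<forall>b\<in>B. \<exists>z. \<forall>x\<in>S. \<phi> (b * x) = z * \<phi> x" by auto
  have b: "b \<in> L0" using insert by auto
  obtain p where p: "p \<noteq> 0" "\<And>\<phi> x. linear \<phi> \<Longrightarrow> poly_act b p \<phi> x = 0"
    using annihilating_polynomial[of b] by blast
  obtain z q where q: "\<exists>x\<in>S. poly_act b q \<phi> x \<noteq> 0"
    "\<And>x. x \<in> S \<Longrightarrow> poly_act b q \<phi> (b * x) = z * poly_act b q \<phi> x"
    using eigenfunctional[of \<phi> p S b x0] p \<phi> b assms(3) unfolding submodule_def by blast
  have "\<forall>x\<in>S0. poly_act b q \<phi> x = 0"
    using \<phi>(4) assms(4) b power_L0 unfolding poly_act_def submodule_def by simp
  moreover have "\<forall>c\<in>B. \<exists>z. \<forall>x\<in>S. poly_act b q \<phi> (c * x) = z * poly_act b q \<phi> x"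
  proof
    fix c assume c: "c \<in> B"
    then obtain w where w: "\<And>x. x \<in> S \<Longrightarrow> \<phi> (c * x) = w * \<phi> x" using \<phi>(5) by blast
    have "\<phi> (b ^ i * (c * x)) = w * \<phi> (b ^ i * x)" if "x \<in> S" for x i
    proof -
      have "b ^ i * (c * x) = c * (b ^ i * x)"
        using power_L0[OF b, of i] central by (metis mult.assoc)
      moreover have "b ^ i * x \<in> S"
        using that power_L0[OF b] assms(3) by (auto simp: submodule_def)
      ultimately show ?thesis using w by simp
    qed
    then have "\<forall>x\<in>S. poly_act b q \<phi> (c * x) = w * poly_act b q \<phi> x"
      by (simp add: poly_act_def sum_distrib_left algebra_simps)
    then show "\<exists>z. \<forall>x\<in>S. poly_act b q \<phi> (c * x) = z * poly_act b q \<phi> x" by blast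
  qed
  ultimately show ?case using q linear_poly_act[OF \<phi>(1)] by blast
qed

text \<open>Eigenvalues on a finite basis of \<open>L0\<close> extend linearly to \<open>L0\<close>,
  and evaluating \<psi> at x * (y * s) shows that they are multiplicative. With
  \<open>S0 = {0}\<close> this produces functionals on S; with a proper ideal as \<open>S0\<close>
  it produces a character that kills the ideal.\<close>

lemma character_functional:
  assumes "submodule S" "submodule S0" "S0 \<subseteq> S" "S0 \<noteq> S"
  obtains \<omega> and \<psi> :: "'a \<Rightarrow> complex" and s where "character \<omega>" "linear \<psi>" "s \<in> S" "\<psi> s \<noteq> 0" "\<And>x. x \<in> S0 \<Longrightarrow> \<psi> x = 0"
    "\<And>b x. b \<in> L0 \<Longrightarrow> x \<in> S \<Longrightarrow> \<psi> (b * x) = \<omega> b * \<psi> x"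
proof -
  obtain B where B: "B \<subseteq> L0" "independent B" "L0 \<subseteq> span B"
    using basis_exists[of L0] by metis
  obtain \<psi> :: "'a \<Rightarrow> complex" and s where \<psi>: "linear \<psi>" "s \<in> S" "\<psi> s \<noteq> 0" "\<forall>x\<in>S0. \<psi> x = 0"
    "\<forall>b\<in>B. \<exists>z. \<forall>x\<in>S. \<psi> (b * x) = z * \<psi> x"
    using common_eigenfunctional[OF independent_imp_finite[OF B(2)] B(1) assms] by blast
  interpret linear \<psi> by fact
  have ev: "\<exists>z. \<forall>x\<in>S. \<psi> (b * x) = z * \<psi> x" if "b \<in> L0" for b
  proof -
    have "b \<in> span B" using that B by blast
    then show ?thesis
    proof (induction rule: span_induct_alt)
      case base
      have "\<psi> (0 * x) = 0 * \<psi> x" for x using linear_0[OF \<psi>(1)] by simp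
      then show ?case by blast
    next
      case (step c x y)
      then obtain z w where "\<forall>v\<in>S. \<psi> (x * v) = z * \<psi> v" "\<forall>v\<in>S. \<psi> (y * v) = w * \<psi> v"
        using \<psi>(5) by blast
      then show ?case
        by (intro exI[of _ "of_real c * z + w"]) (simp add: algebra_simps add scale scaleR_conv_of_real[of _ "_ :: complex"])
    qed
  qed
  \<comment> \<open>Division by \<psi> s gives a linear map on all of \<open>'a\<close>, which on
    \<open>L0\<close> is the eigenvalue.\<close>
  define \<omega> where "\<omega> b = \<psi> (b * s) / \<psi> s" for b
  have eq: "\<psi> (b * x) = \<omega> b * \<psi> x" if "b \<in> L0" "x \<in> S" for b x
    using ev[OF that(1)] that \<psi>(2,3) unfolding \<omega>_def by (metis nonzero_mult_div_cancel_right)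
  have "character \<omega>"
    unfolding character_def
  proof (intro conjI ballI)
    show "linear \<omega>" unfolding \<omega>_def
      by (rule linearI) (simp_all add: algebra_simps add scale add_divide_distrib scaleR_conv_of_real[of _ "_ :: complex"])
    show "\<omega> 1 = 1" using \<psi> by (simp add: \<omega>_def)
    fix x y assume "x \<in> L0" "y \<in> L0"
    then have "\<psi> (x * (y * s)) = \<omega> x * (\<omega> y * \<psi> s)"
      using eq \<psi>(2) assms(1) by (simp add: submodule_def)
    then show "\<omega> (x * y) = \<omega> x * \<omega> y" using \<psi>(3) by (simp add: \<omega>_def[of "x * y"] mult.assoc)
  qed
  with \<psi> eq show ?thesis using that by blast
qed

lemma submodule_L0: "submodule L0"
  by (auto simp: submodule_def subspace_L0 mult_L0)

lemma submodule_ideal: assumes "b \<in> L0" shows "submodule ((\<lambda>x. x * b) ` L0)"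
  unfolding submodule_def
proof (intro conjI ballI)
  show "subspace ((\<lambda>x. x * b) ` L0)"
    by (rule linear_subspace_image[OF linear_mult_right subspace_L0])
  show "c * x \<in> (\<lambda>x. x * b) ` L0" if "c \<in> L0" "x \<in> (\<lambda>x. x * b) ` L0" for c x
    using that by (auto simp: mult.assoc[symmetric] mult_L0)
qed

text \<open>If b is not a unit, the ideal generated by b is proper, and a character functional on
  \<open>L0\<close> modulo this ideal has \<omega> b * \<psi> s = \<psi> (b * s) = 0 although \<psi>
  s is nonzero.\<close>

lemma inverse_exists:
  assumes "b \<in> L0" "\<And>\<omega>. character \<omega> \<Longrightarrow> \<omega> b \<noteq> 0"
  obtains b' where "b' \<in> L0" "b' * b = 1"
proof (cases "1 \<in> (\<lambda>x. x * b) ` L0")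
  case True
  then show ?thesis using that by auto
next
  case False
  have "(\<lambda>x. x * b) ` L0 \<subseteq> L0" using assms mult_L0 by auto
  then obtain \<omega> \<psi> s where h: "character \<omega>" "s \<in> L0" "\<psi> s \<noteq> 0" "\<And>x. x \<in> (\<lambda>x. x * b) ` L0 \<Longrightarrow> \<psi> x = 0"
    "\<And>b x. b \<in> L0 \<Longrightarrow> x \<in> L0 \<Longrightarrow> \<psi> (b * x) = \<omega> b * \<psi> x"
    using character_functional[OF submodule_L0 submodule_ideal[OF assms(1)]] one_L0 False by metis
  have "\<psi> (b * s) = 0" using h(2) assms(1) by (subst central) (auto intro: h(4))
  with h assms show ?thesis by auto
qed

text \<open>Real combinations of 1 and j lift every complex number through \<omega>; later this
  turns complex Taylor coefficients into elements of \<open>L0\<close>.\<close>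

lemma character_imaginary_unit:
  assumes "character \<omega>"
  obtains j where "j \<in> L0" "\<omega> j = \<i>"
proof -
  obtain e :: "nat \<Rightarrow> 'a" and p where e: "\<And>k. k \<in> {0..p} \<Longrightarrow> e k \<in> L0" "e 0 = 1" "(\<Sum>k=0..p. e k ^ 2) = 0"
    using isotropic by blast
  interpret linear \<omega> using assms by (simp add: character_def)
  have \<omega>1: "\<omega> 1 = 1" using assms by (simp add: character_def)
  have s: "(\<Sum>k=0..p. \<omega> (e k) ^ 2) = 0"
    using arg_cong[OF e(3), of \<omega>] character_power[OF assms e(1)] by (simp add: sum zero)
  have "\<exists>k\<in>{0..p}. Im (\<omega> (e k)) \<noteq> 0"
  proof (rule ccontr)
    assume "\<not> ?thesis"
    then have "Re (\<Sum>k=0..p. \<omega> (e k) ^ 2) = (\<Sum>k=0..p. Re (\<omega> (e k)) ^ 2)"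
      by (auto simp: power2_eq_square)
    moreover have "(\<Sum>k=0..p. Re (\<omega> (e k)) ^ 2) \<ge> Re (\<omega> (e 0)) ^ 2"
      by (rule member_le_sum) auto
    ultimately show False using s \<omega>1 e(2) by simp
  qed
  then obtain k where k: "k \<in> {0..p}" "Im (\<omega> (e k)) \<noteq> 0" by blast
  \<comment> \<open>Since \<omega> 1 = 1, a real shift and a real scaling move the nonreal value
    \<omega> (e k) to the imaginary unit.\<close>
  define j where "j = (1 / Im (\<omega> (e k))) *\<^sub>R (e k - Re (\<omega> (e k)) *\<^sub>R 1)"
  have "j \<in> L0" unfolding j_def
    using k e subspace_L0 one_L0 by (intro subspace_scale subspace_diff) auto
  moreover have "\<omega> j = \<i>" using k(2)
    by (simp add: j_def scale diff \<omega>1 complex_eq_iff)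
  ultimately show ?thesis using that by blast
qed

text \<open>All these values are roots of one annihilating polynomial. Finiteness makes strict
  inequalities for single characters uniform over all of them.\<close>

lemma finite_spectrum:
  assumes "b \<in> L0"
  shows "finite {\<omega> b |\<omega>. character \<omega>}"
proof -
  obtain p where p: "p \<noteq> 0" "\<And>\<phi> x. linear \<phi> \<Longrightarrow> poly_act b p \<phi> x = 0"
    using annihilating_polynomial[of b] by blast
  have "poly p (\<omega> b) = 0" if "character \<omega>" for \<omega>
    using p(2)[of \<omega> 1] that character_power[OF that assms]
    by (simp add: poly_act_def poly_altdef character_def)
  then have "{\<omega> b |\<omega>. character \<omega>} \<subseteq> {z. poly p z = 0}" by auto
  then show ?thesis using poly_roots_finite[OF p(1)] by (rule finite_subset)
qed

section \<open>Growth of powers in terms of character values\<close>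

lemma geometric_recurrence:
  fixes u w :: "nat \<Rightarrow> complex"
  assumes rec: "\<And>n. u (Suc n) = z * u n + w n" and z: "norm z < \<rho>" and w: "\<And>n. norm (w n) \<le> C * \<rho> ^ n"
  shows "\<exists>C'. \<forall>n. norm (u n) \<le> C' * \<rho> ^ n"
proof -
  \<comment> \<open>Chosen to dominate the initial value and to satisfy norm z * C' + C \<le> C' *
    \<rho>, which is what the induction step needs.\<close>
  define C' where "C' = max (norm (u 0)) (C / (\<rho> - norm z))"
  have C': "norm z * C' + C \<le> C' * \<rho>"
    using z by (simp add: C'_def field_simps max_def)
  have \<rho>: "\<rho> > 0" using z norm_ge_zero[of z] by linarith
  have "norm (u n) \<le> C' * \<rho> ^ n" for n
  proof (induction n)
    case 0
    then show ?case by (simp add: C'_def)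
  next
    case (Suc n)
    have "norm (u (Suc n)) \<le> norm z * norm (u n) + norm (w n)"
      using norm_triangle_ineq[of "z * u n" "w n"] by (simp add: rec norm_mult)
    also have "\<dots> \<le> norm z * (C' * \<rho> ^ n) + C * \<rho> ^ n"
      using Suc w by (intro add_mono mult_left_mono) auto
    also have "\<dots> = (norm z * C' + C) * \<rho> ^ n" by (simp add: algebra_simps)
    also have "\<dots> \<le> (C' * \<rho>) * \<rho> ^ n" using C' \<rho> by (intro mult_right_mono) auto
    finally show ?case by (simp add: mult_ac)
  qed
  then show ?thesis by blast
qed

text \<open>The sequence \<phi> (b ^ n) obeys the linear recurrence with characteristic polynomial
  p, whose factors X - z are removed one by one. If norm z < \<rho>, a factor costs one first-order
  recurrence. Otherwise neither z nor its conjugate is a character value of b, and the factor can be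
  cancelled on \<open>L0\<close>.\<close>

lemma functional_power_bound:
  assumes b: "b \<in> L0" and \<rho>: "\<rho> > 0" "\<And>\<omega>. character \<omega> \<Longrightarrow> norm (\<omega> b) < \<rho>"
    and "linear \<phi>" "p \<noteq> 0" "\<And>x. x \<in> L0 \<Longrightarrow> poly_act b p \<phi> x = 0"
  shows "\<exists>C. \<forall>n. norm (\<phi> (b ^ n)) \<le> C * \<rho> ^ n"
  using assms(4-6)
proof (induction "degree p" arbitrary: p \<phi>)
  case 0
  have "coeff p 0 \<noteq> 0" using 0(1,3) by (metis leading_coeff_0_iff)
  then have "\<phi> (b ^ n) = 0" for n
    using 0(4)[OF power_L0[OF b, of n]] 0(1) by (auto simp: poly_act_def)
  then show ?case by (auto intro: exI[of _ 0])
next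
  case (Suc d)
  obtain z q where q: "p = [:- z, 1:] * q" and dq: "degree q = d"
    using complex_poly_linear_factor[OF Suc(2)[symmetric]] .
  have q0: "q \<noteq> 0" using Suc(4) q by auto
  interpret linear \<phi> by fact
  have pq: "poly_act b q \<phi> (b * x) = z * poly_act b q \<phi> x" if "x \<in> L0" for x
    using Suc(5)[OF that] unfolding q poly_act_linear_factor by simp
  show ?case
  proof (cases "norm z < \<rho>")
    case True
    \<comment> \<open>This is (T - z) \<phi>. It is annihilated by q, so the induction hypothesis
      bounds it.\<close>
    define \<psi> where "\<psi> x = \<phi> (b * x) - z * \<phi> x" for x
    have "linear \<psi>" unfolding \<psi>_def by (rule linearI) (simp_all add: algebra_simps add scale)
    moreover have "poly_act b q \<psi> x = 0" if "x \<in> L0" for x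
    proof -
      have "poly_act b q \<psi> x = poly_act b q \<phi> (b * x) - z * poly_act b q \<phi> x"
        unfolding poly_act_def \<psi>_def
        by (simp add: algebra_simps sum_subtractf sum_distrib_left)
          (simp add: mult.assoc[symmetric] power_commutes[symmetric])
      then show ?thesis using pq[OF that] by simp
    qed
    ultimately obtain C where "\<And>n. norm (\<psi> (b ^ n)) \<le> C * \<rho> ^ n"
      using Suc(1)[OF dq[symmetric] _ q0] by blast
    then show ?thesis
      by (intro geometric_recurrence[of "\<lambda>n. \<phi> (b ^ n)" z "\<lambda>n. \<psi> (b ^ n)"]) (auto simp: \<psi>_def True)
  next
    case False
    have "poly_act b q \<phi> x = 0" if "x \<in> L0" for x
    proof (rule ccontr)
      assume nz: "poly_act b q \<phi> x \<noteq> 0"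
      define \<theta> where "\<theta> = poly_act b q \<phi>"
      interpret \<theta>: linear \<theta> unfolding \<theta>_def by (rule linear_poly_act) fact
      have \<theta>b: "\<theta> (b * y) = z * \<theta> y" if "y \<in> L0" for y using pq that by (simp add: \<theta>_def)
      \<comment> \<open>A substitute for (b - z)(b - cnj z) with real coefficients, since the
        scalars of the algebra are real. As \<theta> vanishes on all multiples of Q without being
        zero, Q is not a unit; a character vanishing at Q sends b to z or cnj z, whose modulus is at
        least \<rho>.\<close>
      define Q where "Q = (b - Re z *\<^sub>R 1) ^ 2 + (Im z ^ 2) *\<^sub>R 1"
      have Qexp: "Q * y = b * (b * y) - (2 * Re z) *\<^sub>R (b * y) + (Re z ^ 2 + Im z ^ 2) *\<^sub>R y" for y
        by (simp add: Q_def power2_eq_square algebra_simps scaleR_2[symmetric] del: scaleR_scaleR)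
          (simp add: scaleR_add_left[symmetric] algebra_simps)
      have QL: "Q \<in> L0"
        unfolding Q_def using b subspace_L0 one_L0
        by (intro subspace_add power_L0 subspace_diff subspace_scale) auto
      have \<theta>Q: "\<theta> (Q * y) = 0" if "y \<in> L0" for y
      proof -
        have "\<theta> (Q * y) = (z * z - of_real (2 * Re z) * z + of_real (Re z ^ 2 + Im z ^ 2)) * \<theta> y"
          unfolding Qexp using that b mult_L0
          by (simp add: \<theta>.add \<theta>.diff \<theta>.scale \<theta>b scaleR_conv_of_real[of _ "_ :: complex"] algebra_simps)
        also have "z * z - of_real (2 * Re z) * z + of_real (Re z ^ 2 + Im z ^ 2) = 0"
          by (simp add: complex_eq_iff power2_eq_square)
        finally show ?thesis by simp
      qed
      have "\<exists>\<omega>. character \<omega> \<and> \<omega> Q = 0"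
      proof (rule ccontr)
        assume "\<not> ?thesis"
        then obtain Q' where "Q' \<in> L0" "Q' * Q = 1" using inverse_exists[OF QL] by blast
        then have "x = Q * (Q' * x)" using central[OF QL] by (metis mult.assoc mult_1)
        then have "\<theta> x = 0" using \<theta>Q[of "Q' * x"] \<open>Q' \<in> L0\<close> \<open>x \<in> L0\<close> mult_L0 by simp
        with nz show False by (simp add: \<theta>_def)
      qed
      then obtain \<omega> where \<omega>: "character \<omega>" "\<omega> Q = 0" by blast
      interpret \<omega>: linear \<omega> using \<omega>(1) by (simp add: character_def)
      have "\<omega> Q = \<omega> b * \<omega> b - of_real (2 * Re z) * \<omega> b + of_real (Re z ^ 2 + Im z ^ 2)"
        using Qexp[of 1] \<omega>(1) b
        by (simp add: \<omega>.add \<omega>.diff \<omega>.scale scaleR_conv_of_real[of _ "_ :: complex"] character_def)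
      also have "\<dots> = (\<omega> b - z) * (\<omega> b - cnj z)"
        by (simp add: complex_eq_iff power2_eq_square algebra_simps)
      finally have "\<omega> b = z \<or> \<omega> b = cnj z" using \<omega>(2) by simp
      then have "norm (\<omega> b) = norm z" by auto
      with \<rho>(2)[OF \<omega>(1)] False show False by simp
    qed
    then show ?thesis using Suc(1)[OF dq[symmetric] Suc(3) q0] by blast
  qed
qed

text \<open>The spectral radius estimate, obtained for each coordinate functional and summed.
  Nilpotent parts of b contribute polynomial growth, which is absorbed by the strict inequality
  between the character values and \<rho>.\<close>

lemma power_bound:
  assumes b: "b \<in> L0" and \<rho>: "\<rho> > 0" "\<And>\<omega>. character \<omega> \<Longrightarrow> norm (\<omega> b) < \<rho>"
  obtains C where "C > 0" "\<And>n. norm (b ^ n) \<le> C * \<rho> ^ n"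
proof -
  obtain p where p: "p \<noteq> 0" "\<And>\<phi> x. linear \<phi> \<Longrightarrow> poly_act b p \<phi> x = 0"
    using annihilating_polynomial[of b] by blast
  have "\<exists>C. \<forall>n. norm (complex_of_real (b ^ n \<bullet> i)) \<le> C * \<rho> ^ n" for i
  proof (rule functional_power_bound[of b \<rho> "\<lambda>x. complex_of_real (x \<bullet> i)" p])
    show "b \<in> L0" "\<rho> > 0" "\<And>\<omega>. character \<omega> \<Longrightarrow> norm (\<omega> b) < \<rho>"
      by (fact b \<rho>)+
    show l: "linear (\<lambda>x. complex_of_real (x \<bullet> i))"
      by (rule linearI) (simp_all add: inner_add_left scaleR_conv_of_real[of _ "_ :: complex"])
    show "p \<noteq> 0" by (rule p)
    show "poly_act b p (\<lambda>x. complex_of_real (x \<bullet> i)) x = 0" for x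
      by (rule p(2)[OF l])
  qed
  then have "\<forall>i. \<exists>C. \<forall>n. \<bar>b ^ n \<bullet> i\<bar> \<le> C * \<rho> ^ n" by (simp only: norm_of_real simp_thms)
  from choice[OF this] obtain C where C: "\<And>i n. \<bar>b ^ n \<bullet> i\<bar> \<le> C i * \<rho> ^ n" by blast
  show ?thesis
  proof (rule that[of "1 + \<bar>\<Sum>i\<in>Basis. C i\<bar>"])
    fix n
    have "norm (b ^ n) \<le> (\<Sum>i\<in>Basis. \<bar>b ^ n \<bullet> i\<bar>)" by (rule norm_le_l1)
    also have "\<dots> \<le> (\<Sum>i\<in>Basis. C i * \<rho> ^ n)" by (intro sum_mono C)
    also have "\<dots> = (\<Sum>i\<in>Basis. C i) * \<rho> ^ n" by (simp add: sum_distrib_right)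
    also have "\<dots> \<le> (1 + \<bar>\<Sum>i\<in>Basis. C i\<bar>) * \<rho> ^ n"
      using \<rho>(1) by (intro mult_right_mono) auto
    finally show "norm (b ^ n) \<le> (1 + \<bar>\<Sum>i\<in>Basis. C i\<bar>) * \<rho> ^ n" .
  qed simp
qed

text \<open>An element outside \<open>ker \<omega>\<close> generating an ideal of minimal dimension yields an idempotent
  which is killed by every character that is neither \<open>\<omega>\<close> nor its complex conjugate.\<close>

lemma local_idempotent:
  assumes \<omega>: "character \<omega>"
  obtains u where "u \<in> L0" "u * u = u" "\<omega> u = 1"
    "\<And>\<omega>' b. character \<omega>' \<Longrightarrow> b \<in> L0 \<Longrightarrow> norm (\<omega>' (b * u)) \<le> norm (\<omega> b)"
proof -
  have \<omega>m: "\<omega> (x * y) = \<omega> x * \<omega> y" if "x \<in> L0" "y \<in> L0" for x y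
    using \<omega> that by (simp add: character_def)
  define I where "I p = (\<lambda>x. x * p) ` L0" for p
  have ex: "1 \<in> L0 \<and> \<omega> 1 \<noteq> 0" using \<omega> one_L0 by (simp add: character_def)
  \<comment> \<open>Multiplying this p by an element outside ker \<omega> cannot shrink its ideal
    any further, so p is recovered as a multiple of the product.\<close>
  define p where "p = arg_min (\<lambda>p. dim (I p)) (\<lambda>p. p \<in> L0 \<and> \<omega> p \<noteq> 0)"
  have p: "p \<in> L0" "\<omega> p \<noteq> 0" and pmin: "\<And>b. b \<in> L0 \<Longrightarrow> \<omega> b \<noteq> 0 \<Longrightarrow> dim (I p) \<le> dim (I b)"
    using arg_min_nat_lemma[of "\<lambda>p. p \<in> L0 \<and> \<omega> p \<noteq> 0" 1 "\<lambda>p. dim (I p)"] ex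
    unfolding p_def by blast+
  have Isub: "subspace (I b)" if "b \<in> L0" for b
    using submodule_ideal[OF that] by (simp add: I_def submodule_def)
  have gen: "\<exists>c\<in>L0. p = c * (b * p)" if b: "b \<in> L0" "\<omega> b \<noteq> 0" for b
  proof -
    have bp: "b * p \<in> L0" "\<omega> (b * p) \<noteq> 0" using b p by (auto simp: mult_L0 \<omega>m)
    have "I (b * p) \<subseteq> I p" using b by (auto simp: I_def mult.assoc[symmetric] mult_L0)
    then have "I (b * p) = I p"
      using subspace_dim_equal[OF Isub[OF bp(1)] Isub[OF p(1)]] pmin[OF bp] by auto
    moreover have "p \<in> I p" using one_L0 by (auto simp: I_def intro: image_eqI[of _ _ 1])
    ultimately show ?thesis by (auto simp: I_def)
  qed
  \<comment> \<open>With b = p itself: the relation p = c * (p * p) makes c * p idempotent.\<close>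
  obtain c where c: "c \<in> L0" "p = c * (p * p)" using gen[OF p] by blast
  define u where "u = c * p"
  have u: "u \<in> L0" using c p by (simp add: u_def mult_L0)
  have uu: "u * u = u"
  proof -
    have "u * u = c * (p * c) * p" by (simp add: u_def mult.assoc)
    also have "\<dots> = c * (c * (p * p))" using central[OF p(1), of c] by (simp add: mult.assoc)
    finally show ?thesis using c by (simp add: u_def)
  qed
  have "\<omega> p = \<omega> c * \<omega> p * \<omega> p" using c p \<omega>m mult_L0 by (metis mult.assoc)
  then have \<omega>u: "\<omega> u = 1" using p c by (simp add: u_def \<omega>m)
  show ?thesis
  proof (rule that[OF u uu \<omega>u])
    fix \<omega>' b assume \<omega>': "character \<omega>'" and b: "b \<in> L0"
    have \<omega>m': "\<omega>' (x * y) = \<omega>' x * \<omega>' y" if "x \<in> L0" "y \<in> L0" for x y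
      using \<omega>' that by (simp add: character_def)
    show "norm (\<omega>' (b * u)) \<le> norm (\<omega> b)"
    proof (cases "\<omega>' u = 0")
      case True
      then show ?thesis using b u by (simp add: \<omega>m')
    next
      case False
      have "\<omega>' u * \<omega>' u = \<omega>' u" using \<omega>m'[OF u u] uu by simp
      with False have \<omega>'u: "\<omega>' u = 1" by simp
      \<comment> \<open>On \<open>L0\<close> the kernel of \<omega>' lies in that of \<omega>: an
        element outside ker \<omega> divides p, and \<omega>' does not vanish at p because \<omega>'
        u = 1.\<close>
      have ker: "\<omega> d = 0" if d: "d \<in> L0" "\<omega>' d = 0" for d
      proof (rule ccontr)
        assume "\<omega> d \<noteq> 0"
        then obtain d' where "d' \<in> L0" "p = d' * (d * p)" using gen d by blast
        then have "\<omega>' p = 0" using d p mult_L0 \<omega>m' by (metis mult_zero_left mult_zero_right)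
        with False show False using c p by (simp add: u_def \<omega>m')
      qed
      interpret l: linear \<omega> using \<omega> by (simp add: character_def)
      interpret l': linear \<omega>' using \<omega>' by (simp add: character_def)
      define z where "z = \<omega>' b"
      \<comment> \<open>The real quadratic in b with roots z and cnj z lies in ker \<omega>', hence
        in ker \<omega>. So \<omega> and \<omega>' agree at b up to conjugation.\<close>
      define Q where "Q = (b - Re z *\<^sub>R 1) ^ 2 + (Im z ^ 2) *\<^sub>R 1"
      have bz: "b - Re z *\<^sub>R 1 \<in> L0" using b subspace_L0 one_L0 by (simp add: subspace_diff subspace_scale)
      have Q: "Q \<in> L0" unfolding Q_def
        using bz subspace_L0 one_L0 by (intro subspace_add power_L0 subspace_scale) auto
      have ev: "\<theta> Q = (\<theta> b - z) * (\<theta> b - cnj z)" if \<theta>: "character \<theta>" for \<theta>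
      proof -
        interpret linear \<theta> using \<theta> by (simp add: character_def)
        have "\<theta> Q = (\<theta> b - of_real (Re z)) ^ 2 + of_real (Im z ^ 2)"
          using \<theta> by (simp add: Q_def add scale diff character_power[OF \<theta> bz] scaleR_conv_of_real[of _ "_ :: complex"] character_def)
        then show ?thesis by (simp add: complex_eq_iff power2_eq_square algebra_simps)
      qed
      have "\<omega> Q = 0" using ker[OF Q] ev[OF \<omega>'] by (simp add: z_def)
      then have "\<omega> b = z \<or> \<omega> b = cnj z" using ev[OF \<omega>] by simp
      then have "norm (\<omega> b) = norm (\<omega>' b)" by (auto simp: z_def)
      then show ?thesis using b u by (simp add: \<omega>m' \<omega>'u)
    qed
  qed
qed

end

section \<open>Power series in several complex variables\<close>

text \<open>One notion of monomial for three kinds of arguments: elements of the algebra, their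
  complex character values, and real radii.\<close>

definition mon :: "'k list \<Rightarrow> ('k \<Rightarrow> 'b::monoid_mult) \<Rightarrow> ('k \<Rightarrow> nat) \<Rightarrow> 'b" where
  "mon ks x I = prod_list (map (\<lambda>\<beta>. x \<beta> ^ I \<beta>) ks)"

definition exponents :: "'k list \<Rightarrow> ('k \<Rightarrow> nat) set" where
  "exponents ks = {I. \<forall>\<beta>. \<beta> \<notin> set ks \<longrightarrow> I \<beta> = 0}"

lemma mon_Nil [simp]: "mon [] x I = 1"
  by (simp add: mon_def)

lemma mon_Cons [simp]: "mon (\<beta> # ks) x I = x \<beta> ^ I \<beta> * mon ks x I"
  by (simp add: mon_def)

lemma mon_cong:
  "(\<And>\<beta>. \<beta> \<in> set ks \<Longrightarrow> x \<beta> = y \<beta>) \<Longrightarrow> (\<And>\<beta>. \<beta> \<in> set ks \<Longrightarrow> I \<beta> = J \<beta>) \<Longrightarrow> mon ks x I = mon ks y J"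
  unfolding mon_def by (metis (mono_tags, lifting) map_cong)

lemma mon_upd [simp]:
  "\<beta> \<notin> set ks \<Longrightarrow> mon ks (x(\<beta> := t)) I = mon ks x I"
  "\<beta> \<notin> set ks \<Longrightarrow> mon ks x (I(\<beta> := n)) = mon ks x I"
  by (auto intro!: mon_cong)

lemma mon_append: "mon (xs @ ys) x I = mon xs x I * mon ys x I"
  by (simp add: mon_def)

lemma mon_map: "mon (map g xs) x I = mon xs (\<lambda>\<beta>. x (g \<beta>)) (\<lambda>\<beta>. I (g \<beta>))"
  by (simp add: mon_def o_def)

lemma mon_concat: "mon (concat xss) x I = prod_list (map (\<lambda>xs. mon xs x I) xss)"
  by (induction xss) (auto simp: mon_append)

lemma mon_nonneg: "(\<And>\<beta>. \<beta> \<in> set ks \<Longrightarrow> 0 \<le> (x \<beta> :: real)) \<Longrightarrow> 0 \<le> mon ks x I"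
  by (induction ks) auto

lemma mon_pos: "(\<And>\<beta>. \<beta> \<in> set ks \<Longrightarrow> 0 < (x \<beta> :: real)) \<Longrightarrow> 0 < mon ks x I"
  by (induction ks) auto

lemma mon_divide: "mon ks (\<lambda>\<beta>. x \<beta> / y \<beta>) I = mon ks x I / (mon ks y I :: 'b::field)"
  by (induction ks) (auto simp: power_divide)

lemma norm_mon: "norm (mon ks x I) = mon ks (\<lambda>\<beta>. norm (x \<beta> :: complex)) I"
  by (induction ks) (auto simp: norm_mult norm_power)

lemma exponents_Nil: "exponents [] = {\<lambda>_. 0}"
  by (auto simp: exponents_def)

lemma bij_betw_exponents_Cons:
  assumes "\<beta> \<notin> set ks"
  shows "bij_betw (\<lambda>(n, I). I(\<beta> := n)) (UNIV \<times> exponents ks) (exponents (\<beta> # ks))"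
proof (rule bij_betwI[where g = "\<lambda>I. (I \<beta>, I(\<beta> := 0))"])
  show "(\<lambda>(n, I). I(\<beta> := n)) \<in> UNIV \<times> exponents ks \<rightarrow> exponents (\<beta> # ks)"
    by (auto simp: exponents_def)
qed (use assms in \<open>auto simp: exponents_def fun_eq_iff\<close>)

lemma has_sum_geometric:
  assumes "0 \<le> x" "x < (1 :: real)"
  shows "((\<lambda>n. x ^ n) has_sum (1 / (1 - x))) UNIV"
  using assms by (intro sums_nonneg_imp_has_sum geometric_sums) auto

text \<open>A product of geometric series, summed one variable at a time.\<close>

lemma mon_summable:
  assumes "distinct ks" "\<And>\<beta>. \<beta> \<in> set ks \<Longrightarrow> 0 \<le> x \<beta>" "\<And>\<beta>. \<beta> \<in> set ks \<Longrightarrow> x \<beta> < (1 :: real)"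
  shows "mon ks x summable_on exponents ks"
  using assms
proof (induction ks)
  case Nil
  then show ?case by (simp add: exponents_Nil)
next
  case (Cons \<beta> ks)
  define g where "g = infsum (mon ks x) (exponents ks)"
  have "(mon ks x has_sum g) (exponents ks)"
    unfolding g_def using Cons by (intro has_sum_infsum) auto
  then have 1: "((\<lambda>I. x \<beta> ^ n * mon ks x I) has_sum x \<beta> ^ n * g) (exponents ks)" for n
    by (rule has_sum_cmult_right)
  have "((\<lambda>n. x \<beta> ^ n * g) has_sum 1 / (1 - x \<beta>) * g) UNIV"
    using Cons.prems by (intro has_sum_cmult_left has_sum_geometric) auto
  then have "(\<lambda>n. x \<beta> ^ n * g) summable_on UNIV" by (rule has_sum_imp_summable)
  then have "(\<lambda>(n, I). x \<beta> ^ n * mon ks x I) summable_on (UNIV \<times> exponents ks)"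
    using 1 Cons.prems by (intro summable_on_SigmaI) (auto intro!: mult_nonneg_nonneg mon_nonneg)
  also have "?this \<longleftrightarrow> (\<lambda>z. mon (\<beta> # ks) x ((\<lambda>(n, I). I(\<beta> := n)) z)) summable_on (UNIV \<times> exponents ks)"
    using Cons.prems by (intro summable_on_cong) auto
  also have "\<dots> \<longleftrightarrow> mon (\<beta> # ks) x summable_on exponents (\<beta> # ks)"
    using Cons.prems by (intro summable_on_reindex_bij_betw bij_betw_exponents_Cons) auto
  finally show ?case .
qed

text \<open>Abel's lemma: coefficients bounded against the radii \<rho> are dominated by the
  geometric series in x / \<rho>.\<close>

lemma bounded_coeffs_summable:
  fixes c :: "('k \<Rightarrow> nat) \<Rightarrow> 'b::real_normed_vector"
  assumes "distinct ks" and x: "\<And>\<beta>. \<beta> \<in> set ks \<Longrightarrow> 0 \<le> x \<beta>" "\<And>\<beta>. \<beta> \<in> set ks \<Longrightarrow> x \<beta> < \<rho> \<beta>"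
    and c: "\<And>I. I \<in> exponents ks \<Longrightarrow> norm (c I) * mon ks \<rho> I \<le> M"
  shows "(\<lambda>I. norm (c I) * mon ks x I) summable_on exponents ks"
proof -
  have \<rho>: "\<And>\<beta>. \<beta> \<in> set ks \<Longrightarrow> 0 < \<rho> \<beta>" using x by force
  have "mon ks (\<lambda>\<beta>. x \<beta> / \<rho> \<beta>) summable_on exponents ks"
    using assms(1) x \<rho> by (intro mon_summable) (auto simp: less_imp_le)
  then have "(\<lambda>I. M * mon ks (\<lambda>\<beta>. x \<beta> / \<rho> \<beta>) I) summable_on exponents ks"
    by (rule summable_on_cmult_right)
  then show ?thesis
  proof (rule summable_on_comparison_test)
    fix I assume I: "I \<in> exponents ks"
    have p: "mon ks \<rho> I > 0" "mon ks x I \<ge> 0" using \<rho> x by (auto intro: mon_pos mon_nonneg)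
    show "norm (c I) * mon ks x I \<le> M * mon ks (\<lambda>\<beta>. x \<beta> / \<rho> \<beta>) I"
      using mult_right_mono[OF c[OF I], of "mon ks x I / mon ks \<rho> I"] p
      by (simp add: mon_divide)
    show "0 \<le> norm (c I) * mon ks x I" using p by simp
  qed
qed

text \<open>The n-th Taylor coefficient in w is the uniform limit of the quotients
  \<open>h j\<close>, formed at points \<open>w j\<close> tending to 0 from G and the lower
  coefficients, which are holomorphic in \<zeta> by induction. The Cauchy estimates make the error
  uniform in \<zeta>.\<close>

lemma coeff_holomorphic:
  fixes G :: "complex \<Rightarrow> complex \<Rightarrow> complex"
  assumes U: "open U" and \<rho>: "0 < \<rho>" "\<rho> < R"
    and holw: "\<And>\<zeta>. \<zeta> \<in> U \<Longrightarrow> (\<lambda>w. G w \<zeta>) holomorphic_on ball 0 R"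
    and hol\<zeta>: "\<And>w. norm w < R \<Longrightarrow> G w holomorphic_on U"
    and M: "\<And>w \<zeta>. norm w \<le> \<rho> \<Longrightarrow> \<zeta> \<in> U \<Longrightarrow> norm (G w \<zeta>) \<le> M"
  shows "(\<lambda>\<zeta>. (deriv ^^ n) (\<lambda>w. G w \<zeta>) 0 / fact n) holomorphic_on U"
proof (induction n rule: less_induct)
  case (less n)
  define c where "c k \<zeta> = (deriv ^^ k) (\<lambda>w. G w \<zeta>) 0 / fact k" for k \<zeta>
  have c_bound: "norm (c k \<zeta>) \<le> M / \<rho> ^ k" if "\<zeta> \<in> U" for k \<zeta>
  proof -
    have "(\<lambda>w. G w \<zeta>) holomorphic_on cball 0 \<rho>"
      using \<rho> by (intro holomorphic_on_subset[OF holw[OF that]]) auto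
    then have "norm ((deriv ^^ k) (\<lambda>w. G w \<zeta>) 0) \<le> fact k * M / \<rho> ^ k"
      using \<rho> M that
      by (intro Cauchy_inequality) (auto intro: holomorphic_on_subset holomorphic_on_imp_continuous_on)
    then show ?thesis by (simp add: c_def norm_divide field_simps)
  qed
  have c_sums: "(\<lambda>k. c k \<zeta> * w ^ k) sums G w \<zeta>" if "\<zeta> \<in> U" "norm w < R" for w \<zeta>
    using holomorphic_power_series[OF holw[OF that(1)], of w] that(2) by (simp add: c_def)
  \<comment> \<open>Positive, tending to 0, and at most 1/2, so that the geometric factor 1 / (1 - t
    j) is at most 2.\<close>
  define t where "t j = 1 / (real j + 2)" for j
  have t: "0 < t j" "t j \<le> 1 / 2" for j by (auto simp: t_def field_simps)
  define w where "w j = complex_of_real (\<rho> * t j)" for j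
  have w: "w j \<noteq> 0" "norm (w j) = \<rho> * t j" "norm (w j) < R" for j
  proof -
    show n: "norm (w j) = \<rho> * t j" using \<rho> t(1)[of j] by (simp add: w_def norm_mult del: of_real_mult)
    show "w j \<noteq> 0" using \<rho> t(1)[of j] by (simp add: w_def)
    have "\<rho> * t j \<le> \<rho> * 1" using \<rho> t(2)[of j] by (intro mult_left_mono) auto
    with n \<rho>(2) show "norm (w j) < R" by (simp only: mult_1_right)
  qed
  define h where "h j \<zeta> = (G (w j) \<zeta> - (\<Sum>k<n. c k \<zeta> * w j ^ k)) / w j ^ n" for j \<zeta>
  have holh: "h j holomorphic_on U" for j
    unfolding h_def using less w by (intro holomorphic_intros hol\<zeta>) (auto simp: c_def)
  \<comment> \<open>The error is the part of the power series of order above n, divided by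
    \<open>w j ^ n\<close>, and so of size \<open>t j\<close>.\<close>
  have h_err: "norm (h j \<zeta> - c n \<zeta>) \<le> 2 * M / \<rho> ^ n * t j" if \<zeta>: "\<zeta> \<in> U" for j \<zeta>
  proof -
    have M0: "0 \<le> M" using \<zeta> \<rho> by (intro order.trans[OF norm_ge_zero M[of 0 \<zeta>]]) auto
    have "(\<lambda>k. c (k + Suc n) \<zeta> * w j ^ (k + Suc n)) sums (G (w j) \<zeta> - (\<Sum>k<Suc n. c k \<zeta> * w j ^ k))"
      using c_sums[OF \<zeta> w(3)] by (rule sums_split_initial_segment)
    then have "(\<lambda>k. c (k + Suc n) \<zeta> * w j ^ (k + Suc n) / w j ^ n) sums
        ((G (w j) \<zeta> - (\<Sum>k<Suc n. c k \<zeta> * w j ^ k)) / w j ^ n)"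
      by (rule sums_divide)
    also have "(\<lambda>k. c (k + Suc n) \<zeta> * w j ^ (k + Suc n) / w j ^ n) = (\<lambda>k. c (k + Suc n) \<zeta> * w j ^ Suc k)"
      using w(1)[of j] by (simp add: fun_eq_iff power_add)
    also have "(G (w j) \<zeta> - (\<Sum>k<Suc n. c k \<zeta> * w j ^ k)) / w j ^ n = h j \<zeta> - c n \<zeta>"
      using w(1)[of j] by (simp add: h_def field_simps)
    finally have s: "(\<lambda>k. c (k + Suc n) \<zeta> * w j ^ Suc k) sums (h j \<zeta> - c n \<zeta>)" .
    have g: "(\<lambda>k. M / \<rho> ^ n * t j * t j ^ k) sums (M / \<rho> ^ n * t j * (1 / (1 - t j)))"
      using t[of j] by (intro sums_mult geometric_sums) auto
    have "norm (h j \<zeta> - c n \<zeta>) \<le> M / \<rho> ^ n * t j * (1 / (1 - t j))"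
    proof (rule norm_sums_le[OF s g])
      fix k
      have "norm (c (k + Suc n) \<zeta> * w j ^ Suc k) \<le> M / \<rho> ^ (k + Suc n) * (\<rho> * t j) ^ Suc k"
        unfolding norm_mult norm_power w(2)
        using \<rho> t(1)[of j] by (intro mult_right_mono c_bound \<zeta>) auto
      also have "\<dots> = M / \<rho> ^ n * t j * t j ^ k"
        using \<rho> by (simp add: power_add power_mult_distrib field_simps)
      finally show "norm (c (k + Suc n) \<zeta> * w j ^ Suc k) \<le> M / \<rho> ^ n * t j * t j ^ k" .
    qed
    also have "\<dots> \<le> M / \<rho> ^ n * t j * 2"
      using t[of j] \<rho> M0 by (intro mult_left_mono) (auto simp: field_simps)
    finally show ?thesis by (simp add: mult_ac)
  qed
  have ulim: "uniform_limit U h (c n) sequentially"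
  proof (rule uniform_limitI)
    fix \<epsilon> :: real assume "\<epsilon> > 0"
    have "t \<longlonglongrightarrow> 0"
      using LIMSEQ_ignore_initial_segment[OF lim_1_over_n[where 'a = real], of 2]
      by (simp add: t_def[abs_def] add.commute)
    then have "(\<lambda>j. 2 * M / \<rho> ^ n * t j) \<longlonglongrightarrow> 0" by (rule tendsto_mult_right_zero)
    then have "\<forall>\<^sub>F j in sequentially. 2 * M / \<rho> ^ n * t j < \<epsilon>"
      using \<open>\<epsilon> > 0\<close> by (rule order_tendstoD)
    then show "\<forall>\<^sub>F j in sequentially. \<forall>\<zeta>\<in>U. dist (h j \<zeta>) (c n \<zeta>) < \<epsilon>"
      by eventually_elim (auto simp: dist_norm intro: le_less_trans[OF h_err])
  qed
  have "\<exists>d>0. cball x d \<subseteq> U \<and> uniform_limit (cball x d) h (c n) sequentially" if "x \<in> U" for x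
    using U that open_contains_cball uniform_limit_on_subset[OF ulim] by metis
  with holh have "c n holomorphic_on U" by (rule holomorphic_uniform_sequence[OF U])
  then show ?case by (simp add: c_def[abs_def])
qed

text \<open>Expand in the first variable; by the Cauchy inequality and
  \<open>coeff_holomorphic\<close> its Taylor coefficients \<open>G n\<close> satisfy the hypotheses
  in the remaining variables. The Cauchy estimates for c are part of the conclusion because they
  pass through the induction and then give joint summability by Abel's lemma. Points are total
  functions, so the last hypothesis makes F a function of the listed coordinates.\<close>

theorem polydisc_power_series:
  fixes F :: "('k \<Rightarrow> complex) \<Rightarrow> complex"
  assumes "distinct ks"
    and "\<And>\<beta>. \<beta> \<in> set ks \<Longrightarrow> 0 < R \<beta>"
    and "\<And>z \<gamma>. \<gamma> \<in> set ks \<Longrightarrow> (\<And>\<beta>. \<beta> \<in> set ks \<Longrightarrow> norm (z \<beta>) < R \<beta>) \<Longrightarrow>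
        (\<lambda>w. F (z(\<gamma> := w))) holomorphic_on ball 0 (R \<gamma>)"
    and "\<And>\<rho>. (\<And>\<beta>. \<beta> \<in> set ks \<Longrightarrow> 0 < \<rho> \<beta> \<and> \<rho> \<beta> < R \<beta>) \<Longrightarrow>
        \<exists>M. \<forall>z. (\<forall>\<beta>\<in>set ks. norm (z \<beta>) \<le> \<rho> \<beta>) \<longrightarrow> norm (F z) \<le> M"
    and "\<And>z z'. (\<And>\<beta>. \<beta> \<in> set ks \<Longrightarrow> z \<beta> = z' \<beta>) \<Longrightarrow> F z = F z'"
  shows "\<exists>c. (\<forall>\<rho> M. (\<forall>\<beta>\<in>set ks. 0 < \<rho> \<beta> \<and> \<rho> \<beta> < R \<beta>) \<longrightarrow>
            (\<forall>z. (\<forall>\<beta>\<in>set ks. norm (z \<beta>) \<le> \<rho> \<beta>) \<longrightarrow> norm (F z) \<le> M) \<longrightarrow>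
            (\<forall>I\<in>exponents ks. norm (c I) * mon ks \<rho> I \<le> M)) \<and>
        (\<forall>z. (\<forall>\<beta>\<in>set ks. norm (z \<beta>) < R \<beta>) \<longrightarrow>
            ((\<lambda>I. c I * mon ks z I) has_sum F z) (exponents ks))"
  using assms
proof (induction ks arbitrary: F)
  case Nil
  have "F z = F (\<lambda>_. 0)" for z by (rule Nil.prems(5)) simp
  then have "((\<lambda>I. F (\<lambda>_. 0) * mon [] z I) has_sum F z) (exponents [])" for z
    by (simp add: exponents_Nil has_sum_finite_iff)
  then show ?case by (intro exI[of _ "\<lambda>_. F (\<lambda>_. 0)"]) auto
next
  case (Cons \<gamma> ks)
  note hol = Cons.prems(3) and bdd = Cons.prems(4) and cong = Cons.prems(5)
  have R: "0 < R \<beta>" if "\<beta> \<in> set (\<gamma> # ks)" for \<beta> using that Cons.prems(2) by blast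
  have dist: "distinct ks" "\<gamma> \<notin> set ks" using Cons.prems(1) by auto
  define G where "G n z = (deriv ^^ n) (\<lambda>w. F (z(\<gamma> := w))) 0 / fact n" for n z
  have holw: "(\<lambda>w. F (z(\<gamma> := w))) holomorphic_on ball 0 (R \<gamma>)"
    if "\<And>\<beta>. \<beta> \<in> set ks \<Longrightarrow> norm (z \<beta>) < R \<beta>" for z
  proof -
    have "(\<lambda>w. F ((z(\<gamma> := 0))(\<gamma> := w))) holomorphic_on ball 0 (R \<gamma>)"
      using that R[of \<gamma>] by (intro hol) auto
    then show ?thesis by (simp only: fun_upd_upd)
  qed
  have G_bound: "norm (G n z) \<le> M / \<rho> \<gamma> ^ n"
    if \<rho>: "\<forall>\<beta>\<in>set (\<gamma> # ks). 0 < \<rho> \<beta> \<and> \<rho> \<beta> < R \<beta>"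
    and M: "\<forall>z. (\<forall>\<beta>\<in>set (\<gamma> # ks). norm (z \<beta>) \<le> \<rho> \<beta>) \<longrightarrow> norm (F z) \<le> M"
    and z: "\<forall>\<beta>\<in>set ks. norm (z \<beta>) \<le> \<rho> \<beta>" for n z \<rho> M
  proof -
    have zR: "norm (z \<beta>) < R \<beta>" if "\<beta> \<in> set ks" for \<beta>
      using that \<rho> z by (meson le_less_trans list.set_intros(2))
    have "(\<lambda>w. F (z(\<gamma> := w))) holomorphic_on cball 0 (\<rho> \<gamma>)"
      using \<rho> by (intro holomorphic_on_subset[OF holw[OF zR]]) auto
    then have "norm ((deriv ^^ n) (\<lambda>w. F (z(\<gamma> := w))) 0) \<le> fact n * M / \<rho> \<gamma> ^ n"
      using \<rho> M z
      by (intro Cauchy_inequality) (auto intro: holomorphic_on_subset holomorphic_on_imp_continuous_on)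
    then show ?thesis by (simp add: G_def norm_divide field_simps)
  qed
  have between: "\<exists>\<rho>. \<forall>\<beta>\<in>set (\<gamma> # ks). 0 < \<rho> \<beta> \<and> norm (z \<beta>) < \<rho> \<beta> \<and> \<rho> \<beta> < R \<beta>"
    if "\<forall>\<beta>\<in>set (\<gamma> # ks). norm (z \<beta>) < R \<beta>" for z :: "'k \<Rightarrow> complex"
    using that by (intro exI[of _ "\<lambda>\<beta>. (norm (z \<beta>) + R \<beta>) / 2"])
      (auto intro: le_less_trans[OF norm_ge_zero] simp: add_nonneg_pos R)
  define Q where "Q n c \<longleftrightarrow> (\<forall>\<rho> M. (\<forall>\<beta>\<in>set ks. 0 < \<rho> \<beta> \<and> \<rho> \<beta> < R \<beta>) \<longrightarrow>
            (\<forall>z. (\<forall>\<beta>\<in>set ks. norm (z \<beta>) \<le> \<rho> \<beta>) \<longrightarrow> norm (G n z) \<le> M) \<longrightarrow>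
            (\<forall>I\<in>exponents ks. norm (c I) * mon ks \<rho> I \<le> M)) \<and>
        (\<forall>z. (\<forall>\<beta>\<in>set ks. norm (z \<beta>) < R \<beta>) \<longrightarrow>
            ((\<lambda>I. c I * mon ks z I) has_sum G n z) (exponents ks))" for n c
  have "\<exists>c. Q n c" for n
    unfolding Q_def
  proof (rule Cons.IH)
    show "distinct ks" by fact
    show "0 < R \<beta>" if "\<beta> \<in> set ks" for \<beta> using that R by simp
    show "G n z = G n z'" if "\<And>\<beta>. \<beta> \<in> set ks \<Longrightarrow> z \<beta> = z' \<beta>" for z z'
    proof -
      have "F (z(\<gamma> := w)) = F (z'(\<gamma> := w))" for w by (rule cong) (use that in auto)
      then show ?thesis by (simp add: G_def)
    qed
    show "\<exists>M. \<forall>z. (\<forall>\<beta>\<in>set ks. norm (z \<beta>) \<le> \<rho> \<beta>) \<longrightarrow> norm (G n z) \<le> M"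
      if \<rho>: "\<And>\<beta>. \<beta> \<in> set ks \<Longrightarrow> 0 < \<rho> \<beta> \<and> \<rho> \<beta> < R \<beta>" for \<rho>
    proof -
      \<comment> \<open>Any radius below R \<gamma> for the first variable bounds the coefficients;
        half of R \<gamma> is chosen.\<close>
      define \<rho>' where "\<rho>' = \<rho>(\<gamma> := R \<gamma> / 2)"
      have \<rho>': "\<forall>\<beta>\<in>set (\<gamma> # ks). 0 < \<rho>' \<beta> \<and> \<rho>' \<beta> < R \<beta>"
        using \<rho> dist R[of \<gamma>] by (auto simp: \<rho>'_def)
      obtain M where M: "\<forall>z. (\<forall>\<beta>\<in>set (\<gamma> # ks). norm (z \<beta>) \<le> \<rho>' \<beta>) \<longrightarrow> norm (F z) \<le> M"
        using bdd[of \<rho>'] \<rho>' by blast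
      have eq: "\<rho>' \<beta> = \<rho> \<beta>" if "\<beta> \<in> set ks" for \<beta> using that dist by (auto simp: \<rho>'_def)
      show ?thesis using G_bound[OF \<rho>' M, of _ n] eq by (metis (no_types, lifting))
    qed
    show "(\<lambda>\<zeta>. G n (z(\<gamma>' := \<zeta>))) holomorphic_on ball 0 (R \<gamma>')"
      if \<gamma>': "\<gamma>' \<in> set ks" and z: "\<And>\<beta>. \<beta> \<in> set ks \<Longrightarrow> norm (z \<beta>) < R \<beta>" for z \<gamma>'
    proof -
      have ne: "\<gamma> \<noteq> \<gamma>'" using \<gamma>' dist by auto
      \<comment> \<open>\<open>coeff_holomorphic\<close> wants a bound uniform in \<zeta>, available
        only on smaller discs. Holomorphy is local, so the discs of all radii s < R \<gamma>'
        suffice.\<close>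
      have hol_s: "(\<lambda>\<zeta>. G n (z(\<gamma>' := \<zeta>))) holomorphic_on ball 0 s" if s: "0 < s" "s < R \<gamma>'" for s
        unfolding G_def
      proof (rule coeff_holomorphic[where \<rho> = "R \<gamma> / 2" and R = "R \<gamma>" and G = "\<lambda>w \<zeta>. F (z(\<gamma>' := \<zeta>, \<gamma> := w))"])
        show "(\<lambda>w. F (z(\<gamma>' := \<zeta>, \<gamma> := w))) holomorphic_on ball 0 (R \<gamma>)" if "\<zeta> \<in> ball 0 s" for \<zeta>
          using that s z by (intro holw) auto
        show "(\<lambda>\<zeta>. F (z(\<gamma>' := \<zeta>, \<gamma> := w))) holomorphic_on ball 0 s" if "norm w < R \<gamma>" for w
        proof -
          have "(\<lambda>\<zeta>. F ((z(\<gamma> := w))(\<gamma>' := \<zeta>))) holomorphic_on ball 0 (R \<gamma>')"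
            using that z \<gamma>' by (intro hol) auto
          then show ?thesis
            using s ne by (auto simp: fun_upd_twist intro: holomorphic_on_subset)
        qed
        \<comment> \<open>The closed polydisc with these radii contains all points that occur: the
          fixed coordinates of z, w up to R \<gamma> / 2, and \<zeta> up to s.\<close>
        define \<rho>' where "\<rho>' = (\<lambda>\<beta>. (norm (z \<beta>) + R \<beta>) / 2)(\<gamma> := R \<gamma> / 2, \<gamma>' := s)"
        have \<rho>': "\<forall>\<beta>\<in>set (\<gamma> # ks). 0 < \<rho>' \<beta> \<and> \<rho>' \<beta> < R \<beta>"
          using z s R ne by (auto simp: \<rho>'_def add_nonneg_pos)
        have "\<exists>M. \<forall>z. (\<forall>\<beta>\<in>set (\<gamma> # ks). norm (z \<beta>) \<le> \<rho>' \<beta>) \<longrightarrow> norm (F z) \<le> M"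
          using bdd[of \<rho>'] \<rho>' by blast
        then have M: "\<forall>z. (\<forall>\<beta>\<in>set (\<gamma> # ks). norm (z \<beta>) \<le> \<rho>' \<beta>) \<longrightarrow>
            norm (F z) \<le> (SOME M. \<forall>z. (\<forall>\<beta>\<in>set (\<gamma> # ks). norm (z \<beta>) \<le> \<rho>' \<beta>) \<longrightarrow> norm (F z) \<le> M)"
          by (rule someI_ex)
        show "norm (F (z(\<gamma>' := \<zeta>, \<gamma> := w))) \<le>
            (SOME M. \<forall>z. (\<forall>\<beta>\<in>set (\<gamma> # ks). norm (z \<beta>) \<le> \<rho>' \<beta>) \<longrightarrow> norm (F z) \<le> M)"
          if "norm w \<le> R \<gamma> / 2" "\<zeta> \<in> ball 0 s" for w \<zeta>
          using that z ne by (intro M[rule_format]) (auto simp: \<rho>'_def less_imp_le)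
      qed (use R[of \<gamma>] in auto)
      have "(\<lambda>\<zeta>. G n (z(\<gamma>' := \<zeta>))) field_differentiable (at x)" if x: "x \<in> ball 0 (R \<gamma>')" for x
      proof -
        have s: "0 < (norm x + R \<gamma>') / 2" "(norm x + R \<gamma>') / 2 < R \<gamma>'" "x \<in> ball 0 ((norm x + R \<gamma>') / 2)"
          using x R[of \<gamma>'] \<gamma>' by (auto simp: add_nonneg_pos)
        then show ?thesis
          using holomorphic_on_imp_differentiable_at[OF hol_s open_ball] by blast
      qed
      then show ?thesis
        by (auto simp: holomorphic_on_def intro: field_differentiable_at_within)
    qed
  qed
  then have "\<forall>n. \<exists>c. Q n c" by blast
  from choice[OF this] obtain c where "\<forall>n. Q n (c n)" by blast
  then have Qc: "Q n (c n)" for n by blast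
  have c: "norm (c n I) * mon ks \<rho> I \<le> M"
    if "\<forall>\<beta>\<in>set ks. 0 < \<rho> \<beta> \<and> \<rho> \<beta> < R \<beta>"
      "\<forall>z. (\<forall>\<beta>\<in>set ks. norm (z \<beta>) \<le> \<rho> \<beta>) \<longrightarrow> norm (G n z) \<le> M" "I \<in> exponents ks" for n \<rho> M I
    by (rule Qc[unfolded Q_def, THEN conjunct1, rule_format]) (use that in blast)+
  have c_sum: "((\<lambda>I. c n I * mon ks z I) has_sum G n z) (exponents ks)"
    if "\<forall>\<beta>\<in>set ks. norm (z \<beta>) < R \<beta>" for n z
    by (rule Qc[unfolded Q_def, THEN conjunct2, rule_format]) (use that in blast)
  define d where "d I = c (I \<gamma>) (I(\<gamma> := 0))" for I
  have d_bound: "norm (d I) * mon (\<gamma> # ks) \<rho> I \<le> M"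
    if \<rho>: "\<forall>\<beta>\<in>set (\<gamma> # ks). 0 < \<rho> \<beta> \<and> \<rho> \<beta> < R \<beta>"
    and M: "\<forall>z. (\<forall>\<beta>\<in>set (\<gamma> # ks). norm (z \<beta>) \<le> \<rho> \<beta>) \<longrightarrow> norm (F z) \<le> M"
    and I: "I \<in> exponents (\<gamma> # ks)" for \<rho> M I
  proof -
    have "norm (d I) * mon ks \<rho> (I(\<gamma> := 0)) \<le> M / \<rho> \<gamma> ^ I \<gamma>"
      unfolding d_def using \<rho> I by (intro c) (auto intro!: G_bound[OF \<rho> M] simp: exponents_def)
    then show ?thesis using \<rho> dist by (simp add: field_simps)
  qed
  moreover have "((\<lambda>I. d I * mon (\<gamma> # ks) z I) has_sum F z) (exponents (\<gamma> # ks))"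
    if z: "\<forall>\<beta>\<in>set (\<gamma> # ks). norm (z \<beta>) < R \<beta>" for z
  proof -
    obtain \<rho> where \<rho>: "\<forall>\<beta>\<in>set (\<gamma> # ks). 0 < \<rho> \<beta> \<and> norm (z \<beta>) < \<rho> \<beta> \<and> \<rho> \<beta> < R \<beta>"
      using between[OF z] by blast
    then have \<rho>': "\<forall>\<beta>\<in>set (\<gamma> # ks). 0 < \<rho> \<beta> \<and> \<rho> \<beta> < R \<beta>" by blast
    obtain M where M: "\<forall>z. (\<forall>\<beta>\<in>set (\<gamma> # ks). norm (z \<beta>) \<le> \<rho> \<beta>) \<longrightarrow> norm (F z) \<le> M"
      using bdd[of \<rho>] \<rho>' by blast
    have "(\<lambda>I. norm (d I) * mon (\<gamma> # ks) (\<lambda>\<beta>. norm (z \<beta>)) I) summable_on exponents (\<gamma> # ks)"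
    proof (rule bounded_coeffs_summable[where \<rho> = \<rho> and M = M])
      show "norm (d I) * mon (\<gamma> # ks) \<rho> I \<le> M" if "I \<in> exponents (\<gamma> # ks)" for I
        by (rule d_bound[OF \<rho>' M that])
    qed (use Cons.prems(1) \<rho> in auto)
    then have "(\<lambda>I. norm (d I * mon (\<gamma> # ks) z I)) summable_on exponents (\<gamma> # ks)"
      by (simp only: norm_mult norm_mon)
    then have summ: "(\<lambda>I. d I * mon (\<gamma> # ks) z I) summable_on exponents (\<gamma> # ks)"
      by (rule abs_summable_summable)
    have bij: "bij_betw (\<lambda>(n, I). I(\<gamma> := n)) (UNIV \<times> exponents ks) (exponents (\<gamma> # ks))"
      by (rule bij_betw_exponents_Cons) fact
    have term_eq: "d (I(\<gamma> := n)) * mon (\<gamma> # ks) z (I(\<gamma> := n)) = z \<gamma> ^ n * (c n I * mon ks z I)"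
      if "I \<in> exponents ks" for n I
    proof -
      have "I(\<gamma> := 0) = I" using that dist by (auto simp: exponents_def)
      then show ?thesis using dist by (simp add: d_def)
    qed
    \<comment> \<open>Sum first over the exponents of the remaining variables and then over n; the
      joint summability \<open>summ\<close> justifies this.\<close>
    have "((\<lambda>p. d ((\<lambda>(n, I). I(\<gamma> := n)) p) * mon (\<gamma> # ks) z ((\<lambda>(n, I). I(\<gamma> := n)) p)) has_sum F z)
        (UNIV \<times> exponents ks)"
    proof (rule has_sum_SigmaI)
      show "((\<lambda>I. d ((\<lambda>(n, I). I(\<gamma> := n)) (n, I)) * mon (\<gamma> # ks) z ((\<lambda>(n, I). I(\<gamma> := n)) (n, I))) has_sum
          z \<gamma> ^ n * G n z) (exponents ks)" for n
      proof -
        have "((\<lambda>I. z \<gamma> ^ n * (c n I * mon ks z I)) has_sum z \<gamma> ^ n * G n z) (exponents ks)"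
          using z by (intro has_sum_cmult_right c_sum) auto
        then show ?thesis by (rule has_sum_cong[THEN iffD1, rotated]) (simp only: term_eq case_prod_conv)
      qed
      have "(\<lambda>n. norm (z \<gamma> ^ n * G n z)) summable_on UNIV"
      proof (rule summable_on_comparison_test)
        show "(\<lambda>n. M * (norm (z \<gamma>) / \<rho> \<gamma>) ^ n) summable_on UNIV"
          using \<rho> by (intro summable_on_cmult_right has_sum_imp_summable[OF has_sum_geometric]) auto
        fix n
        have "norm (G n z) \<le> M / \<rho> \<gamma> ^ n"
          using \<rho> by (intro G_bound[OF \<rho>' M]) (auto simp: less_imp_le)
        then have "norm (z \<gamma>) ^ n * norm (G n z) \<le> norm (z \<gamma>) ^ n * (M / \<rho> \<gamma> ^ n)"
          by (intro mult_left_mono) auto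
        then show "norm (z \<gamma> ^ n * G n z) \<le> M * (norm (z \<gamma>) / \<rho> \<gamma>) ^ n"
          by (simp add: norm_mult norm_power power_divide mult_ac)
      qed auto
      then have "summable (\<lambda>n. norm (z \<gamma> ^ n * G n z))"
        by (rule summable_on_UNIV_nonneg_real_iff[THEN iffD1, rotated]) auto
      moreover have "(\<lambda>n. z \<gamma> ^ n * G n z) sums F z"
        using holomorphic_power_series[OF holw, of z "z \<gamma>"] z by (simp add: G_def mult.commute)
      ultimately show "((\<lambda>n. z \<gamma> ^ n * G n z) has_sum F z) UNIV"
        by (rule norm_summable_imp_has_sum)
      show "(\<lambda>p. d ((\<lambda>(n, I). I(\<gamma> := n)) p) * mon (\<gamma> # ks) z ((\<lambda>(n, I). I(\<gamma> := n)) p)) summable_on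
          UNIV \<times> exponents ks"
        using summable_on_reindex_bij_betw[OF bij, of "\<lambda>I. d I * mon (\<gamma> # ks) z I"] summ by (simp only:)
    qed
    then show ?thesis
      using has_sum_reindex_bij_betw[OF bij, of "\<lambda>I. d I * mon (\<gamma> # ks) z I"] by (simp only:)
  qed
  ultimately show ?case by (intro exI[of _ d]) blast
qed

section \<open>Series in block coordinates\<close>

lemma summable_tail:
  fixes M :: "'i \<Rightarrow> real"
  assumes "M summable_on T" "\<epsilon> > 0"
  obtains F where "finite F" "F \<subseteq> T" "\<bar>infsum M (T - F)\<bar> < \<epsilon>"
proof -
  have "(M has_sum infsum M T) T" using assms by simp
  then have "\<forall>\<^sub>F F in finite_subsets_at_top T. dist (sum M F) (infsum M T) < \<epsilon>"
    unfolding has_sum_def using assms(2) by (rule tendstoD)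
  then obtain F where F: "finite F" "F \<subseteq> T" "dist (sum M F) (infsum M T) < \<epsilon>"
    unfolding eventually_finite_subsets_at_top by blast
  have "infsum M (T - F) = infsum M T - infsum M F"
    by (rule infsum_Diff[OF assms(1) _ F(2)]) (use F in auto)
  with F have "\<bar>infsum M (T - F)\<bar> < \<epsilon>" by (simp add: dist_real_def)
  with F show ?thesis using that by blast
qed

lemma has_sum_sum:
  fixes f :: "'k \<Rightarrow> 'i \<Rightarrow> 'b::topological_comm_monoid_add"
  assumes "finite K" "\<And>\<beta>. \<beta> \<in> K \<Longrightarrow> (f \<beta> has_sum S \<beta>) T"
  shows "((\<lambda>i. \<Sum>\<beta>\<in>K. f \<beta> i) has_sum (\<Sum>\<beta>\<in>K. S \<beta>)) T"
  using assms by (induction K) (auto intro!: has_sum_add)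

lemma has_sum_diff:
  fixes f g :: "'i \<Rightarrow> 'b::real_normed_vector"
  assumes "(f has_sum S) T" "(g has_sum S') T"
  shows "((\<lambda>i. f i - g i) has_sum (S - S')) T"
proof -
  have "((\<lambda>i. - g i) has_sum - S') T" using assms(2) by (simp add: has_sum_uminus)
  from has_sum_add[OF assms(1) this] show ?thesis by simp
qed

text \<open>Split off a finite set that carries all but e / 4 of the majorant. The finite part is
  differentiable. By the mean value inequality on the convex set S, each other term deviates from
  its linear part by at most 2 * M i * norm (y - x), so the tail contributes at most e / 2.\<close>

lemma has_derivative_infsum:
  fixes g :: "'i \<Rightarrow> 'v::euclidean_space \<Rightarrow> 'b::banach"
  assumes S: "open S" "convex S" "x \<in> S" and M: "M summable_on T"
    and g: "\<And>i y. i \<in> T \<Longrightarrow> y \<in> S \<Longrightarrow> (g i has_derivative g' i y) (at y)"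
    and gM: "\<And>i y. i \<in> T \<Longrightarrow> y \<in> S \<Longrightarrow> norm (g i y) \<le> M i"
    and g'M: "\<And>i y k. i \<in> T \<Longrightarrow> y \<in> S \<Longrightarrow> norm (g' i y k) \<le> M i * norm k"
  shows "((\<lambda>y. infsum (\<lambda>i. g i y) T) has_derivative (\<lambda>k. infsum (\<lambda>i. g' i x k) T)) (at x)"
proof -
  have sg: "(\<lambda>i. g i y) summable_on T" if "y \<in> S" for y
    by (rule abs_summable_summable, rule Infinite_Sum.abs_summable_on_comparison_test'[OF M]) (use gM that in auto)
  have sg': "(\<lambda>i. g' i x k) summable_on T" for k
    by (rule abs_summable_summable, rule Infinite_Sum.abs_summable_on_comparison_test'[OF summable_on_cmult_left[OF M]])
      (use g'M S in auto)
  have lin: "linear (g' i x)" if "i \<in> T" for i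
    using has_derivative_linear[OF g[OF that S(3)]] .
  have bl: "bounded_linear (\<lambda>k. infsum (\<lambda>i. g' i x k) T)"
  proof (rule bounded_linear_intro[where K = "infsum M T"])
    fix k l :: 'v and r :: real
    have "infsum (\<lambda>i. g' i x (k + l)) T = infsum (\<lambda>i. g' i x k + g' i x l) T"
      by (intro infsum_cong) (simp add: lin linear_add)
    then show "infsum (\<lambda>i. g' i x (k + l)) T = infsum (\<lambda>i. g' i x k) T + infsum (\<lambda>i. g' i x l) T"
      using infsum_add[OF sg' sg'] by simp
    have "infsum (\<lambda>i. g' i x (r *\<^sub>R k)) T = infsum (\<lambda>i. r *\<^sub>R g' i x k) T"
      by (intro infsum_cong) (simp add: lin linear_cmul)
    then show "infsum (\<lambda>i. g' i x (r *\<^sub>R k)) T = r *\<^sub>R infsum (\<lambda>i. g' i x k) T"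
      by (simp add: infsum_scaleR_right)
    have "norm (infsum (\<lambda>i. g' i x k) T) \<le> infsum (\<lambda>i. M i * norm k) T"
      by (rule norm_infsum_le[OF has_sum_infsum[OF sg'] has_sum_infsum[OF summable_on_cmult_left[OF M]]])
        (use g'M S in auto)
    then show "norm (infsum (\<lambda>i. g' i x k) T) \<le> norm k * infsum M T"
      by (simp add: infsum_cmult_left[OF M] mult.commute)
  qed
  show ?thesis
    unfolding has_derivative_at_alt
  proof (intro conjI allI impI bl)
    fix e :: real assume e: "e > 0"
    obtain F where F: "finite F" "F \<subseteq> T" "\<bar>infsum M (T - F)\<bar> < e / 4"
      using summable_tail[OF M, of "e / 4"] e by auto
    have "((\<lambda>y. \<Sum>i\<in>F. g i y) has_derivative (\<lambda>k. \<Sum>i\<in>F. g' i x k)) (at x)"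
      using F S by (intro has_derivative_sum g) auto
    then obtain d where d: "d > 0" "\<And>y. norm (y - x) < d \<Longrightarrow>
        norm ((\<Sum>i\<in>F. g i y) - (\<Sum>i\<in>F. g i x) - (\<Sum>i\<in>F. g' i x (y - x))) \<le> e / 2 * norm (y - x)"
      unfolding has_derivative_at_alt using e by (meson half_gt_zero)
    obtain d' where d': "d' > 0" "ball x d' \<subseteq> S" using S open_contains_ball by blast
    show "\<exists>d>0. \<forall>y. norm (y - x) < d \<longrightarrow>
        norm (infsum (\<lambda>i. g i y) T - infsum (\<lambda>i. g i x) T - infsum (\<lambda>i. g' i x (y - x)) T) \<le> e * norm (y - x)"
    proof (intro exI[of _ "min d d'"] conjI allI impI)
      fix y assume y: "norm (y - x) < min d d'"
      then have yS: "y \<in> S" using d' by (auto simp: dist_norm norm_minus_commute)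
      define R where "R i = g i y - g i x - g' i x (y - x)" for i
      have hR: "(R has_sum (infsum (\<lambda>i. g i y) T - infsum (\<lambda>i. g i x) T - infsum (\<lambda>i. g' i x (y - x)) T)) T"
        unfolding R_def by (intro has_sum_diff has_sum_infsum sg sg' yS S(3))
      then have sR: "R summable_on T" by (rule has_sum_imp_summable)
      have sR': "R summable_on (T - F)" by (rule summable_on_subset_banach[OF sR]) auto
      have sM': "(\<lambda>i. 2 * M i * norm (y - x)) summable_on (T - F)"
        by (intro summable_on_cmult_left summable_on_cmult_right summable_on_subset[OF M]) auto
      have "norm (R i) \<le> 2 * M i * norm (y - x)" if "i \<in> T" for i
      proof -
        have "norm (g i y - g i x) \<le> M i * norm (y - x)"
        proof (rule differentiable_bound[OF S(2)])
          fix z assume "z \<in> S"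
          show "(g i has_derivative g' i z) (at z within S)"
            using g[OF that \<open>z \<in> S\<close>] by (rule has_derivative_at_withinI)
          show "onorm (g' i z) \<le> M i"
            by (intro onorm_le g'M that \<open>z \<in> S\<close>)
        qed (use yS S in auto)
        then show ?thesis
          using g'M[OF that S(3), of "y - x"] norm_triangle_ineq4[of "g i y - g i x" "g' i x (y - x)"]
          by (simp add: R_def)
      qed
      then have "norm (infsum R (T - F)) \<le> infsum (\<lambda>i. 2 * M i * norm (y - x)) (T - F)"
        by (intro norm_infsum_le[OF has_sum_infsum[OF sR'] has_sum_infsum[OF sM']]) auto
      also have "\<dots> = 2 * infsum M (T - F) * norm (y - x)"
        using summable_on_subset[OF M, of "T - F"]
        by (simp add: infsum_cmult_left infsum_cmult_right summable_on_cmult_right)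
      also have "\<dots> \<le> e / 2 * norm (y - x)"
        using F by (intro mult_right_mono) auto
      finally have tail: "norm (infsum R (T - F)) \<le> e / 2 * norm (y - x)" .
      have "sum R F = (\<Sum>i\<in>F. g i y) - (\<Sum>i\<in>F. g i x) - (\<Sum>i\<in>F. g' i x (y - x))"
        by (simp add: R_def sum_subtractf)
      then have head: "norm (sum R F) \<le> e / 2 * norm (y - x)" using d(2)[of y] y by simp
      have "infsum (\<lambda>i. g i y) T - infsum (\<lambda>i. g i x) T - infsum (\<lambda>i. g' i x (y - x)) T = infsum R T"
        by (rule infsumI[OF hR, symmetric])
      also have "\<dots> = infsum R (T - F) + sum R F"
        using infsum_Diff[OF sR _ F(2)] F by simp
      finally show "norm (infsum (\<lambda>i. g i y) T - infsum (\<lambda>i. g i x) T - infsum (\<lambda>i. g' i x (y - x)) T)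
          \<le> e * norm (y - x)"
        using norm_triangle_ineq[of "infsum R (T - F)" "sum R F"] head tail by (simp add: field_simps)
    qed (use d d' in auto)
  qed
qed

text \<open>A discrete Duhamel formula: (b + w)^n differs from b^n by the sum of b^(n-1-k) w (b +
  w)^k over k < n. Inserting the induction hypothesis yields a geometric sum that closes up with
  rate \<rho> + C * \<omega> and the same constant C, as for bounded perturbations of
  semigroups.\<close>

lemma power_perturb_bound:
  fixes b w :: "'a::real_algebra_1" and nm :: "'a \<Rightarrow> real"
  assumes b: "\<And>n x. nm (b ^ n * x) \<le> C * \<rho> ^ n * nm x" and w: "\<And>x. nm (w * x) \<le> \<omega> * nm x"
    and tri: "\<And>x y. nm (x + y) \<le> nm x + nm y" "nm 0 = 0" and nonneg: "C \<ge> 0" "\<rho> \<ge> 0" "\<omega> \<ge> 0" "\<And>x. nm x \<ge> 0"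
  shows "nm ((b + w) ^ n * x) \<le> C * (\<rho> + C * \<omega>) ^ n * nm x"
proof (induction n rule: less_induct)
  case (less n)
  define \<sigma> where "\<sigma> = \<rho> + C * \<omega>"
  have id: "(b + w) ^ n * x = b ^ n * x + (\<Sum>k<n. b ^ (n - Suc k) * (w * ((b + w) ^ k * x)))" for n
  proof (induction n)
    case (Suc n)
    have "(b + w) ^ Suc n * x = b * ((b + w) ^ n * x) + w * ((b + w) ^ n * x)"
      by (simp add: algebra_simps)
    also have "b * ((b + w) ^ n * x) =
        b ^ Suc n * x + (\<Sum>k<n. b ^ Suc (n - Suc k) * (w * ((b + w) ^ k * x)))"
      by (subst Suc) (simp add: distrib_left sum_distrib_left mult.assoc)
    also have "(\<Sum>k<n. b ^ Suc (n - Suc k) * (w * ((b + w) ^ k * x))) =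
        (\<Sum>k<n. b ^ (Suc n - Suc k) * (w * ((b + w) ^ k * x)))"
      by (intro sum.cong) (auto simp: Suc_diff_Suc simp del: power_Suc)
    finally show ?case by simp
  qed simp
  have sum_le: "nm (sum f A) \<le> (\<Sum>i\<in>A. nm (f i))" if "finite A" for f and A :: "nat set"
    using that by (induction A) (auto simp: tri intro: order.trans[OF tri(1)])
  have "nm ((b + w) ^ n * x) \<le>
      nm (b ^ n * x) + (\<Sum>k<n. nm (b ^ (n - Suc k) * (w * ((b + w) ^ k * x))))"
    by (subst id) (intro order.trans[OF tri(1)] add_left_mono sum_le finite_lessThan)
  also have "\<dots> \<le> C * \<rho> ^ n * nm x + (\<Sum>k<n. C * \<rho> ^ (n - Suc k) * (\<omega> * (C * \<sigma> ^ k * nm x)))"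
  proof (intro add_mono sum_mono b)
    fix k assume k: "k \<in> {..<n}"
    have "nm (b ^ (n - Suc k) * (w * ((b + w) ^ k * x))) \<le> C * \<rho> ^ (n - Suc k) * nm (w * ((b + w) ^ k * x))"
      by (rule b)
    also have "\<dots> \<le> C * \<rho> ^ (n - Suc k) * (\<omega> * nm ((b + w) ^ k * x))"
      using nonneg by (intro mult_left_mono w) auto
    also have "\<dots> \<le> C * \<rho> ^ (n - Suc k) * (\<omega> * (C * \<sigma> ^ k * nm x))"
      using nonneg k less unfolding \<sigma>_def by (intro mult_left_mono) auto
    finally show "nm (b ^ (n - Suc k) * (w * ((b + w) ^ k * x))) \<le>
        C * \<rho> ^ (n - Suc k) * (\<omega> * (C * \<sigma> ^ k * nm x))" .
  qed
  also have "\<dots> = C * (\<rho> ^ n + (\<sigma> - \<rho>) * (\<Sum>k<n. \<rho> ^ (n - Suc k) * \<sigma> ^ k)) * nm x"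
    by (simp add: \<sigma>_def sum_distrib_left algebra_simps)
  also have "(\<sigma> - \<rho>) * (\<Sum>k<n. \<rho> ^ (n - Suc k) * \<sigma> ^ k) = \<sigma> ^ n - \<rho> ^ n"
    by (rule power_diff_sumr2[symmetric])
  finally show ?case by (simp add: \<sigma>_def)
qed

text \<open>An even variable and a single Z_k of an odd variable are treated alike: a lead
  direction, together with directions that d'' ties to it through the factors
  \<open>a \<beta> j\<close>. X is the superspace inside the ambient Euclidean space of all pairs of
  \<Lambda>-vectors.\<close>

locale block_coordinates = even_algebra L0
  for L0 :: "'a::{real_algebra_1,euclidean_space} set" +
  fixes ks :: "'k list" and Bl :: "'k \<Rightarrow> nat set" and E :: "'k \<Rightarrow> nat \<Rightarrow> 'v::euclidean_space"
    and a :: "'k \<Rightarrow> nat \<Rightarrow> 'a" and lead :: "'k \<Rightarrow> nat" and X :: "'v set"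
  assumes distinct_ks: "distinct ks"
    and finite_Bl: "\<And>\<beta>. \<beta> \<in> set ks \<Longrightarrow> finite (Bl \<beta>)"
    and lead_Bl: "\<And>\<beta>. \<beta> \<in> set ks \<Longrightarrow> lead \<beta> \<in> Bl \<beta>"
    and E_X: "\<And>\<beta> j. \<beta> \<in> set ks \<Longrightarrow> j \<in> Bl \<beta> \<Longrightarrow> E \<beta> j \<in> X"
    and a_L0: "\<And>\<beta> j. \<beta> \<in> set ks \<Longrightarrow> j \<in> Bl \<beta> \<Longrightarrow> a \<beta> j \<in> L0"
    and a_lead: "\<And>\<beta>. \<beta> \<in> set ks \<Longrightarrow> a \<beta> (lead \<beta>) = 1"
    and a_isotropic: "\<And>\<beta>. \<beta> \<in> set ks \<Longrightarrow> (\<Sum>j\<in>Bl \<beta>. a \<beta> j ^ 2) = 0"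
    and subspace_X: "subspace X"
    and orthonormal: "\<And>\<beta> \<gamma> i j. \<beta> \<in> set ks \<Longrightarrow> \<gamma> \<in> set ks \<Longrightarrow> i \<in> Bl \<beta> \<Longrightarrow> j \<in> Bl \<gamma> \<Longrightarrow>
        E \<beta> i \<bullet> E \<gamma> j = (if \<beta> = \<gamma> \<and> i = j then 1 else 0)"
    and expansion: "\<And>h. h \<in> X \<Longrightarrow> h = (\<Sum>\<beta>\<in>set ks. \<Sum>j\<in>Bl \<beta>. (h \<bullet> E \<beta> j) *\<^sub>R E \<beta> j)"
begin

definition Z :: "'k \<Rightarrow> 'v \<Rightarrow> 'a" where
  "Z \<beta> h = (\<Sum>j\<in>Bl \<beta>. (h \<bullet> E \<beta> j) *\<^sub>R a \<beta> j)"

definition v :: "'k \<Rightarrow> 'v" where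
  "v \<beta> = E \<beta> (lead \<beta>)"

lemma linear_Z: "linear (Z \<beta>)"
  unfolding Z_def
  by (rule linearI) (simp_all add: inner_add_left scaleR_add_left sum.distrib scaleR_sum_right)

lemmas bounded_linear_Z = linear_Z[THEN linear_linear[THEN iffD2]]

lemma Z_L0: "\<beta> \<in> set ks \<Longrightarrow> Z \<beta> h \<in> L0"
  unfolding Z_def using subspace_L0 by (intro subspace_sum subspace_scale a_L0) auto

lemma v_X: "\<beta> \<in> set ks \<Longrightarrow> v \<beta> \<in> X"
  by (simp add: v_def E_X lead_Bl)

lemma Z_E:
  assumes "\<beta> \<in> set ks" "\<gamma> \<in> set ks" "j \<in> Bl \<gamma>"
  shows "Z \<beta> (E \<gamma> j) = (if \<beta> = \<gamma> then a \<gamma> j else 0)"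
proof -
  have "Z \<beta> (E \<gamma> j) = (\<Sum>i\<in>Bl \<beta>. (if \<beta> = \<gamma> \<and> i = j then 1 else 0) *\<^sub>R a \<beta> i)"
    unfolding Z_def using assms by (intro sum.cong) (auto simp: orthonormal)
  then show ?thesis
    using assms finite_Bl[of \<gamma>] by (auto simp: if_distrib[of "\<lambda>x. x *\<^sub>R _"] sum.delta cong: if_cong)
qed

lemma Z_v: "\<beta> \<in> set ks \<Longrightarrow> \<gamma> \<in> set ks \<Longrightarrow> Z \<beta> (v \<gamma>) = (if \<beta> = \<gamma> then 1 else 0)"
  by (simp add: v_def Z_E lead_Bl a_lead)

definition series_term :: "(('k \<Rightarrow> nat) \<Rightarrow> 'a) \<Rightarrow> 'v \<Rightarrow> ('k \<Rightarrow> nat) \<Rightarrow> 'a" where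
  "series_term A h I = A I * mon ks (\<lambda>\<beta>. Z \<beta> h) I"

text \<open>The formal derivative in the block variable \<beta>. At I \<beta> = 0 the factor
  \<open>real (I \<beta>)\<close> removes the truncated exponent.\<close>

definition deriv_term :: "(('k \<Rightarrow> nat) \<Rightarrow> 'a) \<Rightarrow> 'v \<Rightarrow> 'k \<Rightarrow> ('k \<Rightarrow> nat) \<Rightarrow> 'a" where
  "deriv_term A h \<beta> I = real (I \<beta>) *\<^sub>R (A I * mon ks (\<lambda>\<beta>. Z \<beta> h) (I(\<beta> := I \<beta> - 1)))"

section \<open>Termwise differentiation of the series\<close>

lemma power_Z_has_derivative:
  assumes "\<beta> \<in> set ks"
  shows "((\<lambda>h. Z \<beta> h ^ n) has_derivative (\<lambda>k. real n *\<^sub>R (Z \<beta> k * Z \<beta> h ^ (n - 1)))) (at h)"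
proof (induction n)
  case (Suc n)
  have "((\<lambda>h. Z \<beta> h * Z \<beta> h ^ n) has_derivative
      (\<lambda>k. Z \<beta> h * (real n *\<^sub>R (Z \<beta> k * Z \<beta> h ^ (n - 1))) + Z \<beta> k * Z \<beta> h ^ n)) (at h)"
    by (rule bounded_bilinear.FDERIV[OF bounded_bilinear_times
          bounded_linear_imp_has_derivative[OF bounded_linear_Z] Suc])
  moreover have "Z \<beta> h * (real n *\<^sub>R (Z \<beta> k * Z \<beta> h ^ (n - 1))) + Z \<beta> k * Z \<beta> h ^ n =
      real (Suc n) *\<^sub>R (Z \<beta> k * Z \<beta> h ^ (Suc n - 1))" for k
  proof -
    have "Z \<beta> h * (Z \<beta> k * Z \<beta> h ^ (n - 1)) = Z \<beta> k * (Z \<beta> h * Z \<beta> h ^ (n - 1))"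
      using central[OF Z_L0[OF assms]] by (metis mult.assoc)
    then have "Z \<beta> h * (real n *\<^sub>R (Z \<beta> k * Z \<beta> h ^ (n - 1))) = real n *\<^sub>R (Z \<beta> k * Z \<beta> h ^ n)"
      by (cases n) (simp_all del: of_nat_Suc)
    then show ?thesis by (simp add: scaleR_add_left)
  qed
  ultimately show ?case by simp
qed simp

lemma mon_Z_has_derivative:
  assumes "distinct ls" "set ls \<subseteq> set ks"
  shows "((\<lambda>h. mon ls (\<lambda>\<beta>. Z \<beta> h) I) has_derivative
    (\<lambda>k. \<Sum>\<beta>\<in>set ls. real (I \<beta>) *\<^sub>R (Z \<beta> k * mon ls (\<lambda>\<beta>. Z \<beta> h) (I(\<beta> := I \<beta> - 1))))) (at h)"
  using assms
proof (induction ls)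
  case (Cons \<gamma> ls)
  have \<gamma>: "\<gamma> \<in> set ks" "\<gamma> \<notin> set ls" using Cons.prems by auto
  let ?m = "mon ls (\<lambda>\<beta>. Z \<beta> h)"
  have "((\<lambda>h. Z \<gamma> h ^ I \<gamma> * mon ls (\<lambda>\<beta>. Z \<beta> h) I) has_derivative
      (\<lambda>k. Z \<gamma> h ^ I \<gamma> * (\<Sum>\<beta>\<in>set ls. real (I \<beta>) *\<^sub>R (Z \<beta> k * ?m (I(\<beta> := I \<beta> - 1)))) +
        real (I \<gamma>) *\<^sub>R (Z \<gamma> k * Z \<gamma> h ^ (I \<gamma> - 1)) * ?m I)) (at h)"
    by (rule bounded_bilinear.FDERIV[OF bounded_bilinear_times power_Z_has_derivative[OF \<gamma>(1)] Cons.IH])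
      (use Cons.prems in auto)
  moreover have "Z \<gamma> h ^ I \<gamma> * (\<Sum>\<beta>\<in>set ls. real (I \<beta>) *\<^sub>R (Z \<beta> k * ?m (I(\<beta> := I \<beta> - 1)))) +
        real (I \<gamma>) *\<^sub>R (Z \<gamma> k * Z \<gamma> h ^ (I \<gamma> - 1)) * ?m I =
      (\<Sum>\<beta>\<in>set (\<gamma> # ls). real (I \<beta>) *\<^sub>R (Z \<beta> k * mon (\<gamma> # ls) (\<lambda>\<beta>. Z \<beta> h) (I(\<beta> := I \<beta> - 1))))" for k
  proof -
    have "Z \<gamma> h ^ I \<gamma> * (real (I \<beta>) *\<^sub>R (Z \<beta> k * ?m (I(\<beta> := I \<beta> - 1)))) =
        real (I \<beta>) *\<^sub>R (Z \<beta> k * mon (\<gamma> # ls) (\<lambda>\<beta>. Z \<beta> h) (I(\<beta> := I \<beta> - 1)))" if "\<beta> \<in> set ls" for \<beta>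
    proof -
      have "\<beta> \<noteq> \<gamma>" using that \<gamma> by auto
      moreover have "Z \<gamma> h ^ I \<gamma> * Z \<beta> k = Z \<beta> k * Z \<gamma> h ^ I \<gamma>"
        by (intro central power_L0 Z_L0 \<gamma>)
      ultimately show ?thesis by (simp add: mult.assoc[symmetric])
    qed
    then have "Z \<gamma> h ^ I \<gamma> * (\<Sum>\<beta>\<in>set ls. real (I \<beta>) *\<^sub>R (Z \<beta> k * ?m (I(\<beta> := I \<beta> - 1)))) =
        (\<Sum>\<beta>\<in>set ls. real (I \<beta>) *\<^sub>R (Z \<beta> k * mon (\<gamma> # ls) (\<lambda>\<beta>. Z \<beta> h) (I(\<beta> := I \<beta> - 1))))"
      unfolding sum_distrib_left by (rule sum.cong[OF refl])
    moreover have "?m (I(\<gamma> := I \<gamma> - 1)) = ?m I" using \<gamma> by (intro mon_cong) auto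
    then have "real (I \<gamma>) *\<^sub>R (Z \<gamma> k * Z \<gamma> h ^ (I \<gamma> - 1)) * ?m I =
        real (I \<gamma>) *\<^sub>R (Z \<gamma> k * mon (\<gamma> # ls) (\<lambda>\<beta>. Z \<beta> h) (I(\<gamma> := I \<gamma> - 1)))"
      unfolding mon_Cons by (simp only: fun_upd_same mult_scaleR_left mult.assoc)
    ultimately show ?thesis using \<gamma>(2) by (simp only: list.set sum.insert finite_set not_False_eq_True add.commute)
  qed
  ultimately show ?case by (simp only: mon_Cons)
qed simp

text \<open>The values of Z are central and can be moved to the left of all other factors; the
  derivative then has exactly the shape demanded by d''f = 0.\<close>

lemma series_term_has_derivative:
  "((\<lambda>h. series_term A h I) has_derivative (\<lambda>k. \<Sum>\<beta>\<in>set ks. Z \<beta> k * deriv_term A h \<beta> I)) (at h)"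
proof -
  have "bounded_linear (\<lambda>x. A I * x)"
    by (rule bounded_bilinear.bounded_linear_right[OF bounded_bilinear_times])
  then have "((\<lambda>h. series_term A h I) has_derivative
      (\<lambda>k. A I * (\<Sum>\<beta>\<in>set ks. real (I \<beta>) *\<^sub>R (Z \<beta> k * mon ks (\<lambda>\<beta>. Z \<beta> h) (I(\<beta> := I \<beta> - 1)))))) (at h)"
    unfolding series_term_def
    by (rule bounded_linear.has_derivative[OF _ mon_Z_has_derivative]) (use distinct_ks in auto)
  moreover have "A I * (\<Sum>\<beta>\<in>set ks. real (I \<beta>) *\<^sub>R (Z \<beta> k * mon ks (\<lambda>\<beta>. Z \<beta> h) (I(\<beta> := I \<beta> - 1)))) =
      (\<Sum>\<beta>\<in>set ks. Z \<beta> k * deriv_term A h \<beta> I)" for k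
    unfolding deriv_term_def sum_distrib_left
  proof (intro sum.cong refl)
    fix \<beta> assume "\<beta> \<in> set ks"
    then have "A I * Z \<beta> k = Z \<beta> k * A I" using central Z_L0 by metis
    then show "A I * (real (I \<beta>) *\<^sub>R (Z \<beta> k * mon ks (\<lambda>\<beta>. Z \<beta> h) (I(\<beta> := I \<beta> - 1)))) =
        Z \<beta> k * (real (I \<beta>) *\<^sub>R (A I * mon ks (\<lambda>\<beta>. Z \<beta> h) (I(\<beta> := I \<beta> - 1))))"
      by (simp add: mult.assoc[symmetric])
  qed
  ultimately show ?thesis by simp
qed

text \<open>One majorant for terms and first derivatives on a ball of the ambient space:
  \<open>Z \<beta>\<close> is defined everywhere through inner products, so differentiation takes
  place in an open set and is restricted to X afterwards.\<close>

definition dominated_near :: "(('k \<Rightarrow> nat) \<Rightarrow> 'a) \<Rightarrow> 'v \<Rightarrow> real \<Rightarrow> bool" where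
  "dominated_near A h0 \<epsilon> \<longleftrightarrow> (\<exists>M. M summable_on exponents ks \<and> (\<forall>h\<in>ball h0 \<epsilon>. \<forall>I\<in>exponents ks.
     norm (series_term A h I) \<le> M I \<and> (\<forall>\<beta>\<in>set ks. norm (deriv_term A h \<beta> I) \<le> M I)))"

lemma dominated_near_summable:
  assumes "dominated_near A h0 \<epsilon>" "h \<in> ball h0 \<epsilon>"
  shows "(\<lambda>I. norm (series_term A h I)) summable_on exponents ks"
    and "\<beta> \<in> set ks \<Longrightarrow> (\<lambda>I. norm (deriv_term A h \<beta> I)) summable_on exponents ks"
proof -
  obtain M where M: "M summable_on exponents ks"
    "\<And>I. I \<in> exponents ks \<Longrightarrow> norm (series_term A h I) \<le> M I"
    "\<And>I \<beta>. I \<in> exponents ks \<Longrightarrow> \<beta> \<in> set ks \<Longrightarrow> norm (deriv_term A h \<beta> I) \<le> M I"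
    using assms unfolding dominated_near_def by blast
  show "(\<lambda>I. norm (series_term A h I)) summable_on exponents ks"
    using M(1,2) by (rule Infinite_Sum.abs_summable_on_comparison_test')
  show "(\<lambda>I. norm (deriv_term A h \<beta> I)) summable_on exponents ks" if "\<beta> \<in> set ks"
    using M(1) M(3)[OF _ that] by (rule Infinite_Sum.abs_summable_on_comparison_test')
qed

lemma dominated_near_has_derivative:
  assumes "dominated_near A h0 \<epsilon>" "h \<in> ball h0 \<epsilon>"
  shows "((\<lambda>h. infsum (series_term A h) (exponents ks)) has_derivative
    (\<lambda>k. \<Sum>\<beta>\<in>set ks. Z \<beta> k * infsum (deriv_term A h \<beta>) (exponents ks))) (at h)"
proof -
  obtain M where M: "M summable_on exponents ks"
    and bnd: "\<And>h I. h \<in> ball h0 \<epsilon> \<Longrightarrow> I \<in> exponents ks \<Longrightarrow> norm (series_term A h I) \<le> M I"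
      "\<And>h I \<beta>. h \<in> ball h0 \<epsilon> \<Longrightarrow> I \<in> exponents ks \<Longrightarrow> \<beta> \<in> set ks \<Longrightarrow> norm (deriv_term A h \<beta> I) \<le> M I"
    using assms(1) unfolding dominated_near_def by blast
  obtain B where B: "B \<ge> 1" "\<And>x y :: 'a. norm (x * y) \<le> B * norm x * norm y"
    using mult_norm_bound by blast
  \<comment> \<open>C bounds all multiplications by \<open>Z \<beta> k\<close> relative to norm k,
    so (1 + C) * M I majorises terms and derivatives at once.\<close>
  define C where "C = (\<Sum>\<beta>\<in>set ks. B * onorm (Z \<beta>))"
  have C: "C \<ge> 0" unfolding C_def
    using B by (intro sum_nonneg mult_nonneg_nonneg onorm_pos_le bounded_linear_Z) auto
  have M0: "0 \<le> M I" if "I \<in> exponents ks" for I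
    using bnd(1)[OF assms(2) that] norm_ge_zero order.trans by blast
  have "((\<lambda>h. infsum (series_term A h) (exponents ks)) has_derivative
      (\<lambda>k. infsum (\<lambda>I. \<Sum>\<beta>\<in>set ks. Z \<beta> k * deriv_term A h \<beta> I) (exponents ks))) (at h)"
  proof (rule has_derivative_infsum[where S = "ball h0 \<epsilon>" and M = "\<lambda>I. (1 + C) * M I"])
    fix I h assume I: "I \<in> exponents ks" and h: "h \<in> ball h0 \<epsilon>"
    show "norm (series_term A h I) \<le> (1 + C) * M I"
      using bnd(1)[OF h I] C M0[OF I] by (simp add: algebra_simps add_increasing2)
    show "norm (\<Sum>\<beta>\<in>set ks. Z \<beta> k * deriv_term A h \<beta> I) \<le> (1 + C) * M I * norm k" for k
    proof -
      have "norm (\<Sum>\<beta>\<in>set ks. Z \<beta> k * deriv_term A h \<beta> I) \<le>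
          (\<Sum>\<beta>\<in>set ks. B * (onorm (Z \<beta>) * norm k) * M I)"
      proof (intro sum_norm_le)
        fix \<beta> assume \<beta>: "\<beta> \<in> set ks"
        have "norm (Z \<beta> k * deriv_term A h \<beta> I) \<le> B * norm (Z \<beta> k) * norm (deriv_term A h \<beta> I)" by (rule B)
        also have "\<dots> \<le> B * (onorm (Z \<beta>) * norm k) * M I"
          using bnd(2)[OF h I \<beta>] B
          by (intro mult_mono mult_left_mono onorm bounded_linear_Z mult_nonneg_nonneg onorm_pos_le) auto
        finally show "norm (Z \<beta> k * deriv_term A h \<beta> I) \<le> B * (onorm (Z \<beta>) * norm k) * M I" .
      qed
      also have "\<dots> = C * M I * norm k" by (simp add: C_def sum_distrib_left sum_distrib_right mult_ac)
      also have "\<dots> \<le> (1 + C) * M I * norm k"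
        using M0[OF I] by (intro mult_right_mono) auto
      finally show ?thesis .
    qed
  qed (use assms(2) M in \<open>auto intro: summable_on_cmult_right series_term_has_derivative\<close>)
  moreover have "infsum (\<lambda>I. \<Sum>\<beta>\<in>set ks. Z \<beta> k * deriv_term A h \<beta> I) (exponents ks) =
      (\<Sum>\<beta>\<in>set ks. Z \<beta> k * infsum (deriv_term A h \<beta>) (exponents ks))" for k
  proof (intro infsumI has_sum_sum)
    fix \<beta> assume "\<beta> \<in> set ks"
    then have "(deriv_term A h \<beta> has_sum infsum (deriv_term A h \<beta>) (exponents ks)) (exponents ks)"
      by (rule has_sum_infsum[OF abs_summable_summable[OF dominated_near_summable(2)[OF assms]]])
    then show "((\<lambda>I. Z \<beta> k * deriv_term A h \<beta> I) has_sum Z \<beta> k * infsum (deriv_term A h \<beta>) (exponents ks)) (exponents ks)"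
      by (rule has_sum_bounded_linear[OF bounded_bilinear.bounded_linear_right[OF bounded_bilinear_times]])
  qed auto
  ultimately show ?thesis by simp
qed

section \<open>From absolute convergence at one point to domination near another\<close>

lemma power_mult_central:
  assumes "y \<in> L0"
  shows "(x * y) ^ n = x ^ n * y ^ n"
proof (induction n)
  case (Suc n)
  have "(x * y) ^ Suc n = x * (y * x ^ n) * y ^ n" by (simp add: Suc mult.assoc)
  also have "y * x ^ n = x ^ n * y" using assms by (rule central)
  finally show ?case by (simp add: mult.assoc)
qed simp

lemma mon_mult_central:
  assumes "\<And>\<beta>. \<beta> \<in> set ls \<Longrightarrow> y \<beta> \<in> L0"
  shows "mon ls (\<lambda>\<beta>. x \<beta> * y \<beta>) I = mon ls x I * mon ls y I"
  using assms
proof (induction ls)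
  case (Cons \<beta> ls)
  have "y \<beta> ^ I \<beta> * mon ls x I = mon ls x I * y \<beta> ^ I \<beta>"
    using Cons.prems by (intro central power_L0) auto
  then have "y \<beta> ^ I \<beta> * (mon ls x I * mon ls y I) = mon ls x I * (y \<beta> ^ I \<beta> * mon ls y I)"
    by (simp only: mult.assoc[symmetric])
  then show ?case using Cons by (simp add: power_mult_central mult.assoc)
qed simp

lemma mon_Suc_central:
  assumes "distinct ls" "\<beta> \<in> set ls" "x \<beta> \<in> L0"
  shows "mon ls x (I(\<beta> := Suc n)) = mon ls x (I(\<beta> := n)) * x \<beta>"
  using assms(1,2)
proof (induction ls)
  case (Cons \<gamma> ls)
  show ?case
  proof (cases "\<beta> = \<gamma>")
    case True
    have "mon ls x (I(\<beta> := k)) = mon ls x I" for k using Cons.prems True by (intro mon_cong) auto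
    then show ?thesis
      unfolding True[symmetric] mon_Cons fun_upd_same
      using central[OF assms(3), of "x \<beta> ^ n * mon ls x I"] by (simp add: mult.assoc)
  next
    case False
    then show ?thesis using Cons by (simp add: mult.assoc)
  qed
qed simp

lemma mon_le_1:
  assumes "\<And>\<beta>. \<beta> \<in> set ls \<Longrightarrow> 0 \<le> x \<beta> \<and> x \<beta> \<le> (1 :: real)"
  shows "mon ls x I \<le> 1"
  using assms by (induction ls) (auto intro!: mult_le_one power_le_one mon_nonneg)

lemma mon_le_power:
  assumes "\<beta> \<in> set ls" "\<And>\<beta>. \<beta> \<in> set ls \<Longrightarrow> 0 \<le> x \<beta> \<and> x \<beta> \<le> (1 :: real)"
  shows "mon ls x I \<le> x \<beta> ^ I \<beta>"
  using assms
proof (induction ls)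
  case (Cons \<gamma> ls)
  have p: "0 \<le> x \<gamma> ^ I \<gamma>" "x \<gamma> ^ I \<gamma> \<le> 1" "0 \<le> mon ls x I" "mon ls x I \<le> 1"
    using Cons.prems by (auto intro!: power_le_one mon_nonneg mon_le_1)
  show ?case
  proof (cases "\<beta> = \<gamma>")
    case True
    then show ?thesis using p mult_left_mono[OF p(4) p(1)] by simp
  next
    case False
    then have "mon ls x I \<le> x \<beta> ^ I \<beta>" using Cons by auto
    then show ?thesis using mult_left_le_one_le[OF p(3) p(1) p(2)] by simp
  qed
qed simp

text \<open>Each variable is estimated through its whole power, so the loss is one factor
  \<open>B * C\<close> per variable and does not depend on the exponents.\<close>

lemma norm_mult_mon_le:
  fixes x :: 'a
  assumes B: "B \<ge> 1" "\<And>x y :: 'a. norm (x * y) \<le> B * norm x * norm y"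
    and y: "\<And>\<beta> n. \<beta> \<in> set ls \<Longrightarrow> norm (y \<beta> ^ n) \<le> C * \<theta> \<beta> ^ n" and "\<And>\<beta>. \<beta> \<in> set ls \<Longrightarrow> \<theta> \<beta> \<ge> 0" "C \<ge> 0"
  shows "norm (x * mon ls y I) \<le> norm x * (B * C) ^ length ls * mon ls \<theta> I"
  using y assms(4)
proof (induction ls arbitrary: x)
  case (Cons \<beta> ls)
  have "norm (x * mon (\<beta> # ls) y I) = norm ((x * y \<beta> ^ I \<beta>) * mon ls y I)"
    by (simp add: mult.assoc)
  also have "\<dots> \<le> norm (x * y \<beta> ^ I \<beta>) * (B * C) ^ length ls * mon ls \<theta> I"
    using Cons by auto
  also have "\<dots> \<le> (B * norm x * (C * \<theta> \<beta> ^ I \<beta>)) * (B * C) ^ length ls * mon ls \<theta> I"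
  proof (intro mult_right_mono mon_nonneg zero_le_power)
    have "norm (x * y \<beta> ^ I \<beta>) \<le> B * norm x * norm (y \<beta> ^ I \<beta>)" by (rule B)
    also have "\<dots> \<le> B * norm x * (C * \<theta> \<beta> ^ I \<beta>)"
      using Cons.prems B(1) by (intro mult_left_mono) auto
    finally show "norm (x * y \<beta> ^ I \<beta>) \<le> B * norm x * (C * \<theta> \<beta> ^ I \<beta>)" .
  qed (use Cons.prems assms(1,5) in auto)
  finally show ?case by (simp add: mult_ac)
qed simp

text \<open>Absorbs the exponent produced by differentiation: each of the n copies of \<theta> ^ (n
  - 1) is at most one of the first n terms of the geometric series.\<close>

lemma nat_mult_power_le:
  assumes "0 \<le> \<theta>" "\<theta> < (1 :: real)"
  shows "real n * \<theta> ^ (n - 1) \<le> 1 / (1 - \<theta>)"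
proof -
  have "real n * \<theta> ^ (n - 1) = (\<Sum>k<n. \<theta> ^ (n - 1))" by simp
  also have "\<dots> \<le> (\<Sum>k<n. \<theta> ^ k)"
    using assms by (intro sum_mono power_decreasing) auto
  also have "\<dots> = (1 - \<theta> ^ n) / (1 - \<theta>)" using assms by (simp add: sum_gp_strict)
  also have "\<dots> \<le> 1 / (1 - \<theta>)" using assms by (intro divide_right_mono) auto
  finally show ?thesis .
qed

text \<open>Write Z \<beta> h = b1 \<beta> * y h \<beta>. The series at \<open>b1\<close> is
  absolutely summable, and the powers of y h \<beta> decay geometrically for all h near
  \<open>h0\<close>, by perturbation from \<open>h0\<close>. In a derivative the missing factor
  \<open>b1 \<beta>\<close> is compensated by its inverse \<open>b' \<beta>\<close>.\<close>

lemma dominated_nearI: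
  assumes b: "\<And>\<beta>. \<beta> \<in> set ks \<Longrightarrow> b1 \<beta> \<in> L0" "\<And>\<beta>. \<beta> \<in> set ks \<Longrightarrow> b' \<beta> \<in> L0"
      "\<And>\<beta>. \<beta> \<in> set ks \<Longrightarrow> b' \<beta> * b1 \<beta> = 1"
    and summ: "(\<lambda>I. norm (A I * mon ks b1 I)) summable_on exponents ks"
    and \<rho>: "0 < \<rho>" "\<rho> < 1" "C > 0"
    and C: "\<And>\<beta> n. \<beta> \<in> set ks \<Longrightarrow> norm ((Z \<beta> h0 * b' \<beta>) ^ n) \<le> C * \<rho> ^ n"
  shows "\<exists>\<epsilon>>0. dominated_near A h0 \<epsilon>"
proof -
  obtain B where B: "B \<ge> 1" "\<And>x y :: 'a. norm (x * y) \<le> B * norm x * norm y"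
    using mult_norm_bound by blast
  \<comment> \<open>Halfway between \<rho> and 1, which leaves room for the perturbation from
    \<open>h0\<close> to h.\<close>
  define \<theta> where "\<theta> = (1 + \<rho>) / 2"
  have \<theta>: "0 < \<theta>" "\<theta> < 1" using \<rho> by (auto simp: \<theta>_def)
  define C1 where "C1 = B * C"
  have C1: "C1 > 0" using B \<rho> by (simp add: C1_def)
  \<comment> \<open>K \<beta> * norm (h - h0) bounds the increase of the rate \<rho> in
    \<open>power_perturb_bound\<close>; \<epsilon> is chosen so that the increase stays within
    \<theta> - \<rho> = (1 - \<rho>) / 2.\<close>
  define K where "K \<beta> = C1 * (B * (B * onorm (Z \<beta>) * norm (b' \<beta>)))" for \<beta>
  have K: "0 \<le> K \<beta>" for \<beta>
    using B C1 by (auto simp: K_def intro!: mult_nonneg_nonneg onorm_pos_le bounded_linear_Z)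
  define \<epsilon> where "\<epsilon> = (1 - \<rho>) / 2 / (1 + sum K (set ks))"
  have sK: "1 + sum K (set ks) > 0" using sum_nonneg[of "set ks" K] K by (smt (verit))
  have \<epsilon>: "\<epsilon> > 0" using \<rho> sK by (simp add: \<epsilon>_def)
  define y where "y h \<beta> = Z \<beta> h * b' \<beta>" for h \<beta>
  have y_L0: "y h \<beta> \<in> L0" if "\<beta> \<in> set ks" for h \<beta> using that b Z_L0 mult_L0 by (simp add: y_def)
  have y_bound: "norm (y h \<beta> ^ n) \<le> C1 * norm (1 :: 'a) * \<theta> ^ n" if h: "h \<in> ball h0 \<epsilon>" and \<beta>: "\<beta> \<in> set ks" for h \<beta> n
  proof -
    define w where "w = Z \<beta> (h - h0) * b' \<beta>"
    have yw: "y h \<beta> = y h0 \<beta> + w"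
      by (simp add: y_def w_def linear_diff[OF linear_Z] algebra_simps)
    have "norm w \<le> B * norm (Z \<beta> (h - h0)) * norm (b' \<beta>)" unfolding w_def by (rule B)
    also have "\<dots> \<le> B * (onorm (Z \<beta>) * norm (h - h0)) * norm (b' \<beta>)"
      using B by (intro mult_right_mono mult_left_mono onorm bounded_linear_Z) auto
    finally have w: "C1 * (B * norm w) \<le> K \<beta> * norm (h - h0)"
      using B C1 by (simp add: K_def mult.assoc mult_left_mono mult.commute[of "norm (h - h0)"])
    also have "\<dots> \<le> (1 + sum K (set ks)) * \<epsilon>"
    proof (intro mult_mono)
      show "K \<beta> \<le> 1 + sum K (set ks)" using member_le_sum[of \<beta> "set ks" K] \<beta> K by auto
      show "norm (h - h0) \<le> \<epsilon>" using h by (simp add: dist_norm norm_minus_commute)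
    qed (use K sK in auto)
    also have "\<dots> = (1 - \<rho>) / 2"
    proof -
      have "1 + sum K (set ks) \<noteq> 0" using sK by simp
      then show ?thesis unfolding \<epsilon>_def by (metis mult.commute nonzero_divide_eq_eq)
    qed
    finally have small: "\<rho> + C1 * (B * norm w) \<le> \<theta>" by (simp add: \<theta>_def field_simps)
    \<comment> \<open>The perturbation bound concerns powers applied to some x; taking x = 1 brings
      in the factor norm 1.\<close>
    have "norm ((y h0 \<beta> + w) ^ n * 1) \<le> C1 * (\<rho> + C1 * (B * norm w)) ^ n * norm (1 :: 'a)"
    proof (rule power_perturb_bound)
      fix x :: 'a and n
      have "norm (y h0 \<beta> ^ n * x) \<le> B * norm (y h0 \<beta> ^ n) * norm x" by (rule B)
      also have "\<dots> \<le> B * (C * \<rho> ^ n) * norm x"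
        using B C[OF \<beta>] unfolding y_def by (intro mult_right_mono mult_left_mono) auto
      finally show "norm (y h0 \<beta> ^ n * x) \<le> C1 * \<rho> ^ n * norm x" by (simp add: C1_def mult_ac)
      show "norm (w * x) \<le> B * norm w * norm x" by (rule B)
    qed (use C1 \<rho> B in \<open>auto intro: norm_triangle_ineq\<close>)
    also have "\<dots> \<le> C1 * \<theta> ^ n * norm (1 :: 'a)"
      using small C1 \<rho> B by (intro mult_right_mono mult_left_mono power_mono) auto
    finally show ?thesis by (simp add: yw mult_ac)
  qed
  define L where "L = (B * (C1 * norm (1 :: 'a))) ^ length ks"
  have L: "L \<ge> 0" using B C1 by (simp add: L_def)
  have nmon: "norm (x * mon ks (y h) J) \<le> norm x * L * mon ks (\<lambda>_. \<theta>) J" if "h \<in> ball h0 \<epsilon>" for x h J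
    unfolding L_def using norm_mult_mon_le[OF B, of ks "y h" "C1 * norm (1 :: 'a)" "\<lambda>_. \<theta>" x J] y_bound[OF that] \<theta> C1
    by auto
  define A' where "A' I = norm (A I * mon ks b1 I)" for I
  have Zy: "mon ks (\<lambda>\<beta>. Z \<beta> h) J = mon ks b1 J * mon ks (y h) J" for h J
  proof -
    have "mon ks (\<lambda>\<beta>. Z \<beta> h) J = mon ks (\<lambda>\<beta>. b1 \<beta> * y h \<beta>) J"
    proof (rule mon_cong)
      fix \<beta> assume \<beta>: "\<beta> \<in> set ks"
      have "b1 \<beta> * (Z \<beta> h * b' \<beta>) = Z \<beta> h * (b' \<beta> * b1 \<beta>)"
        using central[OF b(1)[OF \<beta>]] by (metis mult.assoc)
      then show "Z \<beta> h = b1 \<beta> * y h \<beta>" using b(3)[OF \<beta>] by (simp add: y_def)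
    qed simp
    then show ?thesis using y_L0 by (simp add: mon_mult_central)
  qed
  define M where "M I = A' I * (L + (\<Sum>\<beta>\<in>set ks. B * norm (b' \<beta>) * L / (1 - \<theta>)))" for I
  have pos: "0 \<le> B * norm (b' \<beta>) * L / (1 - \<theta>)" for \<beta> using B L \<theta> by simp
  have "dominated_near A h0 \<epsilon>"
    unfolding dominated_near_def
  proof (intro exI[of _ M] conjI ballI)
    show "M summable_on exponents ks"
      unfolding M_def A'_def by (intro summable_on_cmult_left summ)
    fix h I assume h: "h \<in> ball h0 \<epsilon>" and I: "I \<in> exponents ks"
    have "norm (series_term A h I) = norm ((A I * mon ks b1 I) * mon ks (y h) I)"
      by (simp add: series_term_def Zy mult.assoc)
    also have "\<dots> \<le> A' I * L * mon ks (\<lambda>_. \<theta>) I" unfolding A'_def by (rule nmon[OF h])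
    also have "\<dots> \<le> A' I * L * 1"
      using L \<theta> by (intro mult_left_mono mon_le_1) (auto simp: A'_def)
    also have "\<dots> \<le> M I"
    proof -
      have "0 \<le> (\<Sum>\<beta>\<in>set ks. B * norm (b' \<beta>) * L / (1 - \<theta>))" by (rule sum_nonneg) (rule pos)
      then have "L * 1 \<le> L + (\<Sum>\<beta>\<in>set ks. B * norm (b' \<beta>) * L / (1 - \<theta>))" by simp
      then show ?thesis unfolding M_def mult.assoc by (rule mult_left_mono) (simp add: A'_def)
    qed
    finally show "norm (series_term A h I) \<le> M I" .
    fix \<beta> assume \<beta>: "\<beta> \<in> set ks"
    show "norm (deriv_term A h \<beta> I) \<le> M I"
    proof (cases "I \<beta>")
      case 0
      then show ?thesis using L pos by (auto simp: deriv_term_def M_def A'_def intro!: mult_nonneg_nonneg add_nonneg_nonneg sum_nonneg)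
    next
      case (Suc n)
      let ?J = "I(\<beta> := n)"
      have "mon ks b1 I = mon ks b1 (I(\<beta> := Suc n))" using Suc by (metis fun_upd_triv)
      then have "mon ks b1 I = mon ks b1 ?J * b1 \<beta>"
        using mon_Suc_central[where x = b1, OF distinct_ks \<beta> b(1)[OF \<beta>]] by simp
      then have J: "mon ks b1 ?J = mon ks b1 I * b' \<beta>"
        using b(3)[OF \<beta>] central[OF b(1)[OF \<beta>]] by (simp add: mult.assoc)
      have "norm (A I * mon ks (\<lambda>\<beta>. Z \<beta> h) ?J) = norm ((A I * mon ks b1 I * b' \<beta>) * mon ks (y h) ?J)"
        by (simp add: Zy J mult.assoc)
      also have "\<dots> \<le> norm (A I * mon ks b1 I * b' \<beta>) * L * mon ks (\<lambda>_. \<theta>) ?J" by (rule nmon[OF h])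
      also have "\<dots> \<le> (B * A' I * norm (b' \<beta>)) * L * \<theta> ^ n"
      proof (intro mult_mono mult_right_mono)
        show "norm (A I * mon ks b1 I * b' \<beta>) \<le> B * A' I * norm (b' \<beta>)" unfolding A'_def by (rule B)
        show "mon ks (\<lambda>_. \<theta>) ?J \<le> \<theta> ^ n" using mon_le_power[OF \<beta>, of "\<lambda>_. \<theta>" ?J] \<theta> by simp
      qed (use B L \<theta> in \<open>auto simp: A'_def intro!: mult_nonneg_nonneg mon_nonneg\<close>)
      finally have "real (Suc n) * norm (A I * mon ks (\<lambda>\<beta>. Z \<beta> h) ?J) \<le>
          real (Suc n) * ((B * A' I * norm (b' \<beta>)) * L * \<theta> ^ n)"
        by (intro mult_left_mono) auto
      also have "\<dots> = (B * A' I * norm (b' \<beta>)) * L * (real (Suc n) * \<theta> ^ (Suc n - 1))" by simp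
      also have "\<dots> \<le> (B * A' I * norm (b' \<beta>)) * L * (1 / (1 - \<theta>))"
        using B L \<theta> by (intro mult_left_mono nat_mult_power_le) (auto simp: A'_def)
      also have "\<dots> = A' I * (B * norm (b' \<beta>) * L / (1 - \<theta>))" by simp
      also have "\<dots> \<le> M I"
        unfolding M_def using L member_le_sum[of \<beta> "set ks" "\<lambda>\<beta>. B * norm (b' \<beta>) * L / (1 - \<theta>)"] \<beta> pos
        by (intro mult_left_mono) (auto simp: A'_def)
      finally show ?thesis using Suc by (simp add: deriv_term_def del: of_nat_Suc)
    qed
  qed
  with \<epsilon> show ?thesis by blast
qed

lemma character_spectrum_finite:
  assumes "b ` K \<subseteq> L0" "finite K"
  shows "finite {\<omega> (b \<beta>) |\<omega> \<beta>. character \<omega> \<and> \<beta> \<in> K}"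
proof -
  have "{\<omega> (b \<beta>) |\<omega> \<beta>. character \<omega> \<and> \<beta> \<in> K} = (\<Union>\<beta>\<in>K. {\<omega> (b \<beta>) |\<omega>. character \<omega>})" by blast
  then show ?thesis using assms by (auto intro!: finite_spectrum)
qed

text \<open>Scaling \<open>h0\<close> by 1 + \<delta> enlarges every nonzero character value, and a
  small multiple of V, on which every \<open>Z \<beta>\<close> is 1, makes the vanishing ones
  nonzero.\<close>

lemma dominating_point:
  assumes h0: "h0 \<in> X" and \<epsilon>: "\<epsilon> > 0"
  obtains h1 where "h1 \<in> X" "dist h1 h0 < \<epsilon>"
    "\<And>\<omega> \<beta>. character \<omega> \<Longrightarrow> \<beta> \<in> set ks \<Longrightarrow> norm (\<omega> (Z \<beta> h0)) < norm (\<omega> (Z \<beta> h1))"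
proof -
  \<comment> \<open>The nonzero moduli at \<open>h0\<close>. They are finitely many, so \<eta> keeps
    them away from 0.\<close>
  define Sp where "Sp = norm ` {\<omega> (Z \<beta> h0) |\<omega> \<beta>. character \<omega> \<and> \<beta> \<in> set ks} - {0}"
  have "finite Sp"
    unfolding Sp_def by (intro finite_Diff finite_imageI character_spectrum_finite) (auto simp: Z_L0)
  moreover have "s > 0" if "s \<in> Sp" for s using that by (auto simp: Sp_def)
  ultimately obtain \<eta> where \<eta>: "\<eta> > 0" "\<And>s. s \<in> Sp \<Longrightarrow> \<eta> \<le> s"
  proof (cases "Sp = {}")
    case False
    with \<open>finite Sp\<close> \<open>\<And>s. s \<in> Sp \<Longrightarrow> s > 0\<close> that[of "Min Sp"] show ?thesis by auto
  qed (use that[of 1] in auto)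
  define \<delta> where "\<delta> = \<epsilon> / 2 / (1 + norm h0)"
  define V where "V = (\<Sum>\<beta>\<in>set ks. v \<beta>)"
  \<comment> \<open>The first bound keeps t below \<delta> * \<eta>, the least gain from scaling, so
    that adding t cannot undo it. The second keeps the displacement by V within \<epsilon> /
    2.\<close>
  define t where "t = min (\<delta> * \<eta> / 2) (\<epsilon> / 2 / (1 + norm V))"
  have pos: "1 + norm h0 > 0" "1 + norm V > 0" by (auto intro: add_pos_nonneg)
  have \<delta>: "\<delta> > 0" using \<epsilon> pos by (simp add: \<delta>_def)
  have t: "t > 0" using \<epsilon> pos \<delta> \<eta> by (simp add: t_def)
  define h1 where "h1 = (1 + \<delta>) *\<^sub>R h0 + t *\<^sub>R V"
  have V: "V \<in> X" unfolding V_def using subspace_X v_X by (intro subspace_sum) auto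
  have "Z \<beta> V = 1" if "\<beta> \<in> set ks" for \<beta>
    using that by (simp add: V_def linear_sum[OF linear_Z] Z_v cong: sum.cong)
  then have Zh1: "Z \<beta> h1 = (1 + \<delta>) *\<^sub>R Z \<beta> h0 + t *\<^sub>R 1" if "\<beta> \<in> set ks" for \<beta>
    using that by (simp add: h1_def linear_add[OF linear_Z] linear_cmul[OF linear_Z])
  show ?thesis
  proof (rule that[of h1])
    show "h1 \<in> X" unfolding h1_def using h0 V subspace_X by (intro subspace_add subspace_scale)
    have "dist h1 h0 = norm (\<delta> *\<^sub>R h0 + t *\<^sub>R V)" by (simp add: h1_def dist_norm algebra_simps)
    also have "\<dots> \<le> \<delta> * norm h0 + t * norm V" using norm_triangle_ineq[of "\<delta> *\<^sub>R h0" "t *\<^sub>R V"] \<delta> t by simp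
    also have "\<dots> < \<delta> * (1 + norm h0) + t * (1 + norm V)" using \<delta> t by (simp add: algebra_simps)
    also have "\<dots> \<le> \<epsilon> / 2 + \<epsilon> / 2"
    proof (intro add_mono)
      have "1 + norm h0 \<noteq> 0" using pos by simp
      then show "\<delta> * (1 + norm h0) \<le> \<epsilon> / 2" unfolding \<delta>_def by (metis nonzero_divide_eq_eq order_refl)
      have "t * (1 + norm V) \<le> \<epsilon> / 2 / (1 + norm V) * (1 + norm V)"
        using pos by (intro mult_right_mono) (auto simp: t_def)
      moreover have "1 + norm V \<noteq> 0" using pos by simp
      then have "\<epsilon> / 2 / (1 + norm V) * (1 + norm V) = \<epsilon> / 2" by (metis nonzero_divide_eq_eq)
      ultimately show "t * (1 + norm V) \<le> \<epsilon> / 2" by linarith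
    qed
    finally show "dist h1 h0 < \<epsilon>" by simp
    fix \<omega> \<beta> assume \<omega>: "character \<omega>" and \<beta>: "\<beta> \<in> set ks"
    interpret linear \<omega> using \<omega> by (simp add: character_def)
    have \<omega>1: "\<omega> 1 = 1" using \<omega> by (simp add: character_def)
    define z where "z = \<omega> (Z \<beta> h0)"
    have eq: "\<omega> (Z \<beta> h1) = of_real (1 + \<delta>) * z + of_real t"
      by (simp add: Zh1[OF \<beta>] add scale \<omega>1 z_def scaleR_conv_of_real[of _ "_ :: complex"])
    show "norm (\<omega> (Z \<beta> h0)) < norm (\<omega> (Z \<beta> h1))"
    proof (cases "z = 0")
      case True
      then show ?thesis using eq t by (simp add: z_def)
    next
      case False
      then have "norm z \<in> Sp" unfolding Sp_def z_def using \<omega> \<beta> by auto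
      then have "\<delta> * \<eta> \<le> \<delta> * norm z" using \<eta> \<delta> by (intro mult_left_mono) auto
      moreover have "t < \<delta> * \<eta>" 
      proof -
        have "t \<le> \<delta> * \<eta> / 2" unfolding t_def by (rule min.cobounded1)
        moreover have "0 < \<delta> * \<eta>" using \<delta> \<eta> by simp
        ultimately show ?thesis by linarith
      qed
      moreover have "norm (of_real (1 + \<delta>) * z) = (1 + \<delta>) * norm z"
        using \<delta> by (simp add: norm_mult del: of_real_add)
      moreover have "norm (of_real (1 + \<delta>) * z) \<le> norm (\<omega> (Z \<beta> h1)) + t"
        using norm_triangle_ineq4[of "\<omega> (Z \<beta> h1)" "of_real t"] t unfolding eq by simp
      ultimately have "norm z < norm (\<omega> (Z \<beta> h1))" by (simp add: distrib_right)
      then show ?thesis by (simp add: z_def)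
    qed
  qed
qed

text \<open>Absolute convergence at the single point \<open>h1\<close> controls the series near \<open>h0\<close>, because every
  \<open>Z \<beta> h0 / Z \<beta> h1\<close> has spectral radius less than 1.\<close>

lemma dominated_near_of_abs_convergence:
  assumes h0: "h0 \<in> X" and \<epsilon>: "\<epsilon> > 0"
    and summ: "\<And>h. h \<in> X \<Longrightarrow> dist h h0 < \<epsilon> \<Longrightarrow> (\<lambda>I. norm (series_term A h I)) summable_on exponents ks"
  shows "\<exists>\<epsilon>>0. dominated_near A h0 \<epsilon>"
proof -
  obtain h1 where h1: "h1 \<in> X" "dist h1 h0 < \<epsilon>"
    and lt: "\<And>\<omega> \<beta>. character \<omega> \<Longrightarrow> \<beta> \<in> set ks \<Longrightarrow> norm (\<omega> (Z \<beta> h0)) < norm (\<omega> (Z \<beta> h1))"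
    using dominating_point[OF h0 \<epsilon>] by blast
  have "\<exists>b'\<in>L0. b' * Z \<beta> h1 = 1" if \<beta>: "\<beta> \<in> set ks" for \<beta>
  proof -
    have "\<omega> (Z \<beta> h1) \<noteq> 0" if "character \<omega>" for \<omega>
      using lt[OF that \<beta>] norm_ge_zero[of "\<omega> (Z \<beta> h0)"] by auto
    then show ?thesis using inverse_exists[OF Z_L0[OF \<beta>], of h1] by blast
  qed
  then obtain b' where b': "\<And>\<beta>. \<beta> \<in> set ks \<Longrightarrow> b' \<beta> \<in> L0" "\<And>\<beta>. \<beta> \<in> set ks \<Longrightarrow> b' \<beta> * Z \<beta> h1 = 1"
    by metis
  define y where "y \<beta> = Z \<beta> h0 * b' \<beta>" for \<beta>
  have y: "y \<beta> \<in> L0" if "\<beta> \<in> set ks" for \<beta> using that b' Z_L0 mult_L0 by (simp add: y_def)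
  have y1: "norm (\<omega> (y \<beta>)) < 1" if "character \<omega>" "\<beta> \<in> set ks" for \<omega> \<beta>
  proof -
    have m: "\<omega> (c * d) = \<omega> c * \<omega> d" if "c \<in> L0" "d \<in> L0" for c d
      using \<open>character \<omega>\<close> that by (simp add: character_def)
    have "\<omega> (b' \<beta>) * \<omega> (Z \<beta> h1) = 1"
      using m[of "b' \<beta>" "Z \<beta> h1"] b' that Z_L0 by (simp add: character_def)
    then have "norm (\<omega> (b' \<beta>)) * norm (\<omega> (Z \<beta> h1)) = 1" by (metis norm_mult norm_one)
    moreover from this have "norm (\<omega> (b' \<beta>)) > 0" by (metis mult_zero_left norm_ge_zero order_less_le zero_neq_one)
    ultimately have "norm (\<omega> (b' \<beta>)) * norm (\<omega> (Z \<beta> h0)) < 1"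
      using lt[OF that] by (metis mult_strict_left_mono)
    then show ?thesis using m[of "Z \<beta> h0" "b' \<beta>"] b' that Z_L0 by (simp add: y_def norm_mult mult.commute)
  qed
  define Sp where "Sp = norm ` {\<omega> (y \<beta>) |\<omega> \<beta>. character \<omega> \<and> \<beta> \<in> set ks}"
  have Sp: "finite Sp" "\<And>s. s \<in> Sp \<Longrightarrow> s < 1"
    unfolding Sp_def using y y1 by (auto intro!: finite_imageI character_spectrum_finite)
  \<comment> \<open>Halfway between the largest spectral value of the quotients and 1; inserting 0
    keeps the maximum meaningful when there are no values.\<close>
  define \<rho> where "\<rho> = (1 + Max (insert 0 Sp)) / 2"
  have Mx: "Max (insert 0 Sp) < 1" "0 \<le> Max (insert 0 Sp)" using Sp by auto
  then have \<rho>: "0 < \<rho>" "\<rho> < 1" by (auto simp: \<rho>_def)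
  have "norm (\<omega> (y \<beta>)) < \<rho>" if "character \<omega>" "\<beta> \<in> set ks" for \<omega> \<beta>
  proof -
    have "norm (\<omega> (y \<beta>)) \<in> Sp" unfolding Sp_def using that by blast
    then have "norm (\<omega> (y \<beta>)) \<le> Max (insert 0 Sp)" using Sp by simp
    then show ?thesis using Mx by (simp add: \<rho>_def)
  qed
  then have "\<exists>C>0. \<forall>n. norm (y \<beta> ^ n) \<le> C * \<rho> ^ n" if "\<beta> \<in> set ks" for \<beta>
    using power_bound[OF y[OF that] \<rho>(1)] that by metis
  then obtain C where C: "\<And>\<beta>. \<beta> \<in> set ks \<Longrightarrow> C \<beta> > 0" "\<And>\<beta> n. \<beta> \<in> set ks \<Longrightarrow> norm (y \<beta> ^ n) \<le> C \<beta> * \<rho> ^ n"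
    by metis
  have "norm (y \<beta> ^ n) \<le> (1 + sum C (set ks)) * \<rho> ^ n" if "\<beta> \<in> set ks" for \<beta> n
  proof -
    have "C \<beta> \<le> sum C (set ks)" by (rule member_le_sum) (use that C(1) in \<open>auto intro: less_imp_le\<close>)
    then have "C \<beta> \<le> 1 + sum C (set ks)" by simp
    then have "C \<beta> * \<rho> ^ n \<le> (1 + sum C (set ks)) * \<rho> ^ n" using \<rho> by (intro mult_right_mono) auto
    then show ?thesis using C(2)[OF that, of n] by linarith
  qed
  moreover have "(\<lambda>I. norm (A I * mon ks (\<lambda>\<beta>. Z \<beta> h1) I)) summable_on exponents ks"
    using summ[OF h1] by (simp add: series_term_def)
  moreover have "1 + sum C (set ks) > 0" using C(1) by (intro add_pos_nonneg sum_nonneg) (auto intro: less_imp_le)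
  ultimately show ?thesis
    using \<rho> b' Z_L0
    by (intro dominated_nearI[of "\<lambda>\<beta>. Z \<beta> h1" b' A \<rho> "1 + sum C (set ks)"]) (auto simp: y_def)
qed

text \<open>The equation d''f = 0 in block form: on X the derivative is a combination of the
  Z-coordinates with coefficients from the lead directions. The condition is confined to h in X
  because D is only relatively open.\<close>

definition qS :: "('v \<Rightarrow> 'a) \<Rightarrow> 'v set \<Rightarrow> bool" where
  "qS f D \<longleftrightarrow> openin (top_of_set X) D \<and>
    (\<forall>x\<in>D. \<exists>f'. (f has_derivative f') (at x within D) \<and> (\<forall>h\<in>X. f' h = (\<Sum>\<beta>\<in>set ks. Z \<beta> h * f' (v \<beta>))))"

text \<open>The converse direction: around each point of D the series converges absolutely on a
  relative ball, so it is dominated near that point and may be differentiated term by term.\<close>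

lemma qS_of_series:
  assumes D: "openin (top_of_set X) D" and c: "c \<in> X"
    and summ: "\<And>x. x \<in> D \<Longrightarrow> (\<lambda>I. norm (series_term A (x - c) I)) summable_on exponents ks"
    and f: "\<And>x. x \<in> D \<Longrightarrow> (series_term A (x - c) has_sum f x) (exponents ks)"
  shows "qS f D"
  unfolding qS_def
proof (intro conjI ballI D)
  fix x assume x: "x \<in> D"
  have xX: "x \<in> X" using x D openin_imp_subset by blast
  obtain \<epsilon> where \<epsilon>: "\<epsilon> > 0" "ball x \<epsilon> \<inter> X \<subseteq> D" using D x by (auto simp: openin_contains_ball)
  have "\<exists>\<epsilon>>0. dominated_near A (x - c) \<epsilon>"
  proof (rule dominated_near_of_abs_convergence[OF _ \<epsilon>(1)])
    show "x - c \<in> X" using xX c subspace_X by (rule subspace_diff[rotated])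
    fix h assume h: "h \<in> X" "dist h (x - c) < \<epsilon>"
    have "h + c \<in> D"
    proof -
      have "h + c \<in> X" using h c subspace_X by (simp add: subspace_add)
      moreover have "dist x (h + c) < \<epsilon>" using h(2) by (simp add: dist_norm norm_minus_commute algebra_simps)
      ultimately show ?thesis using \<epsilon>(2) by auto
    qed
    from summ[OF this] show "(\<lambda>I. norm (series_term A h I)) summable_on exponents ks" by simp
  qed
  then obtain \<epsilon>' where \<epsilon>': "\<epsilon>' > 0" "dominated_near A (x - c) \<epsilon>'" by blast
  define G where "G \<beta> = infsum (deriv_term A (x - c) \<beta>) (exponents ks)" for \<beta>
  have "((\<lambda>h. infsum (series_term A h) (exponents ks)) has_derivative (\<lambda>k. \<Sum>\<beta>\<in>set ks. Z \<beta> k * G \<beta>)) (at (x - c))"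
    unfolding G_def using \<epsilon>' by (intro dominated_near_has_derivative) auto
  then have "((\<lambda>h. infsum (series_term A h) (exponents ks)) \<circ> (\<lambda>x. x - c) has_derivative
      (\<lambda>k. \<Sum>\<beta>\<in>set ks. Z \<beta> k * G \<beta>) \<circ> (\<lambda>k. k)) (at x)"
    by (intro diff_chain_at) (auto intro!: derivative_eq_intros)
  then have "((\<lambda>x. infsum (series_term A (x - c)) (exponents ks)) has_derivative (\<lambda>k. \<Sum>\<beta>\<in>set ks. Z \<beta> k * G \<beta>)) (at x within D)"
    by (simp add: o_def has_derivative_at_withinI)
  then have "(f has_derivative (\<lambda>k. \<Sum>\<beta>\<in>set ks. Z \<beta> k * G \<beta>)) (at x within D)"
    by (rule has_derivative_transform[OF x, rotated]) (simp add: infsumI[OF f])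
  moreover have "(\<Sum>\<beta>\<in>set ks. Z \<beta> (v \<gamma>) * G \<beta>) = G \<gamma>" if "\<gamma> \<in> set ks" for \<gamma>
    using that by (simp add: Z_v if_distrib[of "\<lambda>x. x * _"] sum.delta cong: if_cong sum.cong)
  ultimately show "\<exists>f'. (f has_derivative f') (at x within D) \<and>
      (\<forall>h\<in>X. f' h = (\<Sum>\<beta>\<in>set ks. Z \<beta> h * f' (v \<beta>)))"
    by (intro exI[of _ "\<lambda>k. \<Sum>\<beta>\<in>set ks. Z \<beta> k * G \<beta>"]) (simp cong: sum.cong)
qed

end

section \<open>Expansion of qS-differentiable functions\<close>

lemma has_sum_in_subspace:
  fixes f :: "'i \<Rightarrow> 'b::euclidean_space"
  assumes "subspace S" "(f has_sum s) T" "\<And>i. i \<in> T \<Longrightarrow> f i \<in> S"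
  shows "s \<in> S"
proof (rule Lim_in_closed_set)
  show "closed S" using assms(1) by (rule closed_subspace)
  show "(sum f \<longlongrightarrow> s) (finite_subsets_at_top T)" using assms(2) by (simp add: has_sum_def)
  show "\<forall>\<^sub>F F in finite_subsets_at_top T. sum f F \<in> S"
    by (rule eventually_finite_subsets_at_top_weakI) (use assms in \<open>auto intro!: subspace_sum\<close>)
qed simp

text \<open>D is open only relative to X, but for w in X the line through x stays in D for small t,
  so a derivative within D determines the derivative along that line.\<close>

lemma has_vector_derivative_along:
  fixes f :: "'v::real_normed_vector \<Rightarrow> 'b::real_normed_vector"
  assumes f: "(f has_derivative f') (at x within D)" and D: "openin (top_of_set X) D"
    and X: "subspace X" "x \<in> D" "w \<in> X"
  shows "((\<lambda>t. f (x + t *\<^sub>R w)) has_vector_derivative f' w) (at 0)"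
proof -
  obtain \<epsilon> where \<epsilon>: "\<epsilon> > 0" "ball x \<epsilon> \<inter> X \<subseteq> D" using D X by (auto simp: openin_contains_ball)
  have xX: "x \<in> X" using X D openin_imp_subset by blast
  define \<delta> where "\<delta> = \<epsilon> / (1 + norm w)"
  have pos: "1 + norm w > 0" by (simp add: add_pos_nonneg)
  then have \<delta>: "\<delta> > 0" using \<epsilon> by (simp add: \<delta>_def)
  have in_D: "x + t *\<^sub>R w \<in> D" if "\<bar>t\<bar> < \<delta>" for t
  proof -
    have "\<bar>t\<bar> * norm w \<le> \<bar>t\<bar> * (1 + norm w)" by (intro mult_left_mono) auto
    also have "\<dots> < \<delta> * (1 + norm w)" using that pos by (intro mult_strict_right_mono)
    also have "\<dots> = \<epsilon>" using pos by (simp add: \<delta>_def)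
    finally have "x + t *\<^sub>R w \<in> ball x \<epsilon>" by (simp add: dist_norm)
    moreover have "x + t *\<^sub>R w \<in> X" using X xX by (intro subspace_add subspace_scale)
    ultimately show ?thesis using \<epsilon> by blast
  qed
  have "((\<lambda>t. x + t *\<^sub>R w) has_derivative (\<lambda>t. t *\<^sub>R w)) (at 0 within ball 0 \<delta>)"
    by (auto intro!: derivative_eq_intros)
  moreover have "(f has_derivative f') (at (x + 0 *\<^sub>R w) within (\<lambda>t. x + t *\<^sub>R w) ` ball 0 \<delta>)"
    using f in_D by (auto intro: has_derivative_subset)
  ultimately have "(f \<circ> (\<lambda>t. x + t *\<^sub>R w) has_derivative f' \<circ> (\<lambda>t. t *\<^sub>R w)) (at 0 within ball 0 \<delta>)"
    by (rule diff_chain_within)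
  then have "((\<lambda>t. f (x + t *\<^sub>R w)) has_derivative (\<lambda>t. f' (t *\<^sub>R w))) (at 0)"
    using \<delta> by (simp add: o_def at_within_open[of 0 "ball 0 \<delta>"])
  moreover have "f' (t *\<^sub>R w) = t *\<^sub>R f' w" for t
    using has_derivative_linear[OF f] by (simp add: linear_cmul)
  ultimately show ?thesis by (simp add: has_vector_derivative_def)
qed

text \<open>Pair with the component z of f' w orthogonal to S: the function z \<bullet> f vanishes
  on D, hence so does its derivative z \<bullet> f' w. This keeps derivatives in the submodule on
  which \<phi> is compatible with \<omega>.\<close>

lemma derivative_in_subspace:
  fixes f :: "'v::real_normed_vector \<Rightarrow> 'b::euclidean_space"
  assumes f: "(f has_derivative f') (at x within D)" and D: "openin (top_of_set X) D"
    and X: "subspace X" "x \<in> D" "w \<in> X" and S: "subspace S" "\<And>y. y \<in> D \<Longrightarrow> f y \<in> S"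
  shows "f' w \<in> S"
proof -
  have span: "span S = S" using S by simp
  obtain y z where yz: "y \<in> S" "\<And>u. u \<in> S \<Longrightarrow> orthogonal z u" "f' w = y + z"
    using orthogonal_subspace_decomp_exists[of S "f' w"] unfolding span by blast
  have "((\<lambda>y. z \<bullet> f y) has_derivative (\<lambda>k. z \<bullet> f' k)) (at x within D)"
    by (rule has_derivative_inner_right[OF f])
  then have "((\<lambda>t. z \<bullet> f (x + t *\<^sub>R w)) has_vector_derivative z \<bullet> f' w) (at 0)"
    using has_vector_derivative_along[OF _ D X] by blast
  moreover have "((\<lambda>_. 0 :: real) has_derivative (\<lambda>k. z \<bullet> f' k)) (at x within D)"
    by (rule has_derivative_transform[OF X(2) _ \<open>((\<lambda>y. z \<bullet> f y) has_derivative (\<lambda>k. z \<bullet> f' k)) (at x within D)\<close>])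
      (use yz S in \<open>auto simp: orthogonal_def\<close>)
  then have "((\<lambda>_. 0 :: real) has_vector_derivative z \<bullet> f' w) (at (0 :: real))"
    using has_vector_derivative_along[OF _ D X, of "\<lambda>_. 0 :: real"] by blast
  then have "z \<bullet> f' w = 0"
    using vector_derivative_unique_at has_vector_derivative_const by blast
  then have "z = 0" using yz by (auto simp: inner_add_right orthogonal_def)
  then show ?thesis using yz by simp
qed

context block_coordinates
begin

section \<open>Block norms and block balls\<close>

definition block_norm :: "'k \<Rightarrow> 'v \<Rightarrow> real" where
  "block_norm \<beta> h = L2_set (\<lambda>j. h \<bullet> E \<beta> j) (Bl \<beta>)"

definition block_ball :: "('k \<Rightarrow> real) \<Rightarrow> 'v set" where
  "block_ball T = {h \<in> X. \<forall>\<beta>\<in>set ks. block_norm \<beta> h < T \<beta>}"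

lemma block_norm_nonneg: "0 \<le> block_norm \<beta> h"
  by (simp add: block_norm_def)

lemma continuous_block_norm: "continuous_on UNIV (block_norm \<beta>)"
  unfolding block_norm_def[abs_def] L2_set_def by (intro continuous_intros)

lemma block_norm_add: "block_norm \<beta> (h + k) \<le> block_norm \<beta> h + block_norm \<beta> k"
  unfolding block_norm_def inner_add_left by (rule L2_set_triangle_ineq)

lemma block_norm_scaleR: "block_norm \<beta> (t *\<^sub>R h) = \<bar>t\<bar> * block_norm \<beta> h"
  unfolding block_norm_def inner_scaleR_left
  by (simp add: L2_set_def power_mult_distrib sum_distrib_left[symmetric] real_sqrt_mult)

lemma openin_block_ball: "openin (top_of_set X) (block_ball T)"
proof -
  have "open (\<Inter>\<beta>\<in>set ks. {h. block_norm \<beta> h < T \<beta>})"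
    by (intro open_INT ballI open_Collect_less[OF continuous_block_norm continuous_on_const]) auto
  moreover have "block_ball T = X \<inter> (\<Inter>\<beta>\<in>set ks. {h. block_norm \<beta> h < T \<beta>})"
    by (auto simp: block_ball_def)
  ultimately show ?thesis by (simp add: openin_open_Int)
qed

lemma compact_closed_block_ball: "compact {h \<in> X. \<forall>\<beta>\<in>set ks. block_norm \<beta> h \<le> T \<beta>}"
proof -
  have "closed (X \<inter> (\<Inter>\<beta>\<in>set ks. {h. block_norm \<beta> h \<le> T \<beta>}))"
    by (intro closed_Int closed_INT ballI closed_subspace subspace_X closed_Collect_le[OF continuous_block_norm continuous_on_const])
  moreover have "bounded {h \<in> X. \<forall>\<beta>\<in>set ks. block_norm \<beta> h \<le> T \<beta>}"
    unfolding bounded_iff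
  proof (intro exI ballI)
    fix h assume "h \<in> {h \<in> X. \<forall>\<beta>\<in>set ks. block_norm \<beta> h \<le> T \<beta>}"
    then have h: "h \<in> X" "\<And>\<beta>. \<beta> \<in> set ks \<Longrightarrow> block_norm \<beta> h \<le> T \<beta>" by auto
    have "norm h \<le> (\<Sum>\<beta>\<in>set ks. \<Sum>j\<in>Bl \<beta>. T \<beta> * norm (E \<beta> j))"
    proof -
      have "norm ((h \<bullet> E \<beta> j) *\<^sub>R E \<beta> j) \<le> T \<beta> * norm (E \<beta> j)" if "\<beta> \<in> set ks" "j \<in> Bl \<beta>" for \<beta> j
      proof -
        have "\<bar>h \<bullet> E \<beta> j\<bar> = L2_set (\<lambda>j. h \<bullet> E \<beta> j) {j}" by (simp add: L2_set_def)
        also have "\<dots> \<le> block_norm \<beta> h"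
          unfolding block_norm_def L2_set_def using that finite_Bl
          by (intro real_sqrt_le_mono sum_mono2) auto
        also have "\<dots> \<le> T \<beta>" using h(2) that by blast
        finally show ?thesis by (simp add: mult_right_mono)
      qed
      then have "norm (\<Sum>\<beta>\<in>set ks. \<Sum>j\<in>Bl \<beta>. (h \<bullet> E \<beta> j) *\<^sub>R E \<beta> j) \<le> (\<Sum>\<beta>\<in>set ks. \<Sum>j\<in>Bl \<beta>. T \<beta> * norm (E \<beta> j))"
        by (intro sum_norm_le)
      then show ?thesis using expansion[OF h(1)] by simp
    qed
    then show "norm h \<le> (\<Sum>\<beta>\<in>set ks. \<Sum>j\<in>Bl \<beta>. T \<beta> * norm (E \<beta> j))" .
  qed
  moreover have "{h \<in> X. \<forall>\<beta>\<in>set ks. block_norm \<beta> h \<le> T \<beta>} = X \<inter> (\<Inter>\<beta>\<in>set ks. {h. block_norm \<beta> h \<le> T \<beta>})"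
    by auto
  ultimately show ?thesis by (simp add: compact_eq_bounded_closed)
qed

text \<open>Convexity of the block norms; it keeps the segments of the fibre argument inside the
  block ball.\<close>

lemma block_norm_segment:
  assumes "0 \<le> t" "t \<le> 1" "block_norm \<beta> p \<le> block_norm \<beta> h"
  shows "block_norm \<beta> (h + t *\<^sub>R (p - h)) \<le> block_norm \<beta> h"
proof -
  have "h + t *\<^sub>R (p - h) = (1 - t) *\<^sub>R h + t *\<^sub>R p" by (simp add: algebra_simps)
  then have "block_norm \<beta> (h + t *\<^sub>R (p - h)) \<le> (1 - t) * block_norm \<beta> h + t * block_norm \<beta> p"
    using block_norm_add[of \<beta> "(1 - t) *\<^sub>R h" "t *\<^sub>R p"] assms by (simp add: block_norm_scaleR)
  also have "\<dots> \<le> (1 - t) * block_norm \<beta> h + t * block_norm \<beta> h"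
    using assms by (intro add_left_mono mult_left_mono) auto
  finally show ?thesis by (simp add: algebra_simps)
qed

text \<open>For isotropic l the vectors of real and of imaginary parts are orthogonal and of equal
  length. Hence z \<mapsto> Re (cnj (l j) * z) is a multiple of an isometric embedding of the
  complex plane, and x \<mapsto> \<Sum> x j * l j, whose adjoint it is, inverts it up to a real
  factor.\<close>

lemma sum_Re_cnj_mult_squares:
  fixes l :: "nat \<Rightarrow> complex"
  assumes "(\<Sum>j\<in>B. l j ^ 2) = 0"
  shows "(\<Sum>j\<in>B. Re (cnj (l j) * z) ^ 2) = norm z ^ 2 * ((\<Sum>j\<in>B. norm (l j) ^ 2) / 2)"
    and "(\<Sum>j\<in>B. of_real (Re (cnj (l j) * z)) * l j) = z * of_real ((\<Sum>j\<in>B. norm (l j) ^ 2) / 2)"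
proof -
  have "(\<Sum>j\<in>B. Re (l j ^ 2)) = 0" "(\<Sum>j\<in>B. Im (l j ^ 2)) = 0"
    using arg_cong[OF assms, of Re] arg_cong[OF assms, of Im] by simp_all
  then have eq: "(\<Sum>j\<in>B. Re (l j) ^ 2) = (\<Sum>j\<in>B. Im (l j) ^ 2)" "(\<Sum>j\<in>B. Re (l j) * Im (l j)) = 0"
    by (simp_all add: power2_eq_square sum_subtractf sum_distrib_left[symmetric] mult.commute sum.distrib)
  then have n: "(\<Sum>j\<in>B. norm (l j) ^ 2) / 2 = (\<Sum>j\<in>B. Im (l j) ^ 2)"
    by (simp add: cmod_power2 sum.distrib)
  have "(\<Sum>j\<in>B. Re (cnj (l j) * z) ^ 2) =
      Re z ^ 2 * (\<Sum>j\<in>B. Re (l j) ^ 2) + Im z ^ 2 * (\<Sum>j\<in>B. Im (l j) ^ 2) +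
      2 * Re z * Im z * (\<Sum>j\<in>B. Re (l j) * Im (l j))"
    by (simp add: sum_distrib_left sum.distrib[symmetric] power2_eq_square algebra_simps)
  then show "(\<Sum>j\<in>B. Re (cnj (l j) * z) ^ 2) = norm z ^ 2 * ((\<Sum>j\<in>B. norm (l j) ^ 2) / 2)"
    unfolding n eq by (simp add: cmod_power2 algebra_simps)
  have "Re (\<Sum>j\<in>B. of_real (Re (cnj (l j) * z)) * l j) =
      Re z * (\<Sum>j\<in>B. Re (l j) ^ 2) + Im z * (\<Sum>j\<in>B. Re (l j) * Im (l j))"
    by (simp add: sum_distrib_left sum.distrib[symmetric] power2_eq_square algebra_simps)
  moreover have "Im (\<Sum>j\<in>B. of_real (Re (cnj (l j) * z)) * l j) =
      Im z * (\<Sum>j\<in>B. Im (l j) ^ 2) + Re z * (\<Sum>j\<in>B. Re (l j) * Im (l j))"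
    by (simp add: sum_distrib_left sum.distrib[symmetric] power2_eq_square algebra_simps)
  ultimately show "(\<Sum>j\<in>B. of_real (Re (cnj (l j) * z)) * l j) = z * of_real ((\<Sum>j\<in>B. norm (l j) ^ 2) / 2)"
    unfolding n eq by (simp add: complex_eq_iff)
qed

text \<open>A character maps the block ball of radius \<open>t\<close> onto the disc of radius \<open>\<kappa> \<beta> * t\<close>: since
  \<open>\<Sum> a\<^sub>j\<^sup>2 = 0\<close>, real and imaginary part of \<open>\<omega> \<circ> Z \<beta>\<close> are orthogonal of equal length.\<close>

lemma character_section:
  assumes \<omega>: "character \<omega>"
  obtains \<kappa> :: "'k \<Rightarrow> real" and \<xi> :: "'k \<Rightarrow> complex \<Rightarrow> 'v" where
    "\<And>\<beta>. \<beta> \<in> set ks \<Longrightarrow> 0 < \<kappa> \<beta>"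
    "\<And>\<beta> h. \<beta> \<in> set ks \<Longrightarrow> norm (\<omega> (Z \<beta> h)) \<le> \<kappa> \<beta> * block_norm \<beta> h"
    "\<And>\<beta>. \<beta> \<in> set ks \<Longrightarrow> linear (\<xi> \<beta>)"
    "\<And>\<beta> z. \<beta> \<in> set ks \<Longrightarrow> \<xi> \<beta> z \<in> X"
    "\<And>\<beta> \<gamma> z. \<beta> \<in> set ks \<Longrightarrow> \<gamma> \<in> set ks \<Longrightarrow> \<omega> (Z \<gamma> (\<xi> \<beta> z)) = (if \<beta> = \<gamma> then z else 0)"
    "\<And>\<gamma> z. \<gamma> \<in> set ks \<Longrightarrow> block_norm \<gamma> (\<Sum>\<beta>\<in>set ks. \<xi> \<beta> (z \<beta>)) = norm (z \<gamma>) / \<kappa> \<gamma>"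
proof -
  interpret linear \<omega> using \<omega> by (simp add: character_def)
  have \<omega>1: "\<omega> 1 = 1" using \<omega> by (simp add: character_def)
  define l where "l \<beta> j = \<omega> (a \<beta> j)" for \<beta> j
  have l0: "(\<Sum>j\<in>Bl \<beta>. l \<beta> j ^ 2) = 0" if "\<beta> \<in> set ks" for \<beta>
  proof -
    have "(\<Sum>j\<in>Bl \<beta>. l \<beta> j ^ 2) = \<omega> (\<Sum>j\<in>Bl \<beta>. a \<beta> j ^ 2)"
      using that by (simp add: sum l_def character_power[OF \<omega> a_L0])
    then show ?thesis using a_isotropic[OF that] by (simp add: zero)
  qed
  \<comment> \<open>On a block, \<omega> \<circ> Z \<beta> is \<kappa> \<beta> times a coisometry;
    the lead entry \<omega> 1 = 1 makes \<kappa> \<beta> positive.\<close>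
  define \<kappa> where "\<kappa> \<beta> = sqrt ((\<Sum>j\<in>Bl \<beta>. norm (l \<beta> j) ^ 2) / 2)" for \<beta>
  have \<kappa>2: "\<kappa> \<beta> ^ 2 = (\<Sum>j\<in>Bl \<beta>. norm (l \<beta> j) ^ 2) / 2" for \<beta>
    by (simp add: \<kappa>_def sum_nonneg)
  have \<kappa>: "0 < \<kappa> \<beta>" if "\<beta> \<in> set ks" for \<beta>
  proof -
    have "(1 :: real) = norm (l \<beta> (lead \<beta>)) ^ 2" using that by (simp add: l_def a_lead \<omega>1)
    also have "\<dots> \<le> (\<Sum>j\<in>Bl \<beta>. norm (l \<beta> j) ^ 2)"
      using that finite_Bl lead_Bl by (intro member_le_sum) auto
    finally show ?thesis by (simp add: \<kappa>_def)
  qed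
  \<comment> \<open>The adjoint divided by \<kappa> squared, that is, the right inverse of least
    block norm.\<close>
  define \<xi> where "\<xi> \<beta> z = (\<Sum>j\<in>Bl \<beta>. (Re (cnj (l \<beta> j) * z) / \<kappa> \<beta> ^ 2) *\<^sub>R E \<beta> j)" for \<beta> z
  have \<xi>_inner: "\<xi> \<beta> z \<bullet> E \<gamma> j = (if \<beta> = \<gamma> then Re (cnj (l \<gamma> j) * z) / \<kappa> \<gamma> ^ 2 else 0)"
    if "\<beta> \<in> set ks" "\<gamma> \<in> set ks" "j \<in> Bl \<gamma>" for \<beta> \<gamma> z j
  proof -
    have "\<xi> \<beta> z \<bullet> E \<gamma> j = (\<Sum>i\<in>Bl \<beta>. Re (cnj (l \<beta> i) * z) / \<kappa> \<beta> ^ 2 * (if \<beta> = \<gamma> \<and> i = j then 1 else 0))"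
      unfolding \<xi>_def inner_sum_left inner_scaleR_left using that orthonormal by (intro sum.cong) auto
    then show ?thesis using that finite_Bl[of \<gamma>]
      by (cases "\<beta> = \<gamma>") (auto simp: if_distrib[of "\<lambda>x. _ * x"] sum.delta cong: if_cong)
  qed
  have \<omega>Z: "\<omega> (Z \<beta> h) = (\<Sum>j\<in>Bl \<beta>. of_real (h \<bullet> E \<beta> j) * l \<beta> j)" for \<beta> h
    by (simp add: Z_def sum scale l_def scaleR_conv_of_real[of _ "_ :: complex"])
  show ?thesis
  proof (rule that[of \<kappa> \<xi>])
    fix \<beta> assume \<beta>: "\<beta> \<in> set ks"
    show "0 < \<kappa> \<beta>" by (rule \<kappa>) fact
    show "linear (\<xi> \<beta>)"
      unfolding \<xi>_def
      by (rule linearI) (simp_all add: distrib_left add_divide_distrib scaleR_add_left scaleR_add_right sum.distrib scaleR_sum_right)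
    show "\<xi> \<beta> z \<in> X" for z
      unfolding \<xi>_def using subspace_X \<beta> by (intro subspace_sum subspace_scale E_X) auto
    show "norm (\<omega> (Z \<beta> h)) \<le> \<kappa> \<beta> * block_norm \<beta> h" for h
    proof -
      define z where "z = \<omega> (Z \<beta> h)"
      \<comment> \<open>Pair z with itself and apply Cauchy-Schwarz on the block; one factor norm z
        cancels at the end.\<close>
      have "norm z ^ 2 = Re (cnj z * z)"
        unfolding cmod_power2 by (simp add: power2_eq_square)
      also have "\<dots> = (\<Sum>j\<in>Bl \<beta>. (h \<bullet> E \<beta> j) * Re (cnj (l \<beta> j) * z))"
      proof -
        have "Re (cnj z * w) = Re (cnj w * z)" for w by simp
        moreover have "cnj z * z = (\<Sum>j\<in>Bl \<beta>. of_real (h \<bullet> E \<beta> j) * (cnj z * l \<beta> j))"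
          by (subst (2) z_def) (simp add: \<omega>Z sum_distrib_left algebra_simps)
        ultimately show ?thesis by (simp only: Re_sum) (auto intro!: sum.cong simp: algebra_simps)
      qed
      also have "\<dots> \<le> block_norm \<beta> h * L2_set (\<lambda>j. Re (cnj (l \<beta> j) * z)) (Bl \<beta>)"
      proof -
        have "(\<Sum>j\<in>Bl \<beta>. (h \<bullet> E \<beta> j) * Re (cnj (l \<beta> j) * z)) \<le>
            (\<Sum>j\<in>Bl \<beta>. \<bar>h \<bullet> E \<beta> j\<bar> * \<bar>Re (cnj (l \<beta> j) * z)\<bar>)"
          by (intro sum_mono) (metis abs_ge_self abs_mult)
        also have "\<dots> \<le> block_norm \<beta> h * L2_set (\<lambda>j. Re (cnj (l \<beta> j) * z)) (Bl \<beta>)"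
          unfolding block_norm_def by (rule L2_set_mult_ineq)
        finally show ?thesis .
      qed
      also have "L2_set (\<lambda>j. Re (cnj (l \<beta> j) * z)) (Bl \<beta>) = norm z * \<kappa> \<beta>"
        unfolding L2_set_def sum_Re_cnj_mult_squares(1)[OF l0[OF \<beta>]] \<kappa>2[symmetric]
        using \<kappa>[OF \<beta>] by (simp add: real_sqrt_mult)
      finally have "norm z * norm z \<le> norm z * (\<kappa> \<beta> * block_norm \<beta> h)"
        by (simp add: power2_eq_square mult_ac)
      then show ?thesis
        using \<kappa>[OF \<beta>] block_norm_nonneg[of \<beta> h] by (cases "z = 0") (auto simp: z_def)
    qed
    fix \<gamma> z assume \<gamma>: "\<gamma> \<in> set ks"
    show "\<omega> (Z \<gamma> (\<xi> \<beta> z)) = (if \<beta> = \<gamma> then z else 0)"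
    proof (cases "\<beta> = \<gamma>")
      case True
      have "\<omega> (Z \<gamma> (\<xi> \<gamma> z)) = (\<Sum>j\<in>Bl \<gamma>. of_real (Re (cnj (l \<gamma> j) * z)) * l \<gamma> j) / of_real (\<kappa> \<gamma> ^ 2)"
        unfolding \<omega>Z sum_divide_distrib using \<gamma> by (intro sum.cong) (auto simp: \<xi>_inner)
      also have "\<dots> = z"
        unfolding sum_Re_cnj_mult_squares(2)[OF l0[OF \<gamma>]] \<kappa>2[symmetric] using \<kappa>[OF \<gamma>] by simp
      finally show ?thesis using True by simp
    next
      case False
      then show ?thesis using \<beta> \<gamma> by (simp add: \<omega>Z \<xi>_inner)
    qed
  next
    fix \<gamma> and z :: "'k \<Rightarrow> complex" assume \<gamma>: "\<gamma> \<in> set ks"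
    have "(\<Sum>\<beta>\<in>set ks. \<xi> \<beta> (z \<beta>)) \<bullet> E \<gamma> j = Re (cnj (l \<gamma> j) * z \<gamma>) / \<kappa> \<gamma> ^ 2" if "j \<in> Bl \<gamma>" for j
      using that \<gamma> by (simp add: inner_sum_left \<xi>_inner sum.delta cong: sum.cong)
    then have "block_norm \<gamma> (\<Sum>\<beta>\<in>set ks. \<xi> \<beta> (z \<beta>)) =
        sqrt ((\<Sum>j\<in>Bl \<gamma>. Re (cnj (l \<gamma> j) * z \<gamma>) ^ 2) / (\<kappa> \<gamma> ^ 2) ^ 2)"
      by (simp add: block_norm_def L2_set_def power_divide sum_divide_distrib)
    also have "\<dots> = sqrt ((norm (z \<gamma>) / \<kappa> \<gamma>) ^ 2)"
      unfolding sum_Re_cnj_mult_squares(1)[OF l0[OF \<gamma>]] \<kappa>2[symmetric] using \<kappa>[OF \<gamma>]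
      by (simp add: power_divide power2_eq_square)
    finally show "block_norm \<gamma> (\<Sum>\<beta>\<in>set ks. \<xi> \<beta> (z \<beta>)) = norm (z \<gamma>) / \<kappa> \<gamma>"
      using \<kappa>[OF \<gamma>] by simp
  qed
qed

lemma qS_diff:
  assumes "qS f D" "qS g D"
  shows "qS (\<lambda>x. f x - g x) D"
  unfolding qS_def
proof (intro conjI ballI)
  show "openin (top_of_set X) D" using assms by (simp add: qS_def)
  fix x assume x: "x \<in> D"
  obtain f' where f': "(f has_derivative f') (at x within D)" "\<And>h. h \<in> X \<Longrightarrow> f' h = (\<Sum>\<beta>\<in>set ks. Z \<beta> h * f' (v \<beta>))"
    using assms(1) x unfolding qS_def by blast
  obtain g' where g': "(g has_derivative g') (at x within D)" "\<And>h. h \<in> X \<Longrightarrow> g' h = (\<Sum>\<beta>\<in>set ks. Z \<beta> h * g' (v \<beta>))"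
    using assms(2) x unfolding qS_def by blast
  have "f' h - g' h = (\<Sum>\<beta>\<in>set ks. Z \<beta> h * (f' (v \<beta>) - g' (v \<beta>)))" if "h \<in> X" for h
    by (subst f'(2)[OF that], subst g'(2)[OF that]) (simp add: right_diff_distrib sum_subtractf)
  then show "\<exists>f'. ((\<lambda>x. f x - g x) has_derivative f') (at x within D) \<and>
      (\<forall>h\<in>X. f' h = (\<Sum>\<beta>\<in>set ks. Z \<beta> h * f' (v \<beta>)))"
    using has_derivative_diff[OF f'(1) g'(1)] by blast
qed

lemma qS_continuous_on: "qS f D \<Longrightarrow> continuous_on D f"
  unfolding qS_def continuous_on_eq_continuous_within
  using has_derivative_continuous by blast

text \<open>The component \<open>\<phi> \<circ> f\<close> is constant along the fibres of the maps \<open>\<omega> \<circ> Z \<beta>\<close>, hence a holomorphic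
  function of the numbers \<open>\<omega> (Z \<beta> h)\<close>.\<close>

lemma character_component_expansion:
  assumes T: "\<And>\<beta>. \<beta> \<in> set ks \<Longrightarrow> 0 < T \<beta>" and S: "submodule S"
    and f: "qS f (block_ball T)" "\<And>h. h \<in> block_ball T \<Longrightarrow> f h \<in> S"
    and \<omega>: "character \<omega>" and \<phi>: "linear \<phi>" "\<And>b x. b \<in> L0 \<Longrightarrow> x \<in> S \<Longrightarrow> \<phi> (b * x) = \<omega> b * \<phi> x"
  obtains c :: "('k \<Rightarrow> nat) \<Rightarrow> complex" and R where
    "\<And>\<beta> h. \<beta> \<in> set ks \<Longrightarrow> h \<in> block_ball T \<Longrightarrow> norm (\<omega> (Z \<beta> h)) < R \<beta>"
    "\<And>\<rho>. \<forall>\<beta>\<in>set ks. 0 < \<rho> \<beta> \<and> \<rho> \<beta> < R \<beta> \<Longrightarrow> \<exists>M. \<forall>I\<in>exponents ks. norm (c I) * mon ks \<rho> I \<le> M"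
    "\<And>h. h \<in> block_ball T \<Longrightarrow> ((\<lambda>I. c I * mon ks (\<lambda>\<beta>. \<omega> (Z \<beta> h)) I) has_sum \<phi> (f h)) (exponents ks)"
proof -
  obtain \<kappa> \<xi> where \<kappa>: "\<And>\<beta>. \<beta> \<in> set ks \<Longrightarrow> 0 < \<kappa> \<beta>"
    and \<omega>_le: "\<And>\<beta> h. \<beta> \<in> set ks \<Longrightarrow> norm (\<omega> (Z \<beta> h)) \<le> \<kappa> \<beta> * block_norm \<beta> h"
    and lin: "\<And>\<beta>. \<beta> \<in> set ks \<Longrightarrow> linear (\<xi> \<beta> :: complex \<Rightarrow> 'v)"
    and \<xi>_X: "\<And>\<beta> z. \<beta> \<in> set ks \<Longrightarrow> \<xi> \<beta> z \<in> X"
    and \<omega>_\<xi>: "\<And>\<beta> \<gamma> z. \<beta> \<in> set ks \<Longrightarrow> \<gamma> \<in> set ks \<Longrightarrow> \<omega> (Z \<gamma> (\<xi> \<beta> z)) = (if \<beta> = \<gamma> then z else 0)"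
    and bn_\<xi>: "\<And>\<gamma> z. \<gamma> \<in> set ks \<Longrightarrow> block_norm \<gamma> (\<Sum>\<beta>\<in>set ks. \<xi> \<beta> (z \<beta>)) = norm (z \<gamma>) / \<kappa> \<gamma>"
    by (rule character_section[OF \<omega>], rule that; assumption)
  have lin_\<omega>: "linear \<omega>" using \<omega> by (simp add: character_def)
  \<comment> \<open>For prescribed character values, the point of least block norms; it maps the
    polydisc of radii R into the block ball.\<close>
  define \<Xi> where "\<Xi> z = (\<Sum>\<beta>\<in>set ks. \<xi> \<beta> (z \<beta>))" for z
  have \<Xi>_X: "\<Xi> z \<in> X" for z unfolding \<Xi>_def using subspace_X \<xi>_X by (intro subspace_sum) auto
  have \<omega>_\<Xi>: "\<omega> (Z \<gamma> (\<Xi> z)) = z \<gamma>" if "\<gamma> \<in> set ks" for \<gamma> z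
    using that by (simp add: \<Xi>_def linear_sum[OF linear_Z] linear_sum[OF lin_\<omega>] \<omega>_\<xi> cong: sum.cong)
  define R where "R \<beta> = \<kappa> \<beta> * T \<beta>" for \<beta>
  have R: "0 < R \<beta>" if "\<beta> \<in> set ks" for \<beta> using that T \<kappa> by (simp add: R_def)
  have \<Xi>_ball: "\<Xi> z \<in> block_ball T" if "\<And>\<beta>. \<beta> \<in> set ks \<Longrightarrow> norm (z \<beta>) < R \<beta>" for z
    using that \<kappa> \<Xi>_X unfolding block_ball_def \<Xi>_def by (auto simp: bn_\<xi> R_def divide_less_eq mult.commute)
  have \<omega>_R: "norm (\<omega> (Z \<beta> h)) < R \<beta>" if "\<beta> \<in> set ks" "h \<in> block_ball T" for \<beta> h
  proof -
    have "\<kappa> \<beta> * block_norm \<beta> h < \<kappa> \<beta> * T \<beta>"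
      using that \<kappa> by (intro mult_strict_left_mono) (auto simp: block_ball_def)
    then show ?thesis using \<omega>_le[OF that(1), of h] by (simp add: R_def)
  qed
  have bl_\<phi>: "bounded_linear \<phi>" using \<phi>(1) by (simp add: linear_linear)
  have deriv: "\<exists>f'. (f has_derivative f') (at p within block_ball T) \<and>
      (\<forall>h\<in>X. \<phi> (f' h) = (\<Sum>\<beta>\<in>set ks. \<omega> (Z \<beta> h) * \<phi> (f' (v \<beta>))))" if p: "p \<in> block_ball T" for p
  proof -
    obtain f' where f': "(f has_derivative f') (at p within block_ball T)"
      "\<And>h. h \<in> X \<Longrightarrow> f' h = (\<Sum>\<beta>\<in>set ks. Z \<beta> h * f' (v \<beta>))"
      using f(1) p unfolding qS_def by blast
    \<comment> \<open>\<phi> is compatible with \<omega> only on S, so the derivatives have to lie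
      in S before \<phi> is applied.\<close>
    have "f' (v \<beta>) \<in> S" if "\<beta> \<in> set ks" for \<beta>
      using S by (intro derivative_in_subspace[OF f'(1) openin_block_ball subspace_X p v_X[OF that] _ f(2)])
        (auto simp: submodule_def)
    then have "\<phi> (f' h) = (\<Sum>\<beta>\<in>set ks. \<omega> (Z \<beta> h) * \<phi> (f' (v \<beta>)))" if "h \<in> X" for h
      by (subst f'(2)[OF that]) (simp add: linear_sum[OF \<phi>(1)] \<phi>(2) Z_L0 cong: sum.cong)
    with f' show ?thesis by blast
  qed
  define F where "F z = \<phi> (f (\<Xi> z))" for z
  have F_bounded: "\<exists>M. \<forall>z. (\<forall>\<beta>\<in>set ks. norm (z \<beta>) \<le> \<rho> \<beta>) \<longrightarrow> norm (F z) \<le> M"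
    if \<rho>: "\<forall>\<beta>\<in>set ks. 0 < \<rho> \<beta> \<and> \<rho> \<beta> < R \<beta>" for \<rho>
  proof -
    \<comment> \<open>A compact part of the block ball that contains all \<Xi> z in question;
      continuity of f bounds F there.\<close>
    define C where "C = {h \<in> X. \<forall>\<beta>\<in>set ks. block_norm \<beta> h \<le> \<rho> \<beta> / \<kappa> \<beta>}"
    have "\<rho> \<beta> / \<kappa> \<beta> < T \<beta>" if "\<beta> \<in> set ks" for \<beta>
      using \<rho> that \<kappa>[OF that] by (simp add: R_def divide_less_eq mult.commute)
    then have "C \<subseteq> block_ball T" unfolding C_def block_ball_def by (auto intro: le_less_trans)
    then have "continuous_on C (\<lambda>h. \<phi> (f h))"
      by (intro linear_continuous_on_compose[OF _ \<phi>(1)] continuous_on_subset[OF qS_continuous_on[OF f(1)]])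
    then have "bounded ((\<lambda>h. \<phi> (f h)) ` C)"
      unfolding C_def by (intro compact_imp_bounded compact_continuous_image compact_closed_block_ball)
    then obtain M where M: "\<And>h. h \<in> C \<Longrightarrow> norm (\<phi> (f h)) \<le> M" by (auto simp: bounded_iff)
    have "\<Xi> z \<in> C" if "\<forall>\<beta>\<in>set ks. norm (z \<beta>) \<le> \<rho> \<beta>" for z
      using that \<kappa> \<Xi>_X unfolding C_def \<Xi>_def by (auto simp: bn_\<xi> less_imp_le divide_right_mono)
    then show ?thesis unfolding F_def using M by blast
  qed
  have "\<exists>c. (\<forall>\<rho> M. (\<forall>\<beta>\<in>set ks. 0 < \<rho> \<beta> \<and> \<rho> \<beta> < R \<beta>) \<longrightarrow>
            (\<forall>z. (\<forall>\<beta>\<in>set ks. norm (z \<beta>) \<le> \<rho> \<beta>) \<longrightarrow> norm (F z) \<le> M) \<longrightarrow>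
            (\<forall>I\<in>exponents ks. norm (c I) * mon ks \<rho> I \<le> M)) \<and>
        (\<forall>z. (\<forall>\<beta>\<in>set ks. norm (z \<beta>) < R \<beta>) \<longrightarrow>
            ((\<lambda>I. c I * mon ks z I) has_sum F z) (exponents ks))"
  proof (rule polydisc_power_series[OF distinct_ks R])
    show "F z = F z'" if "\<And>\<beta>. \<beta> \<in> set ks \<Longrightarrow> z \<beta> = z' \<beta>" for z z'
      using that by (simp add: F_def \<Xi>_def cong: sum.cong)
    show "(\<lambda>w. F (z(\<gamma> := w))) holomorphic_on ball 0 (R \<gamma>)"
      if \<gamma>: "\<gamma> \<in> set ks" and z: "\<And>\<beta>. \<beta> \<in> set ks \<Longrightarrow> norm (z \<beta>) < R \<beta>" for z \<gamma>
      unfolding holomorphic_on_open[OF open_ball]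
    proof (intro ballI)
      fix w0 :: complex assume w0: "w0 \<in> ball 0 (R \<gamma>)"
      define m where "m w = \<Xi> (z(\<gamma> := w))" for w
      have m_ball: "m w \<in> block_ball T" if "w \<in> ball 0 (R \<gamma>)" for w
        unfolding m_def using that z by (intro \<Xi>_ball) auto
      have m_eq: "m w = \<Xi> (z(\<gamma> := 0)) + \<xi> \<gamma> w" for w
      proof -
        have "(\<Sum>\<beta>\<in>set ks - {\<gamma>}. \<xi> \<beta> ((z(\<gamma> := w)) \<beta>)) = (\<Sum>\<beta>\<in>set ks - {\<gamma>}. \<xi> \<beta> ((z(\<gamma> := 0)) \<beta>))"
          by (intro sum.cong) auto
        then show ?thesis
          unfolding m_def \<Xi>_def sum.remove[OF finite_set \<gamma>] fun_upd_same
          using linear_0[OF lin[OF \<gamma>]] by simp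
      qed
      have m_deriv: "(m has_derivative \<xi> \<gamma>) (at w0 within ball 0 (R \<gamma>))"
        unfolding m_eq using lin[OF \<gamma>] linear_imp_has_derivative[OF lin[OF \<gamma>]]
        by (auto intro!: derivative_eq_intros simp: fun_eq_iff)
      obtain f' where f': "(f has_derivative f') (at (m w0) within block_ball T)"
        "\<And>h. h \<in> X \<Longrightarrow> \<phi> (f' h) = (\<Sum>\<beta>\<in>set ks. \<omega> (Z \<beta> h) * \<phi> (f' (v \<beta>)))"
        using deriv[OF m_ball[OF w0]] by blast
      have "((\<lambda>p. \<phi> (f p)) has_derivative (\<lambda>k. \<phi> (f' k))) (at (m w0) within block_ball T)"
        by (rule bounded_linear.has_derivative[OF bl_\<phi> f'(1)])
      then have "((\<lambda>p. \<phi> (f p)) has_derivative (\<lambda>k. \<phi> (f' k))) (at (m w0) within m ` ball 0 (R \<gamma>))"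
        by (rule has_derivative_subset) (use m_ball in auto)
      from diff_chain_within[OF m_deriv this]
      have "((\<lambda>w. F (z(\<gamma> := w))) has_derivative (\<lambda>w. \<phi> (f' (\<xi> \<gamma> w)))) (at w0 within ball 0 (R \<gamma>))"
        by (simp add: o_def F_def m_def)
      \<comment> \<open>The real derivative in w is multiplication by a complex number, which is the
        Cauchy-Riemann condition.\<close>
      moreover have "\<phi> (f' (\<xi> \<gamma> w)) = \<phi> (f' (v \<gamma>)) * w" for w
        using \<gamma> by (simp add: f'(2) \<xi>_X \<omega>_\<xi> if_distrib[of "\<lambda>x. x * _"] sum.delta' cong: if_cong sum.cong)
      ultimately have "((\<lambda>w. F (z(\<gamma> := w))) has_derivative (\<lambda>w. \<phi> (f' (v \<gamma>)) * w)) (at w0)"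
        using w0 by (simp add: at_within_open[OF w0])
      then show "\<exists>F'. ((\<lambda>w. F (z(\<gamma> := w))) has_field_derivative F') (at w0)"
        by (auto simp: has_field_derivative_def)
    qed
    show "\<exists>M. \<forall>z. (\<forall>\<beta>\<in>set ks. norm (z \<beta>) \<le> \<rho> \<beta>) \<longrightarrow> norm (F z) \<le> M"
      if "\<And>\<beta>. \<beta> \<in> set ks \<Longrightarrow> 0 < \<rho> \<beta> \<and> \<rho> \<beta> < R \<beta>" for \<rho>
      by (rule F_bounded) (use that in blast)
  qed
  then obtain c where c: "\<And>\<rho> M. \<forall>\<beta>\<in>set ks. 0 < \<rho> \<beta> \<and> \<rho> \<beta> < R \<beta> \<Longrightarrow>
            \<forall>z. (\<forall>\<beta>\<in>set ks. norm (z \<beta>) \<le> \<rho> \<beta>) \<longrightarrow> norm (F z) \<le> M \<Longrightarrow>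
            \<forall>I\<in>exponents ks. norm (c I) * mon ks \<rho> I \<le> M"
    and c_sum: "\<And>z. \<forall>\<beta>\<in>set ks. norm (z \<beta>) < R \<beta> \<Longrightarrow> ((\<lambda>I. c I * mon ks z I) has_sum F z) (exponents ks)"
    by blast
  \<comment> \<open>Join h to the point p with the same character values. Since p has no larger
    block norms, the segment stays in the ball; along p - h the derivative of \<phi> \<circ> f
    vanishes, because every \<omega> (Z \<beta> (p - h)) does.\<close>
  have fiber: "\<phi> (f h) = F (\<lambda>\<beta>. \<omega> (Z \<beta> h))" if h: "h \<in> block_ball T" for h
  proof -
    define p where "p = \<Xi> (\<lambda>\<beta>. \<omega> (Z \<beta> h))"
    have hX: "h \<in> X" using h by (simp add: block_ball_def)
    have pX: "p \<in> X" by (simp add: p_def \<Xi>_X)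
    have bn: "block_norm \<beta> p \<le> block_norm \<beta> h" if "\<beta> \<in> set ks" for \<beta>
      using \<omega>_le[OF that, of h] \<kappa>[OF that] that unfolding p_def \<Xi>_def
      by (simp add: bn_\<xi> divide_le_eq mult.commute)
    define s where "s t = h + t *\<^sub>R (p - h)" for t :: real
    have s_ball: "s t \<in> block_ball T" if "t \<in> {0..1}" for t
    proof -
      have "s t \<in> X" unfolding s_def using subspace_X hX pX by (intro subspace_add subspace_scale subspace_diff)
      moreover have "block_norm \<beta> (s t) < T \<beta>" if "\<beta> \<in> set ks" for \<beta>
        using block_norm_segment[of t \<beta> p h] \<open>t \<in> {0..1}\<close> bn[OF that] h that
        unfolding s_def block_ball_def by fastforce
      ultimately show ?thesis by (simp add: block_ball_def)
    qed
    have "((\<lambda>t. \<phi> (f (s t))) has_derivative (\<lambda>k. 0)) (at t within {0..1})" if t: "t \<in> {0..1}" for t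
    proof -
      obtain f' where f': "(f has_derivative f') (at (s t) within block_ball T)"
        "\<And>h. h \<in> X \<Longrightarrow> \<phi> (f' h) = (\<Sum>\<beta>\<in>set ks. \<omega> (Z \<beta> h) * \<phi> (f' (v \<beta>)))"
        using deriv[OF s_ball[OF t]] by blast
      have "((\<lambda>p. \<phi> (f p)) has_derivative (\<lambda>k. \<phi> (f' k))) (at (s t) within block_ball T)"
        by (rule bounded_linear.has_derivative[OF bl_\<phi> f'(1)])
      then have "((\<lambda>p. \<phi> (f p)) has_derivative (\<lambda>k. \<phi> (f' k))) (at (s t) within s ` {0..1})"
        by (rule has_derivative_subset) (use s_ball in auto)
      moreover have "(s has_derivative (\<lambda>k. k *\<^sub>R (p - h))) (at t within {0..1})"
        unfolding s_def by (auto intro!: derivative_eq_intros)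
      ultimately have "((\<lambda>t. \<phi> (f (s t))) has_derivative (\<lambda>k. \<phi> (f' (k *\<^sub>R (p - h))))) (at t within {0..1})"
        using diff_chain_within[of s _ t "{0..1}" "\<lambda>p. \<phi> (f p)" "\<lambda>k. \<phi> (f' k)"] by (simp add: o_def)
      moreover have "\<phi> (f' (k *\<^sub>R (p - h))) = 0" for k
      proof -
        have "\<omega> (Z \<beta> (k *\<^sub>R (p - h))) = 0" if "\<beta> \<in> set ks" for \<beta>
          using that by (simp add: linear_cmul[OF linear_Z] linear_diff[OF linear_Z] linear_cmul[OF lin_\<omega>]
              linear_diff[OF lin_\<omega>] p_def \<omega>_\<Xi>)
        moreover have "k *\<^sub>R (p - h) \<in> X" using subspace_X hX pX by (intro subspace_scale subspace_diff)
        ultimately show ?thesis using f'(2)[of "k *\<^sub>R (p - h)"] by simp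
      qed
      ultimately show ?thesis by simp
    qed
    then obtain d where "\<And>t. t \<in> {0..1} \<Longrightarrow> \<phi> (f (s t)) = d"
      using has_derivative_zero_constant[of "{0..1 :: real}" "\<lambda>t. \<phi> (f (s t))"] by auto
    from this[of 0] this[of 1] show ?thesis by (simp add: s_def F_def p_def)
  qed
  show ?thesis
  proof (rule that[of R c])
    show "norm (\<omega> (Z \<beta> h)) < R \<beta>" if "\<beta> \<in> set ks" "h \<in> block_ball T" for \<beta> h
      using that by (rule \<omega>_R)
    show "\<exists>M. \<forall>I\<in>exponents ks. norm (c I) * mon ks \<rho> I \<le> M" if "\<forall>\<beta>\<in>set ks. 0 < \<rho> \<beta> \<and> \<rho> \<beta> < R \<beta>" for \<rho>
      using F_bounded[OF that] c[OF that] by blast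
    show "((\<lambda>I. c I * mon ks (\<lambda>\<beta>. \<omega> (Z \<beta> h)) I) has_sum \<phi> (f h)) (exponents ks)" if "h \<in> block_ball T" for h
      unfolding fiber[OF that] using \<omega>_R that by (intro c_sum) auto
  qed
qed

section \<open>Lifting the coefficients of one component\<close>

lemma mon_idempotent:
  assumes "u \<in> L0" "u * u = u"
  shows "u * mon ls (\<lambda>_. u) I = u"
proof (induction ls)
  case (Cons \<beta> ls)
  have "u * u ^ n = u" for n by (induction n) (simp_all add: assms mult.assoc[symmetric])
  then show ?case using Cons by (simp add: mult.assoc[symmetric])
qed simp

lemma mon_L0: "(\<And>\<beta>. \<beta> \<in> set ls \<Longrightarrow> x \<beta> \<in> L0) \<Longrightarrow> mon ls x I \<in> L0"
  by (induction ls) (auto intro: one_L0 mult_L0 power_L0)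

lemma character_mon:
  assumes "character \<omega>" "\<And>\<beta>. \<beta> \<in> set ls \<Longrightarrow> x \<beta> \<in> L0"
  shows "\<omega> (mon ls x I) = mon ls (\<lambda>\<beta>. \<omega> (x \<beta>)) I"
  using assms(2)
proof (induction ls)
  case Nil
  then show ?case using assms(1) by (simp add: character_def)
next
  case (Cons \<beta> ls)
  have "\<omega> (x \<beta> ^ I \<beta> * mon ls x I) = \<omega> (x \<beta> ^ I \<beta>) * \<omega> (mon ls x I)"
    using assms(1) Cons.prems mon_L0[of ls x] by (simp add: character_def power_L0)
  then show ?case using Cons character_power[OF assms(1)] by simp
qed

text \<open>The idempotent u can be distributed over all factors, which replaces Z \<beta> h by Z
  \<beta> h * u. All character values of the latter are bounded by the one of \<omega>, so its
  powers grow no faster than the complex series allows.\<close>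

lemma localized_series_summable:
  fixes R :: "'k \<Rightarrow> real" and c :: "('k \<Rightarrow> nat) \<Rightarrow> complex"
  assumes \<omega>: "character \<omega>" and u: "u \<in> L0" "u * u = u"
    "\<And>\<tau> b. character \<tau> \<Longrightarrow> b \<in> L0 \<Longrightarrow> norm (\<tau> (b * u)) \<le> norm (\<omega> b)"
    and A: "\<And>I. A I = d I * u" "\<And>I. norm (d I * u) \<le> K * norm (c I)"
    and h: "\<And>\<beta>. \<beta> \<in> set ks \<Longrightarrow> norm (\<omega> (Z \<beta> h)) < R \<beta>"
    and c: "\<And>\<rho>. \<forall>\<beta>\<in>set ks. 0 < \<rho> \<beta> \<and> \<rho> \<beta> < R \<beta> \<Longrightarrow> \<exists>M. \<forall>I\<in>exponents ks. norm (c I) * mon ks \<rho> I \<le> M"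
  shows "(\<lambda>I. norm (series_term A h I)) summable_on exponents ks"
proof -
  define r where "r \<beta> = norm (\<omega> (Z \<beta> h))" for \<beta>
  \<comment> \<open>Two radii strictly between r and R: \<rho> bounds the powers of y, \<rho>'
    carries the coefficient estimate, and the gap between them gives summability.\<close>
  define \<rho> where "\<rho> \<beta> = (2 * r \<beta> + R \<beta>) / 3" for \<beta>
  define \<rho>' where "\<rho>' \<beta> = (r \<beta> + 2 * R \<beta>) / 3" for \<beta>
  have rR: "0 \<le> r \<beta>" "r \<beta> < R \<beta>" if "\<beta> \<in> set ks" for \<beta> using h[OF that] by (auto simp: r_def)
  have \<rho>: "0 < \<rho> \<beta>" "r \<beta> < \<rho> \<beta>" "\<rho> \<beta> < \<rho>' \<beta>" "0 < \<rho>' \<beta>" "\<rho>' \<beta> < R \<beta>" if "\<beta> \<in> set ks" for \<beta>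
    using rR[OF that] by (simp_all add: \<rho>_def \<rho>'_def)
  obtain B where B: "B \<ge> 1" "\<And>x y :: 'a. norm (x * y) \<le> B * norm x * norm y"
    using mult_norm_bound by blast
  define y where "y \<beta> = Z \<beta> h * u" for \<beta>
  have y: "y \<beta> \<in> L0" if "\<beta> \<in> set ks" for \<beta> using that u Z_L0 mult_L0 by (simp add: y_def)
  have "\<exists>C>0. \<forall>n. norm (y \<beta> ^ n) \<le> C * \<rho> \<beta> ^ n" if "\<beta> \<in> set ks" for \<beta>
  proof -
    have "norm (\<tau> (y \<beta>)) < \<rho> \<beta>" if "character \<tau>" for \<tau>
      using u(3)[OF that Z_L0[OF \<open>\<beta> \<in> set ks\<close>], of h] \<rho>[OF \<open>\<beta> \<in> set ks\<close>] by (simp add: y_def r_def)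
    then show ?thesis using power_bound[OF y[OF that] \<rho>(1)[OF that]] by metis
  qed
  then obtain C where C: "\<And>\<beta>. \<beta> \<in> set ks \<Longrightarrow> C \<beta> > 0"
    "\<And>\<beta> n. \<beta> \<in> set ks \<Longrightarrow> norm (y \<beta> ^ n) \<le> C \<beta> * \<rho> \<beta> ^ n"
    by metis
  define C' where "C' = sum C (set ks)"
  have C': "C' \<ge> 0" unfolding C'_def using C(1) by (intro sum_nonneg) (auto intro: less_imp_le)
  have yC': "norm (y \<beta> ^ n) \<le> C' * \<rho> \<beta> ^ n" if "\<beta> \<in> set ks" for \<beta> n
  proof -
    have "C \<beta> \<le> C'" unfolding C'_def by (rule member_le_sum) (use that C(1) in \<open>auto intro: less_imp_le\<close>)
    then have "C \<beta> * \<rho> \<beta> ^ n \<le> C' * \<rho> \<beta> ^ n" using \<rho>(1)[OF that] by (intro mult_right_mono) auto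
    then show ?thesis using C(2)[OF that, of n] by linarith
  qed
  define L where "L = (B * C') ^ length ks"
  have L: "L \<ge> 0" using B C' by (simp add: L_def)
  obtain M where M: "\<forall>I\<in>exponents ks. norm (c I) * mon ks \<rho>' I \<le> M" using c[of \<rho>'] \<rho> by blast
  have "(\<lambda>I. norm (c I) * mon ks \<rho> I) summable_on exponents ks"
    by (rule bounded_coeffs_summable[where \<rho> = \<rho>' and M = M]) (use distinct_ks \<rho> M in \<open>auto intro: less_imp_le\<close>)
  then have "(\<lambda>I. K * L * (norm (c I) * mon ks \<rho> I)) summable_on exponents ks"
    by (rule summable_on_cmult_right)
  then show ?thesis
  proof (rule Infinite_Sum.abs_summable_on_comparison_test')
    fix I
    have "u * mon ks y I = u * mon ks (\<lambda>\<beta>. Z \<beta> h) I"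
    proof -
      have "mon ks y I = mon ks (\<lambda>\<beta>. Z \<beta> h) I * mon ks (\<lambda>_. u) I"
        unfolding y_def using u by (simp add: mon_mult_central)
      moreover have "u * mon ks (\<lambda>\<beta>. Z \<beta> h) I = mon ks (\<lambda>\<beta>. Z \<beta> h) I * u" by (rule central[OF u(1)])
      moreover have "u * mon ks (\<lambda>_. u) I = u" by (rule mon_idempotent[OF u(1,2)])
      ultimately show ?thesis by (metis mult.assoc)
    qed
    then have "series_term A h I = (d I * u) * mon ks y I"
      unfolding series_term_def A(1) by (simp only: mult.assoc)
    then have "norm (series_term A h I) \<le> norm (d I * u) * L * mon ks \<rho> I"
      unfolding L_def using norm_mult_mon_le[OF B, of ks y C' \<rho> "d I * u" I] yC' \<rho> C'
      by (auto intro: less_imp_le)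
    also have "\<dots> \<le> (K * norm (c I)) * L * mon ks \<rho> I"
      using L \<rho> by (intro mult_right_mono A mon_nonneg) (auto intro: less_imp_le)
    finally show "norm (series_term A h I) \<le> K * L * (norm (c I) * mon ks \<rho> I)"
      by (simp add: mult_ac)
  qed
qed

text \<open>Induction on the dimension of a submodule containing the values: subtracting a series whose
  coefficients lift those of one component of \<open>f\<close> moves the values into a smaller submodule.\<close>

lemma qS_expansion_in_submodule:
  assumes T: "\<And>\<beta>. \<beta> \<in> set ks \<Longrightarrow> 0 < T \<beta>"
    and "submodule S" "qS f (block_ball T)" "\<And>h. h \<in> block_ball T \<Longrightarrow> f h \<in> S"
  shows "\<exists>A. \<forall>h\<in>block_ball T. (\<lambda>I. norm (series_term A h I)) summable_on exponents ks \<and>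
    (series_term A h has_sum f h) (exponents ks)"
  using assms(2-4)
proof (induction "dim S" arbitrary: S f rule: less_induct)
  case less
  note S = less.prems(1) and f = less.prems(2,3)
  have sub_S: "subspace S" using S by (simp add: submodule_def)
  show ?case
  proof (cases "S = {0}")
    case True
    then show ?thesis
      using less.prems(3) by (intro exI[of _ "\<lambda>_. 0"]) (simp add: series_term_def[abs_def])
  next
    case False
    have "submodule {0}" by (auto simp: submodule_def subspace_def)
    moreover have "{0} \<subseteq> S" using sub_S by (simp add: subspace_0)
    ultimately obtain \<omega> \<phi> s where \<omega>: "character \<omega>" and \<phi>: "linear (\<phi> :: 'a \<Rightarrow> complex)"
      and s: "s \<in> S" "\<phi> s \<noteq> 0"
      and \<phi>\<omega>: "\<And>b x. b \<in> L0 \<Longrightarrow> x \<in> S \<Longrightarrow> \<phi> (b * x) = \<omega> b * \<phi> x"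
      using character_functional[OF S, of "{0}"] False by metis
    have bl_\<phi>: "bounded_linear \<phi>" using \<phi> by (simp add: linear_linear)
    have \<omega>m: "\<omega> (x * y) = \<omega> x * \<omega> y" if "x \<in> L0" "y \<in> L0" for x y
      using \<omega> that by (simp add: character_def)
    interpret \<omega>: linear \<omega> using \<omega> by (simp add: character_def)
    interpret \<phi>: linear \<phi> by fact
    have \<omega>1: "\<omega> 1 = 1" using \<omega> by (simp add: character_def)
    obtain j where j: "j \<in> L0" "\<omega> j = \<i>" using character_imaginary_unit[OF \<omega>] .
    \<comment> \<open>A section of \<omega>, from the real coordinates of z with respect to 1 and
      j.\<close>
    define lift where "lift z = Re z *\<^sub>R 1 + Im z *\<^sub>R j" for z
    have lift: "lift z \<in> L0" "\<omega> (lift z) = z" for z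
      unfolding lift_def using subspace_L0 one_L0 j
      by (auto intro!: subspace_add subspace_scale simp: \<omega>.add \<omega>.scale \<omega>1 complex_eq_iff)
    obtain u where u: "u \<in> L0" "u * u = u" "\<omega> u = 1"
      "\<And>\<tau> b. character \<tau> \<Longrightarrow> b \<in> L0 \<Longrightarrow> norm (\<tau> (b * u)) \<le> norm (\<omega> b)"
      using local_idempotent[OF \<omega>] by blast
    have SL: "b * x \<in> S" if "b \<in> L0" "x \<in> S" for b x using S that by (simp add: submodule_def)
    \<comment> \<open>Normalised to \<phi> s0 = 1, so that multiplying by lift (c I) produces the
      \<phi>-value c I.\<close>
    define s0 where "s0 = lift (1 / \<phi> s) * s"
    have s0: "s0 \<in> S" "\<phi> s0 = 1" using lift s by (simp_all add: s0_def SL \<phi>\<omega>)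
    obtain c :: "('k \<Rightarrow> nat) \<Rightarrow> complex" and R where
      R: "\<And>\<beta> h. \<beta> \<in> set ks \<Longrightarrow> h \<in> block_ball T \<Longrightarrow> norm (\<omega> (Z \<beta> h)) < R \<beta>"
      and c: "\<And>\<rho>. \<forall>\<beta>\<in>set ks. 0 < \<rho> \<beta> \<and> \<rho> \<beta> < R \<beta> \<Longrightarrow> \<exists>M. \<forall>I\<in>exponents ks. norm (c I) * mon ks \<rho> I \<le> M"
      and c_sum: "\<And>h. h \<in> block_ball T \<Longrightarrow> ((\<lambda>I. c I * mon ks (\<lambda>\<beta>. \<omega> (Z \<beta> h)) I) has_sum \<phi> (f h)) (exponents ks)"
      by (rule character_component_expansion[of T S f \<omega> \<phi>])
        (rule T, assumption, rule S, rule f(1), rule f(2), assumption, rule \<omega>, rule \<phi>,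
          rule \<phi>\<omega>, assumption, assumption, rule that, assumption+)
    \<comment> \<open>The factor u leaves \<phi>-values unchanged, since \<omega> u = 1, and makes
      \<open>localized_series_summable\<close> applicable.\<close>
    define A0 where "A0 I = (lift (c I) * s0) * u" for I
    obtain B where B: "B \<ge> 1" "\<And>x y :: 'a. norm (x * y) \<le> B * norm x * norm y"
      using mult_norm_bound by blast
    define K where "K = B * (B * (norm (1 :: 'a) + norm j) * norm s0) * norm u"
    have "norm ((lift (c I) * s0) * u) \<le> K * norm (c I)" for I
    proof -
      have "norm (lift (c I)) \<le> \<bar>Re (c I)\<bar> * norm (1 :: 'a) + \<bar>Im (c I)\<bar> * norm j"
        unfolding lift_def by (rule norm_triangle_le) simp
      also have "\<dots> \<le> norm (c I) * norm (1 :: 'a) + norm (c I) * norm j"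
        by (intro add_mono mult_right_mono abs_Re_le_cmod abs_Im_le_cmod) auto
      finally have l: "norm (lift (c I)) \<le> norm (c I) * (norm (1 :: 'a) + norm j)" by (simp add: algebra_simps)
      have "norm ((lift (c I) * s0) * u) \<le> B * norm (lift (c I) * s0) * norm u" by (rule B)
      also have "\<dots> \<le> B * (B * norm (lift (c I)) * norm s0) * norm u"
        using B(1) by (intro mult_right_mono mult_left_mono B(2)) auto
      also have "\<dots> \<le> B * (B * (norm (c I) * (norm (1 :: 'a) + norm j)) * norm s0) * norm u"
        using B(1) by (intro mult_right_mono mult_left_mono l) auto
      finally show ?thesis by (simp add: K_def mult_ac)
    qed
    note K = this
    have A0_summ: "(\<lambda>I. norm (series_term A0 h I)) summable_on exponents ks" if "h \<in> block_ball T" for h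
    proof (rule localized_series_summable[where A = A0 and d = "\<lambda>I. lift (c I) * s0" and c = c and R = R and K = K])
      show "norm (\<tau> (b * u)) \<le> norm (\<omega> b)" if "character \<tau>" "b \<in> L0" for \<tau> b using that by (rule u)
      show "\<exists>M. \<forall>I\<in>exponents ks. norm (c I) * mon ks \<rho> I \<le> M"
        if "\<forall>\<beta>\<in>set ks. 0 < \<rho> \<beta> \<and> \<rho> \<beta> < R \<beta>" for \<rho> using that by (rule c)
    qed (use \<omega> u K R that in \<open>simp_all add: A0_def\<close>)
    define f0 where "f0 h = infsum (series_term A0 h) (exponents ks)" for h
    have f0: "(series_term A0 h has_sum f0 h) (exponents ks)" if "h \<in> block_ball T" for h
      unfolding f0_def by (rule has_sum_infsum[OF abs_summable_summable[OF A0_summ[OF that]]])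
    have qS_f0: "qS f0 (block_ball T)"
      using A0_summ f0 subspace_0[OF subspace_X] by (intro qS_of_series[OF openin_block_ball, where c = 0 and A = A0]) auto
    have term_eq: "series_term A0 h I = mon ks (\<lambda>\<beta>. Z \<beta> h) I * (u * (lift (c I) * s0))" for h I
    proof -
      have "mon ks (\<lambda>\<beta>. Z \<beta> h) I \<in> L0" by (intro mon_L0 Z_L0)
      then show ?thesis unfolding series_term_def A0_def using central u(1) by metis
    qed
    have in_S: "u * (lift (c I) * s0) \<in> S" for I using u lift s0 by (intro SL)
    have term_S: "series_term A0 h I \<in> S" for h I
      unfolding term_eq by (intro SL mon_L0 Z_L0 in_S)
    have f0_S: "f0 h \<in> S" if "h \<in> block_ball T" for h
      using has_sum_in_subspace[OF sub_S f0[OF that]] term_S by blast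
    have \<phi>_eq: "\<phi> (f0 h) = \<phi> (f h)" if h: "h \<in> block_ball T" for h
    proof -
      have "((\<lambda>I. \<phi> (series_term A0 h I)) has_sum \<phi> (f0 h)) (exponents ks)"
        by (rule has_sum_bounded_linear[OF bl_\<phi> f0[OF h]])
      moreover have "\<phi> (series_term A0 h I) = c I * mon ks (\<lambda>\<beta>. \<omega> (Z \<beta> h)) I" for I
      proof -
        have "\<phi> (series_term A0 h I) = \<omega> (mon ks (\<lambda>\<beta>. Z \<beta> h) I) * \<phi> (u * (lift (c I) * s0))"
          unfolding term_eq by (intro \<phi>\<omega> mon_L0 Z_L0 in_S)
        also have "\<phi> (u * (lift (c I) * s0)) = c I" using u lift s0 by (simp add: \<phi>\<omega> SL)
        finally show ?thesis using character_mon[OF \<omega>, of ks "\<lambda>\<beta>. Z \<beta> h" I] Z_L0 by (simp add: mult.commute)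
      qed
      ultimately have "((\<lambda>I. c I * mon ks (\<lambda>\<beta>. \<omega> (Z \<beta> h)) I) has_sum \<phi> (f0 h)) (exponents ks)" by simp
      then show ?thesis using c_sum[OF h] has_sum_unique by blast
    qed
    \<comment> \<open>As f and f0 have the same \<phi>-component, their difference takes values
      here; S' is smaller than S because it misses s.\<close>
    define S' where "S' = {x \<in> S. \<phi> x = 0}"
    have S': "submodule S'"
      unfolding submodule_def S'_def using sub_S SL
      by (auto intro!: subspaceI simp: subspace_0 subspace_add subspace_scale \<phi>.add \<phi>.scale \<phi>.zero \<phi>\<omega>)
    have "S' \<subset> S" using s by (auto simp: S'_def)
    moreover have "span S = S" "span S' = S'" using sub_S S' by (simp_all add: submodule_def span_eq_iff)
    ultimately have "dim S' < dim S" by (intro dim_psubset) (simp only:)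
    moreover have "f h - f0 h \<in> S'" if "h \<in> block_ball T" for h
      using \<phi>_eq[OF that] f(2)[OF that] f0_S[OF that] sub_S by (simp add: S'_def \<phi>.diff subspace_diff)
    ultimately obtain A1 where A1: "\<forall>h\<in>block_ball T. (\<lambda>I. norm (series_term A1 h I)) summable_on exponents ks \<and>
        (series_term A1 h has_sum f h - f0 h) (exponents ks)"
      using less.hyps[OF _ S' qS_diff[OF f(1) qS_f0]] by blast
    define A where "A I = A0 I + A1 I" for I
    have add: "series_term A h I = series_term A0 h I + series_term A1 h I" for h I
      by (simp add: series_term_def A_def distrib_right)
    show ?thesis
    proof (intro exI[of _ A] ballI conjI)
      fix h assume h: "h \<in> block_ball T"
      have "(\<lambda>I. norm (series_term A0 h I) + norm (series_term A1 h I)) summable_on exponents ks"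
        using A0_summ[OF h] A1 h by (intro summable_on_add) auto
      then show "(\<lambda>I. norm (series_term A h I)) summable_on exponents ks"
        by (rule Infinite_Sum.abs_summable_on_comparison_test') (simp add: add norm_triangle_ineq)
      have "((\<lambda>I. series_term A0 h I + series_term A1 h I) has_sum f0 h + (f h - f0 h)) (exponents ks)"
        using f0[OF h] A1 h by (intro has_sum_add) auto
      then show "(series_term A h has_sum f h) (exponents ks)"
        by (simp add: add[abs_def])
    qed
  qed
qed

text \<open>Translation to an arbitrary centre, with the whole algebra as the initial
  submodule.\<close>

lemma qS_expansion:
  assumes T: "\<And>\<beta>. \<beta> \<in> set ks \<Longrightarrow> 0 < T \<beta>" and f: "qS f D" and c: "c \<in> X"
    and D: "\<And>h. h \<in> block_ball T \<Longrightarrow> c + h \<in> D"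
  shows "\<exists>A. \<forall>h\<in>block_ball T. (\<lambda>I. norm (series_term A h I)) summable_on exponents ks \<and>
    (series_term A h has_sum f (c + h)) (exponents ks)"
proof (rule qS_expansion_in_submodule[OF T, where S = UNIV])
  show "submodule UNIV" by (simp add: submodule_def)
  show "qS (\<lambda>h. f (c + h)) (block_ball T)"
    unfolding qS_def
  proof (intro conjI ballI openin_block_ball)
    fix h assume h: "h \<in> block_ball T"
    obtain f' where f': "(f has_derivative f') (at (c + h) within D)"
      "\<And>h. h \<in> X \<Longrightarrow> f' h = (\<Sum>\<beta>\<in>set ks. Z \<beta> h * f' (v \<beta>))"
      using f D[OF h] unfolding qS_def by blast
    have "(f has_derivative f') (at (c + h) within (+) c ` block_ball T)"
      by (rule has_derivative_subset[OF f'(1)]) (use D in auto)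
    then have "(f \<circ> (+) c has_derivative f' \<circ> (\<lambda>k. k)) (at h within block_ball T)"
      by (intro diff_chain_within) (auto intro!: derivative_eq_intros)
    with f'(2) show "\<exists>f'. ((\<lambda>h. f (c + h)) has_derivative f') (at h within block_ball T) \<and>
        (\<forall>h\<in>X. f' h = (\<Sum>\<beta>\<in>set ks. Z \<beta> h * f' (v \<beta>)))"
      by (auto simp: o_def)
  qed
qed auto

end

section \<open>Iterated derivatives and uniqueness of the coefficients\<close>

context block_coordinates
begin

text \<open>Formulated for germs: each differentiation may shrink the ball, and the coefficients
  depend on the germ at c alone.\<close>

definition expands :: "('v \<Rightarrow> 'a) \<Rightarrow> 'v \<Rightarrow> (('k \<Rightarrow> nat) \<Rightarrow> 'a) \<Rightarrow> bool" where
  "expands f c A \<longleftrightarrow> (\<exists>\<epsilon>>0. \<forall>h\<in>X. norm h < \<epsilon> \<longrightarrow>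
     (\<lambda>I. norm (series_term A h I)) summable_on exponents ks \<and>
     (series_term A h has_sum f (c + h)) (exponents ks))"

text \<open>The coefficients of the formal derivative in the block variable \<gamma>.\<close>

definition shift :: "'k \<Rightarrow> (('k \<Rightarrow> nat) \<Rightarrow> 'a) \<Rightarrow> ('k \<Rightarrow> nat) \<Rightarrow> 'a" where
  "shift \<gamma> A I = real (Suc (I \<gamma>)) *\<^sub>R A (I(\<gamma> := Suc (I \<gamma>)))"

text \<open>Terms with I \<gamma> = 0 vanish and the others are renumbered by lowering I \<gamma>.
  The function F lets one argument serve both the series and its norms.\<close>

lemma deriv_term_reindex:
  fixes F :: "'a \<Rightarrow> 'b::{comm_monoid_add,t2_space}"
  assumes "\<gamma> \<in> set ks" "F 0 = 0"
  shows "((\<lambda>I. F (deriv_term A h \<gamma> I)) has_sum s) (exponents ks) \<longleftrightarrow>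
    ((\<lambda>I. F (series_term (shift \<gamma> A) h I)) has_sum s) (exponents ks)"
proof -
  let ?P = "{I \<in> exponents ks. I \<gamma> > 0}"
  have bij: "bij_betw (\<lambda>I. I(\<gamma> := Suc (I \<gamma>))) (exponents ks) ?P"
    by (rule bij_betwI[where g = "\<lambda>I. I(\<gamma> := I \<gamma> - 1)"]) (use assms in \<open>auto simp: exponents_def\<close>)
  have "((\<lambda>I. F (deriv_term A h \<gamma> I)) has_sum s) (exponents ks) \<longleftrightarrow>
      ((\<lambda>I. F (deriv_term A h \<gamma> I)) has_sum s) ?P"
    by (rule has_sum_cong_neutral) (auto simp: deriv_term_def assms)
  also have "\<dots> \<longleftrightarrow> ((\<lambda>I. F (deriv_term A h \<gamma> (I(\<gamma> := Suc (I \<gamma>))))) has_sum s) (exponents ks)"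
    by (rule has_sum_reindex_bij_betw[OF bij, symmetric])
  also have "(\<lambda>I. F (deriv_term A h \<gamma> (I(\<gamma> := Suc (I \<gamma>))))) = (\<lambda>I. F (series_term (shift \<gamma> A) h I))"
    by (simp add: fun_eq_iff deriv_term_def series_term_def shift_def)
  finally show ?thesis .
qed

lemma expands_derivative:
  assumes "expands f c A" "\<gamma> \<in> set ks"
  shows "\<exists>\<epsilon>>0. \<forall>h\<in>X. norm h < \<epsilon> \<longrightarrow> (\<exists>s.
    (\<lambda>I. norm (series_term (shift \<gamma> A) h I)) summable_on exponents ks \<and>
    (series_term (shift \<gamma> A) h has_sum s) (exponents ks) \<and>
    ((\<lambda>t. f (c + h + t *\<^sub>R v \<gamma>)) has_vector_derivative s) (at 0))"
proof -
  obtain \<epsilon>1 where \<epsilon>1: "\<epsilon>1 > 0" "\<And>h. h \<in> X \<Longrightarrow> norm h < \<epsilon>1 \<Longrightarrow> (\<lambda>I. norm (series_term A h I)) summable_on exponents ks"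
    "\<And>h. h \<in> X \<Longrightarrow> norm h < \<epsilon>1 \<Longrightarrow> (series_term A h has_sum f (c + h)) (exponents ks)"
    using assms(1) unfolding expands_def by blast
  obtain \<epsilon>2 where \<epsilon>2: "\<epsilon>2 > 0" "dominated_near A 0 \<epsilon>2"
    using dominated_near_of_abs_convergence[OF subspace_0[OF subspace_X] \<epsilon>1(1)] \<epsilon>1(2) by auto
  define D where "D = X \<inter> ball 0 (min \<epsilon>1 \<epsilon>2)"
  have D: "openin (top_of_set X) D" by (simp add: D_def openin_open_Int)
  have "\<exists>s. (\<lambda>I. norm (series_term (shift \<gamma> A) h I)) summable_on exponents ks \<and>
      (series_term (shift \<gamma> A) h has_sum s) (exponents ks) \<and>
      ((\<lambda>t. f (c + h + t *\<^sub>R v \<gamma>)) has_vector_derivative s) (at 0)" if h: "h \<in> D" for h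
  proof -
    have hb: "h \<in> ball 0 \<epsilon>2" using h by (simp add: D_def)
    define G where "G \<beta> = infsum (deriv_term A h \<beta>) (exponents ks)" for \<beta>
    have "((\<lambda>h. infsum (series_term A h) (exponents ks)) has_derivative (\<lambda>k. \<Sum>\<beta>\<in>set ks. Z \<beta> k * G \<beta>)) (at h within D)"
      unfolding G_def by (rule has_derivative_at_withinI[OF dominated_near_has_derivative[OF \<epsilon>2(2) hb]])
    then have "((\<lambda>h. f (c + h)) has_derivative (\<lambda>k. \<Sum>\<beta>\<in>set ks. Z \<beta> k * G \<beta>)) (at h within D)"
      by (rule has_derivative_transform[OF h, rotated]) (use \<epsilon>1(3) in \<open>auto simp: D_def intro: infsumI[symmetric]\<close>)
    from has_vector_derivative_along[OF this D subspace_X h v_X[OF assms(2)]]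
    have "((\<lambda>t. f (c + h + t *\<^sub>R v \<gamma>)) has_vector_derivative G \<gamma>) (at 0)"
      using assms(2) by (simp add: add.assoc Z_v if_distrib[of "\<lambda>x. x * _"] sum.delta cong: if_cong sum.cong)
    moreover have summ: "(\<lambda>I. norm (deriv_term A h \<gamma> I)) summable_on exponents ks"
      by (rule dominated_near_summable(2)[OF \<epsilon>2(2) hb assms(2)])
    then have "(deriv_term A h \<gamma> has_sum G \<gamma>) (exponents ks)"
      unfolding G_def by (rule has_sum_infsum[OF abs_summable_summable])
    then have "(series_term (shift \<gamma> A) h has_sum G \<gamma>) (exponents ks)"
      using deriv_term_reindex[OF assms(2), of "\<lambda>x. x" A h "G \<gamma>"] by simp
    moreover have "(\<lambda>I. norm (series_term (shift \<gamma> A) h I)) summable_on exponents ks"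
      using summ deriv_term_reindex[OF assms(2), of norm A h] unfolding summable_on_def by simp
    ultimately show ?thesis by blast
  qed
  then show ?thesis using \<epsilon>1(1) \<epsilon>2(1) by (intro exI[of _ "min \<epsilon>1 \<epsilon>2"]) (auto simp: D_def)
qed

text \<open>As f expands around every point of D, the derivative exists throughout D, as
  \<open>has_iter_deriv\<close> requires. Defining g by \<open>vector_derivative\<close> yields one
  function for all centres at once.\<close>

lemma derivative_expands:
  assumes f: "\<And>c. c \<in> D \<Longrightarrow> \<exists>A. expands f c A" and \<gamma>: "\<gamma> \<in> set ks"
  shows "\<exists>g. (\<forall>x\<in>D. ((\<lambda>t. f (x + t *\<^sub>R v \<gamma>)) has_vector_derivative g x) (at 0)) \<and>
    (\<forall>c A. expands f c A \<longrightarrow> expands g c (shift \<gamma> A))"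
proof (intro exI conjI ballI allI impI)
  let ?g = "\<lambda>x. vector_derivative (\<lambda>t. f (x + t *\<^sub>R v \<gamma>)) (at 0)"
  show "((\<lambda>t. f (x + t *\<^sub>R v \<gamma>)) has_vector_derivative ?g x) (at 0)" if x: "x \<in> D" for x
  proof -
    obtain A where "expands f x A" using f[OF x] by blast
    from expands_derivative[OF this \<gamma>] obtain \<epsilon> where \<epsilon>: "\<epsilon> > 0"
      "\<forall>h\<in>X. norm h < \<epsilon> \<longrightarrow> (\<exists>s.
        (\<lambda>I. norm (series_term (shift \<gamma> A) h I)) summable_on exponents ks \<and>
        (series_term (shift \<gamma> A) h has_sum s) (exponents ks) \<and>
        ((\<lambda>t. f (x + h + t *\<^sub>R v \<gamma>)) has_vector_derivative s) (at 0))" by blast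
    then obtain s where "((\<lambda>t. f (x + 0 + t *\<^sub>R v \<gamma>)) has_vector_derivative s) (at 0)"
      using subspace_0[OF subspace_X] norm_zero by metis
    then show ?thesis by (simp add: vector_derivative_at)
  qed
  fix c A assume "expands f c A"
  from expands_derivative[OF this \<gamma>] show "expands ?g c (shift \<gamma> A)"
    unfolding expands_def using vector_derivative_at by metis
qed

lemma iterated_derivative_expands:
  assumes "\<And>c. c \<in> D \<Longrightarrow> \<exists>A. expands f c A" "set \<gamma>s \<subseteq> set ks"
  shows "\<exists>g. has_iter_deriv D (map v \<gamma>s) f g \<and> (\<forall>c A. expands f c A \<longrightarrow> expands g c (foldr shift \<gamma>s A))"
  using assms(2)
proof (induction \<gamma>s)
  case Nil
  then show ?case by (intro exI[of _ f]) simp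
next
  case (Cons \<gamma> \<gamma>s)
  then obtain g where g: "has_iter_deriv D (map v \<gamma>s) f g"
    "\<And>c A. expands f c A \<Longrightarrow> expands g c (foldr shift \<gamma>s A)" by auto
  have "\<exists>A. expands g c A" if "c \<in> D" for c using assms(1)[OF that] g(2) by blast
  from derivative_expands[OF this, of D \<gamma>] Cons.prems obtain g' where
    g': "\<forall>x\<in>D. ((\<lambda>t. g (x + t *\<^sub>R v \<gamma>)) has_vector_derivative g' x) (at 0)"
    "\<And>c A. expands g c A \<Longrightarrow> expands g' c (shift \<gamma> A)" by auto
  have "has_iter_deriv D (map v (\<gamma> # \<gamma>s)) f g'"
    using g(1) g'(1) by auto
  moreover have "\<forall>c A. expands f c A \<longrightarrow> expands g' c (foldr shift (\<gamma> # \<gamma>s) A)"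
    using g(2) g'(2) by simp
  ultimately show ?case by blast
qed

text \<open>At h = 0 only the zero exponent contributes, because 0 ^ 0 = 1.\<close>

lemma expands_center:
  assumes "expands f c A"
  shows "f c = A (\<lambda>_. 0)"
proof -
  have "(series_term A 0 has_sum f (c + 0)) (exponents ks)"
    using assms subspace_0[OF subspace_X] norm_zero unfolding expands_def by metis
  moreover have "(series_term A 0 has_sum A (\<lambda>_. 0)) (exponents ks)"
  proof (rule has_sum_finite_neutralI[where B = "{\<lambda>_. 0}"])
    have "mon ls (\<lambda>\<beta>. 0 :: 'a) I = (if \<forall>\<beta>\<in>set ls. I \<beta> = 0 then 1 else 0)" for ls and I :: "'k \<Rightarrow> nat"
      by (induction ls) (auto simp: zero_power)
    then have m: "mon ks (\<lambda>\<beta>. Z \<beta> 0) I = (if \<forall>\<beta>\<in>set ks. I \<beta> = 0 then 1 else 0)" for I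
      by (simp add: linear_0[OF linear_Z])
    show "A (\<lambda>_. 0) = sum (series_term A 0) {\<lambda>_. 0}" by (simp add: series_term_def m)
    show "series_term A 0 I = 0" if I: "I \<in> exponents ks - {\<lambda>_. 0}" for I
    proof -
      obtain \<beta> where "I \<beta> \<noteq> 0" using I by (auto simp: fun_eq_iff)
      moreover from this have "\<beta> \<in> set ks" using I by (auto simp: exponents_def)
      ultimately show ?thesis by (auto simp: series_term_def m)
    qed
  qed (auto simp: exponents_def)
  ultimately show ?thesis using has_sum_unique by fastforce
qed

text \<open>Each shift in \<gamma> contributes the current exponent plus one; the accumulated
  products are quotients of factorials.\<close>

lemma foldr_shift:
  assumes "set \<gamma>s \<subseteq> set ks"
  shows "foldr shift \<gamma>s A I =
    (\<Prod>\<beta>\<in>set ks. fact (I \<beta> + count_list \<gamma>s \<beta>) / fact (I \<beta>)) *\<^sub>R A (\<lambda>\<beta>. I \<beta> + count_list \<gamma>s \<beta>)"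
  using assms
proof (induction \<gamma>s arbitrary: I)
  case (Cons \<gamma> \<gamma>s)
  have \<gamma>: "\<gamma> \<in> set ks" using Cons.prems by simp
  let ?J = "I(\<gamma> := Suc (I \<gamma>))" and ?q = "\<lambda>\<gamma>s (I :: 'k \<Rightarrow> nat) \<beta>. fact (I \<beta> + count_list \<gamma>s \<beta>) / fact (I \<beta>) :: real"
  have "(\<Prod>\<beta>\<in>set ks - {\<gamma>}. ?q \<gamma>s ?J \<beta>) = (\<Prod>\<beta>\<in>set ks - {\<gamma>}. ?q (\<gamma> # \<gamma>s) I \<beta>)"
    by (intro prod.cong) auto
  moreover have "real (Suc (I \<gamma>)) * ?q \<gamma>s ?J \<gamma> = ?q (\<gamma> # \<gamma>s) I \<gamma>"
  proof -
    have "real (Suc n) * (x / fact (Suc n)) = x / fact n" for n and x :: real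
      by (simp add: fact_Suc del: of_nat_Suc)
    then show ?thesis by simp
  qed
  ultimately have "real (Suc (I \<gamma>)) * (\<Prod>\<beta>\<in>set ks. ?q \<gamma>s ?J \<beta>) = (\<Prod>\<beta>\<in>set ks. ?q (\<gamma> # \<gamma>s) I \<beta>)"
    by (simp only: prod.remove[OF finite_set \<gamma>] mult.assoc[symmetric])
  moreover have "(\<lambda>\<beta>. ?J \<beta> + count_list \<gamma>s \<beta>) = (\<lambda>\<beta>. I \<beta> + count_list (\<gamma> # \<gamma>s) \<beta>)"
    by (auto simp: fun_eq_iff)
  moreover have "foldr shift (\<gamma> # \<gamma>s) A I = shift \<gamma> (foldr shift \<gamma>s A) I" by simp
  moreover have "\<dots> = real (Suc (I \<gamma>)) *\<^sub>R foldr shift \<gamma>s A ?J" by (rule shift_def)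
  moreover have "foldr shift \<gamma>s A ?J = (\<Prod>\<beta>\<in>set ks. ?q \<gamma>s ?J \<beta>) *\<^sub>R A (\<lambda>\<beta>. ?J \<beta> + count_list \<gamma>s \<beta>)"
    using Cons.prems by (intro Cons.IH) auto
  ultimately show ?case by (simp only: scaleR_scaleR)
qed simp

definition directions :: "('k \<Rightarrow> nat) \<Rightarrow> 'k list" where
  "directions I = concat (map (\<lambda>\<beta>. replicate (I \<beta>) \<beta>) ks)"

lemma foldr_shift_directions:
  assumes "I \<in> exponents ks"
  shows "foldr shift (directions I) A (\<lambda>_. 0) = (\<Prod>\<beta>\<in>set ks. fact (I \<beta>)) *\<^sub>R A I"
proof -
  have rep: "count_list (replicate n x) y = (if x = y then n else 0)" for n and x y :: 'k
    by (induction n) auto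
  have "count_list (concat (map (\<lambda>\<beta>. replicate (I \<beta>) \<beta>) ls)) \<beta> = (if \<beta> \<in> set ls then I \<beta> else 0)"
    if "distinct ls" for ls \<beta>
    using that by (induction ls) (auto simp: count_list_append rep)
  from this[OF distinct_ks] have "count_list (directions I) = I"
    using assms by (auto simp: directions_def exponents_def fun_eq_iff)
  moreover have "set (directions I) \<subseteq> set ks" by (auto simp: directions_def)
  ultimately show ?thesis using foldr_shift[of "directions I" A "\<lambda>_. 0"] by simp
qed

section \<open>Small block balls and the Taylor expansion\<close>

lemma norm_le_block_norms:
  assumes "h \<in> X"
  shows "norm h \<le> (\<Sum>\<beta>\<in>set ks. real (card (Bl \<beta>)) * block_norm \<beta> h)"
proof -
  have "norm ((h \<bullet> E \<beta> j) *\<^sub>R E \<beta> j) \<le> block_norm \<beta> h" if "\<beta> \<in> set ks" "j \<in> Bl \<beta>" for \<beta> j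
  proof -
    have "norm (E \<beta> j) = 1" using orthonormal[OF that(1,1,2,2)] by (simp add: norm_eq_sqrt_inner)
    then have "norm ((h \<bullet> E \<beta> j) *\<^sub>R E \<beta> j) = L2_set (\<lambda>j. h \<bullet> E \<beta> j) {j}" by (simp add: L2_set_def)
    also have "\<dots> \<le> block_norm \<beta> h"
      unfolding block_norm_def L2_set_def using that finite_Bl
      by (intro real_sqrt_le_mono sum_mono2) auto
    finally show ?thesis .
  qed
  then have "norm (\<Sum>\<beta>\<in>set ks. \<Sum>j\<in>Bl \<beta>. (h \<bullet> E \<beta> j) *\<^sub>R E \<beta> j) \<le> (\<Sum>\<beta>\<in>set ks. \<Sum>j\<in>Bl \<beta>. block_norm \<beta> h)"
    by (intro sum_norm_le)
  then show ?thesis using expansion[OF assms] by simp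
qed

lemma small_block_ball:
  assumes "\<epsilon> > 0"
  obtains t where "t > 0" "\<And>h. h \<in> block_ball (\<lambda>_. t) \<Longrightarrow> norm h < \<epsilon>"
proof -
  define C where "C = (\<Sum>\<beta>\<in>set ks. real (card (Bl \<beta>)))"
  have C: "C \<ge> 0" by (simp add: C_def sum_nonneg)
  show ?thesis
  proof (rule that[of "\<epsilon> / (1 + C)"])
    show "\<epsilon> / (1 + C) > 0" using assms C by simp
    fix h assume h: "h \<in> block_ball (\<lambda>_. \<epsilon> / (1 + C))"
    have "norm h \<le> (\<Sum>\<beta>\<in>set ks. real (card (Bl \<beta>)) * block_norm \<beta> h)"
      using h by (intro norm_le_block_norms) (simp add: block_ball_def)
    also have "\<dots> \<le> (\<Sum>\<beta>\<in>set ks. real (card (Bl \<beta>)) * (\<epsilon> / (1 + C)))"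
      using h by (intro sum_mono mult_left_mono) (auto simp: block_ball_def)
    also have "\<dots> = C * (\<epsilon> / (1 + C))" unfolding C_def by (rule sum_distrib_right[symmetric])
    also have "\<dots> < \<epsilon>" using assms C by (simp add: field_simps)
    finally show "norm h < \<epsilon>" .
  qed
qed

lemma expands_of_block_ball:
  assumes "\<And>\<beta>. \<beta> \<in> set ks \<Longrightarrow> 0 < T \<beta>"
    and "\<forall>h\<in>block_ball T. (\<lambda>I. norm (series_term A h I)) summable_on exponents ks \<and>
      (series_term A h has_sum f (c + h)) (exponents ks)"
  shows "expands f c A"
proof -
  have "0 \<in> block_ball T"
    using assms(1) subspace_0[OF subspace_X] by (simp add: block_ball_def block_norm_def L2_set_def)
  then obtain \<epsilon> where "\<epsilon> > 0" "ball 0 \<epsilon> \<inter> X \<subseteq> block_ball T"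
    using openin_block_ball[of T] unfolding openin_contains_ball by blast
  with assms(2) show ?thesis unfolding expands_def by (intro exI[of _ \<epsilon>]) auto
qed

text \<open>\<open>qS_expansion\<close> yields coefficients that might depend on T. The iterated
  derivatives at c determine the coefficients of every local expansion, so one family A serves all
  block balls around c.\<close>

theorem qS_taylor:
  assumes f: "qS f D" and c: "c \<in> D"
  shows "\<exists>A. (\<forall>T. (\<forall>\<beta>\<in>set ks. 0 < T \<beta>) \<and> (\<forall>h\<in>block_ball T. c + h \<in> D) \<longrightarrow>
      (\<forall>h\<in>block_ball T. (\<lambda>I. norm (series_term A h I)) summable_on exponents ks \<and>
        (series_term A h has_sum f (c + h)) (exponents ks))) \<and>
    (\<forall>I\<in>exponents ks. \<exists>g. has_iter_deriv D (map v (directions I)) f g \<and>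
      (\<Prod>\<beta>\<in>set ks. fact (I \<beta>)) *\<^sub>R A I = g c)"
proof -
  have D: "openin (top_of_set X) D" using f by (simp add: qS_def)
  then have DX: "D \<subseteq> X" by (rule openin_imp_subset)
  \<comment> \<open>Expansions are wanted at every point of D and not only at c, because the
    iterated derivatives have to exist on all of D.\<close>
  have local: "\<exists>A. expands f x A" if x: "x \<in> D" for x
  proof -
    obtain \<epsilon> where \<epsilon>: "\<epsilon> > 0" "ball x \<epsilon> \<inter> X \<subseteq> D" using D x by (auto simp: openin_contains_ball)
    obtain t where t: "t > 0" "\<And>h. h \<in> block_ball (\<lambda>_. t) \<Longrightarrow> norm h < \<epsilon>"
      using small_block_ball[OF \<epsilon>(1)] by blast
    have "x + h \<in> D" if "h \<in> block_ball (\<lambda>_. t)" for h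
    proof -
      have "x + h \<in> X"
        using that x DX by (intro subspace_add subspace_X) (auto simp: block_ball_def)
      moreover have "x + h \<in> ball x \<epsilon>" using t(2)[OF that] by (simp add: dist_norm)
      ultimately show ?thesis using \<epsilon>(2) by blast
    qed
    then show ?thesis
      using qS_expansion[of "\<lambda>_. t", OF t(1) f] expands_of_block_ball[of "\<lambda>_. t", OF t(1)] x DX by blast
  qed
  have "\<exists>g. has_iter_deriv D (map v (directions I)) f g \<and>
      (\<forall>c A. expands f c A \<longrightarrow> expands g c (foldr shift (directions I) A))" for I
    by (rule iterated_derivative_expands[OF local]) (auto simp: directions_def)
  then have "\<forall>I. \<exists>g. has_iter_deriv D (map v (directions I)) f g \<and>
      (\<forall>c A. expands f c A \<longrightarrow> expands g c (foldr shift (directions I) A))" by blast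
  from choice[OF this] obtain g where g: "\<And>I. has_iter_deriv D (map v (directions I)) f (g I)"
    "\<And>I c A. expands f c A \<Longrightarrow> expands (g I) c (foldr shift (directions I) A)" by blast
  define fc where "fc I = (\<Prod>\<beta>\<in>set ks. fact (I \<beta>) :: real)" for I :: "'k \<Rightarrow> nat"
  have fc: "fc I \<noteq> 0" for I by (simp add: fc_def)
  have coeff: "fc I *\<^sub>R A I = g I c" if "expands f c A" "I \<in> exponents ks" for A I
    using expands_center[OF g(2)[OF that(1)], of I] foldr_shift_directions[OF that(2), of A] by (simp add: fc_def)
  obtain A where A: "expands f c A" using local[OF c] by blast
  show ?thesis
  proof (intro exI[of _ A] conjI allI impI ballI)
    fix I assume "I \<in> exponents ks"
    then show "\<exists>g. has_iter_deriv D (map v (directions I)) f g \<and> (\<Prod>\<beta>\<in>set ks. fact (I \<beta>)) *\<^sub>R A I = g c"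
      using g(1)[of I] coeff[OF A] by (auto simp: fc_def)
  next
    fix T h assume T: "(\<forall>\<beta>\<in>set ks. 0 < T \<beta>) \<and> (\<forall>h\<in>block_ball T. c + h \<in> D)" and h: "h \<in> block_ball T"
    have cX: "c \<in> X" using c DX by blast
    obtain A2 where A2: "\<forall>h\<in>block_ball T. (\<lambda>I. norm (series_term A2 h I)) summable_on exponents ks \<and>
        (series_term A2 h has_sum f (c + h)) (exponents ks)"
      using qS_expansion[OF _ f cX, of T] T by blast
    have e2: "expands f c A2" by (rule expands_of_block_ball[OF _ A2]) (use T in blast)
    \<comment> \<open>Both families are fixed by the same value g I c, up to the nonzero
      factorial.\<close>
    have "A2 I = A I" if "I \<in> exponents ks" for I
      using coeff[OF A that] coeff[OF e2 that] fc[of I] by (metis scaleR_cancel_left)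
    then have eq: "series_term A2 h I = series_term A h I" if "I \<in> exponents ks" for I
      using that by (simp add: series_term_def)
    show "(\<lambda>I. norm (series_term A h I)) summable_on exponents ks"
      using A2 h eq summable_on_cong[of "exponents ks" "\<lambda>I. norm (series_term A2 h I)" "\<lambda>I. norm (series_term A h I)"]
      by simp
    show "(series_term A h has_sum f (c + h)) (exponents ks)"
      by (rule has_sum_cong[THEN iffD1, of "exponents ks" "series_term A2 h"]) (use A2 h eq in auto)
  qed
qed

end

section \<open>Coordinates of the superspace\<close>

lemma orthonormal_basis_coord:
  fixes B :: "nat \<Rightarrow> 'a::euclidean_space"
  assumes B: "basis_family B K S" and K: "finite K"
    and on: "\<And>i j. i \<in> K \<Longrightarrow> j \<in> K \<Longrightarrow> B i \<bullet> B j = (if i = j then 1 else 0)" and x: "x \<in> S"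
  shows "j \<in> K \<Longrightarrow> coord B K x j = x \<bullet> B j"
    and "x = (\<Sum>k\<in>K. (x \<bullet> B k) *\<^sub>R B k)"
    and "(norm x)\<^sup>2 = (\<Sum>k\<in>K. (x \<bullet> B k)\<^sup>2)"
proof -
  have inj: "inj_on B K" and ind: "independent (B ` K)" and span: "x \<in> span (B ` K)"
    using B x by (auto simp: basis_family_def)
  have "(\<Sum>b\<in>B ` K. representation (B ` K) x b *\<^sub>R b) = x"
    using K by (intro real_vector.sum_representation_eq ind span) auto
  then have e: "x = (\<Sum>k\<in>K. coord B K x k *\<^sub>R B k)"
    by (simp add: sum.reindex[OF inj] coord_def)
  show c: "coord B K x j = x \<bullet> B j" if "j \<in> K" for j
  proof -
    have "x \<bullet> B j = (\<Sum>k\<in>K. coord B K x k * (if k = j then 1 else 0))"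
      by (subst e) (auto simp: inner_sum_left on that intro!: sum.cong)
    then show ?thesis using that K by (simp add: if_distrib[of "\<lambda>x. _ * x"] sum.delta cong: if_cong)
  qed
  show e': "x = (\<Sum>k\<in>K. (x \<bullet> B k) *\<^sub>R B k)" by (subst e) (simp add: c cong: sum.cong)
  have "(norm x)\<^sup>2 = x \<bullet> (\<Sum>k\<in>K. (x \<bullet> B k) *\<^sub>R B k)" using e' by (simp add: power2_norm_eq_inner)
  then show "(norm x)\<^sup>2 = (\<Sum>k\<in>K. (x \<bullet> B k)\<^sup>2)"
    by (simp add: inner_sum_right power2_eq_square)
qed

locale super_coordinates =
  fixes L :: "nat \<Rightarrow> 'a::{real_algebra_1,euclidean_space} set"
    and p q r :: nat and e \<epsilon> a :: "nat \<Rightarrow> 'a" and s :: "nat \<Rightarrow> nat"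
    and N :: "'n::{finite,linorder} set" and M :: "'m::{finite,linorder} set"
  assumes csa: "comm_superalgebra L" and A0: "cond_A0 L p e" and A1: "cond_A1 L q \<epsilon> r s a"
    and onb: "orthonormal_bases p e q \<epsilon>"
begin

text \<open>\<open>Inl i\<close> stands for the even variable i and \<open>Inr (k, j)\<close> for
  block k of the odd variable j. The order is that of the factors in \<open>super_term\<close> and
  of the directions in \<open>deriv_dirs\<close>.\<close>

definition ks :: "('n + nat \<times> 'm) list" where
  "ks = map Inl (sorted_list_of_set N) @
    concat (map (\<lambda>k. map (\<lambda>j. Inr (k, j)) (sorted_list_of_set M)) [1..<r + 1])"

definition Bl :: "'n + nat \<times> 'm \<Rightarrow> nat set" where
  "Bl = case_sum (\<lambda>_. {0..p}) (\<lambda>(k, _). {s k..<s (k + 1)})"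

definition E :: "'n + nat \<times> 'm \<Rightarrow> nat \<Rightarrow> ('a, 'n, 'm) superpoint" where
  "E = case_sum (even_dir e) (\<lambda>(_, j). odd_dir \<epsilon> j)"

definition a' :: "'n + nat \<times> 'm \<Rightarrow> nat \<Rightarrow> 'a" where
  "a' = case_sum (\<lambda>_. e) (\<lambda>_. a)"

definition lead :: "'n + nat \<times> 'm \<Rightarrow> nat" where
  "lead = case_sum (\<lambda>_. 0) (\<lambda>(k, _). s k)"

lemma set_ks: "set ks = Inl ` N \<union> Inr ` ({1..r} \<times> M)"
  by (auto simp: ks_def)

lemma distinct_ks: "distinct ks"
proof -
  have "distinct (concat (map (\<lambda>k. map (\<lambda>j. Inr (k, j) :: 'n + nat \<times> 'm) (sorted_list_of_set M)) ls))"
    if "distinct ls" for ls :: "nat list"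
    using that by (induction ls) (auto simp: distinct_map inj_on_def)
  from this[of "[1..<r + 1]"] show ?thesis
    by (auto simp: ks_def distinct_map)
qed

lemma e_basis: "basis_family e {0..p} (L 0)" and e_0: "e 0 = 1" and e_sq: "(\<Sum>k=0..p. e k ^ 2) = 0"
  using A0 by (auto simp: cond_A0_def)

lemma \<epsilon>_basis: "basis_family \<epsilon> {1..q} (L 1)"
  using A1 by (simp add: cond_A1_def)

lemma s_less: "k \<in> {1..r} \<Longrightarrow> s k < s (k + 1)" and s_1: "s 1 = 1" and s_r: "s (r + 1) = q + 1"
  using A1 by (auto simp: cond_A1_def)

lemma s_mono:
  assumes "1 \<le> k" "k \<le> l" "l \<le> r + 1"
  shows "s k \<le> s l"
  using assms(2,1,3)
proof (induction l rule: dec_induct)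
  case (step n)
  then show ?case using s_less[of n] by auto
qed simp

lemma block_subset: "k \<in> {1..r} \<Longrightarrow> {s k..<s (k + 1)} \<subseteq> {1..q}"
  using s_mono[of 1 k] s_mono[of "k + 1" "r + 1"] s_1 s_r by auto

lemma block_unique:
  assumes "k \<in> {1..r}" "l \<in> {1..r}" "t \<in> {s k..<s (k + 1)}" "t \<in> {s l..<s (l + 1)}"
  shows "k = l"
proof (rule ccontr)
  assume "k \<noteq> l"
  then consider "k < l" | "l < k" by linarith
  then show False
    by cases (use assms s_mono[of "k + 1" l] s_mono[of "l + 1" k] in auto)
qed

lemma block_cases:
  assumes "\<beta> \<in> set ks" "t \<in> Bl \<beta>"
  obtains (even) i where "\<beta> = Inl i" "i \<in> N" "t \<in> {0..p}"
    | (odd) k j where "\<beta> = Inr (k, j)" "k \<in> {1..r}" "j \<in> M" "t \<in> {s k..<s (k + 1)}" "t \<in> {1..q}"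
proof (cases \<beta>)
  case (Inl i)
  then show ?thesis using assms even by (auto simp: set_ks Bl_def)
next
  case (Inr x)
  obtain k j where x: "x = (k, j)" by (cases x)
  have "k \<in> {1..r}" "j \<in> M" "t \<in> {s k..<s (k + 1)}" using assms Inr x by (auto simp: set_ks Bl_def)
  moreover from this have "t \<in> {1..q}" using block_subset by blast
  ultimately show ?thesis using odd Inr x by blast
qed

text \<open>The blocks partition the indices 1 to q, because s increases from 1 to q + 1.\<close>

lemma sum_blocks:
  fixes g :: "nat \<Rightarrow> 'b::comm_monoid_add"
  shows "(\<Sum>k\<in>{1..r}. \<Sum>t\<in>{s k..<s (k + 1)}. g t) = (\<Sum>t\<in>{1..q}. g t)"
proof -
  have "(\<Sum>k\<in>{1..n}. \<Sum>t\<in>{s k..<s (k + 1)}. g t) = (\<Sum>t\<in>{1..<s (n + 1)}. g t)" if "n \<le> r" for n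
    using that
  proof (induction n)
    case 0
    then show ?case using s_1 by simp
  next
    case (Suc n)
    have "s 1 \<le> s (Suc n)" "s (Suc n) \<le> s (Suc n + 1)" using Suc.prems by (intro s_mono; simp)+
    then show ?case using Suc s_1 by (simp add: sum.atLeastLessThan_concat)
  qed
  from this[of r] show ?thesis using s_r by (simp add: atLeastLessThanSuc_atLeastAtMost)
qed

lemma subspace_L: "subspace (L 0)" "subspace (L 1)"
  using csa by (auto simp: comm_superalgebra_def)

lemma e_L0: "k \<in> {0..p} \<Longrightarrow> e k \<in> L 0"
  using e_basis span_base[of "e k" "e ` {0..p}"] by (simp add: basis_family_def)

lemma \<epsilon>_L1: "k \<in> {1..q} \<Longrightarrow> \<epsilon> k \<in> L 1"
  using \<epsilon>_basis span_base[of "\<epsilon> k" "\<epsilon> ` {1..q}"] by (simp add: basis_family_def)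

lemma e_on: "i \<in> {0..p} \<Longrightarrow> j \<in> {0..p} \<Longrightarrow> e i \<bullet> e j = (if i = j then 1 else 0)"
  and \<epsilon>_on: "k \<in> {1..q} \<Longrightarrow> l \<in> {1..q} \<Longrightarrow> \<epsilon> k \<bullet> \<epsilon> l = (if k = l then 1 else 0)"
  using onb by (auto simp: orthonormal_bases_def)

lemmas e_coord = orthonormal_basis_coord[OF e_basis finite_atLeastAtMost e_on]
lemmas \<epsilon>_coord = orthonormal_basis_coord[OF \<epsilon>_basis finite_atLeastAtMost \<epsilon>_on]

lemma superspace_iff:
  "h \<in> superspace L N M \<longleftrightarrow> (\<forall>i. fst h $ i \<in> (if i \<in> N then L 0 else {0})) \<and>
    (\<forall>j. snd h $ j \<in> (if j \<in> M then L 1 else {0}))"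
  by (cases h) (auto simp: superspace_def)

lemma subspace_superspace: "subspace (superspace L N M)"
proof (rule subspaceI)
  show "0 \<in> superspace L N M" using subspace_L by (simp add: superspace_iff subspace_0)
  show "x + y \<in> superspace L N M" if "x \<in> superspace L N M" "y \<in> superspace L N M" for x y
    using that subspace_L unfolding superspace_iff by (simp add: subspace_add)
  show "t *\<^sub>R x \<in> superspace L N M" if "x \<in> superspace L N M" for t x
    using that subspace_L unfolding superspace_iff by (simp add: subspace_scale)
qed

lemma inner_even_dir: "h \<bullet> even_dir e i k = fst h $ i \<bullet> e k"
  by (simp add: even_dir_def inner_prod_def inner_axis)

lemma inner_odd_dir: "h \<bullet> odd_dir \<epsilon> j k = snd h $ j \<bullet> \<epsilon> k"
  by (simp add: odd_dir_def inner_prod_def inner_axis)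

lemma superspace_expansion:
  assumes h: "h \<in> superspace L N M"
  shows "h = (\<Sum>\<beta>\<in>set ks. \<Sum>j\<in>Bl \<beta>. (h \<bullet> E \<beta> j) *\<^sub>R E \<beta> j)"
proof -
  have "(\<Sum>\<beta>\<in>set ks. \<Sum>j\<in>Bl \<beta>. (h \<bullet> E \<beta> j) *\<^sub>R E \<beta> j) =
      (\<Sum>i\<in>N. \<Sum>k\<in>{0..p}. (fst h $ i \<bullet> e k) *\<^sub>R even_dir e i k) +
      (\<Sum>x\<in>{1..r} \<times> M. \<Sum>t\<in>{s (fst x)..<s (fst x + 1)}. (snd h $ snd x \<bullet> \<epsilon> t) *\<^sub>R odd_dir \<epsilon> (snd x) t)"
    unfolding set_ks
    by (subst sum.union_disjoint)
      (auto simp: sum.reindex Bl_def E_def inner_even_dir inner_odd_dir case_prod_unfold)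
  also have "(\<Sum>x\<in>{1..r} \<times> M. \<Sum>t\<in>{s (fst x)..<s (fst x + 1)}. (snd h $ snd x \<bullet> \<epsilon> t) *\<^sub>R odd_dir \<epsilon> (snd x) t) =
      (\<Sum>k\<in>{1..r}. \<Sum>j\<in>M. \<Sum>t\<in>{s k..<s (k + 1)}. (snd h $ j \<bullet> \<epsilon> t) *\<^sub>R odd_dir \<epsilon> j t)"
    by (rule trans[OF _ sum.cartesian_product[symmetric]]) (simp add: case_prod_unfold)
  also have "\<dots> = (\<Sum>j\<in>M. \<Sum>k\<in>{1..r}. \<Sum>t\<in>{s k..<s (k + 1)}. (snd h $ j \<bullet> \<epsilon> t) *\<^sub>R odd_dir \<epsilon> j t)"
    by (rule sum.swap)
  also have "\<dots> = (\<Sum>j\<in>M. \<Sum>t\<in>{1..q}. (snd h $ j \<bullet> \<epsilon> t) *\<^sub>R odd_dir \<epsilon> j t)"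
    by (simp only: sum_blocks)
  also have "(\<Sum>i\<in>N. \<Sum>k\<in>{0..p}. (fst h $ i \<bullet> e k) *\<^sub>R even_dir e i k) = (fst h, 0 :: ('a, 'm) vec)"
  proof -
    have "(\<Sum>k\<in>{0..p}. (fst h $ i \<bullet> e k) *\<^sub>R even_dir e i k) = (axis i (fst h $ i), 0 :: ('a, 'm) vec)" if "i \<in> N" for i
    proof -
      have "fst h $ i \<in> L 0" using h that by (auto simp: superspace_iff split: if_splits)
      have lin: "linear (\<lambda>x. (axis i x, 0 :: ('a, 'm) vec) :: ('a, 'n, 'm) superpoint)"
        by (rule linearI) (auto simp: axis_def vec_eq_iff prod_eq_iff)
      have "(axis i (fst h $ i), 0 :: ('a, 'm) vec) = (axis i (\<Sum>k\<in>{0..p}. (fst h $ i \<bullet> e k) *\<^sub>R e k), 0)"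
        using e_coord(2)[OF _ _ \<open>fst h $ i \<in> L 0\<close>] by simp
      also have "\<dots> = (\<Sum>k\<in>{0..p}. (fst h $ i \<bullet> e k) *\<^sub>R even_dir e i k)"
        by (simp only: linear_sum[OF lin] linear_cmul[OF lin] even_dir_def)
      finally show ?thesis by simp
    qed
    then have "(\<Sum>i\<in>N. \<Sum>k\<in>{0..p}. (fst h $ i \<bullet> e k) *\<^sub>R even_dir e i k) =
        (\<Sum>i\<in>N. (axis i (fst h $ i), 0 :: ('a, 'm) vec))" by simp
    also have "\<dots> = (\<Sum>i\<in>N. axis i (fst h $ i), 0)" by (simp add: sum_prod)
    also have "(\<Sum>i\<in>N. axis i (fst h $ i)) = fst h"
      using h by (auto simp: vec_eq_iff superspace_iff axis_def sum.delta' split: if_splits)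
    finally show ?thesis .
  qed
  also have "(\<Sum>j\<in>M. \<Sum>t\<in>{1..q}. (snd h $ j \<bullet> \<epsilon> t) *\<^sub>R odd_dir \<epsilon> j t) = (0 :: ('a, 'n) vec, snd h)"
  proof -
    have "(\<Sum>t\<in>{1..q}. (snd h $ j \<bullet> \<epsilon> t) *\<^sub>R odd_dir \<epsilon> j t) = (0 :: ('a, 'n) vec, axis j (snd h $ j))" if "j \<in> M" for j
    proof -
      have "snd h $ j \<in> L 1" using h that by (auto simp: superspace_iff split: if_splits)
      have lin: "linear (\<lambda>x. (0 :: ('a, 'n) vec, axis j x) :: ('a, 'n, 'm) superpoint)"
        by (rule linearI) (auto simp: axis_def vec_eq_iff prod_eq_iff)
      have "(0 :: ('a, 'n) vec, axis j (snd h $ j)) = (0, axis j (\<Sum>t\<in>{1..q}. (snd h $ j \<bullet> \<epsilon> t) *\<^sub>R \<epsilon> t))"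
        using \<epsilon>_coord(2)[OF _ _ \<open>snd h $ j \<in> L 1\<close>] by simp
      also have "\<dots> = (\<Sum>t\<in>{1..q}. (snd h $ j \<bullet> \<epsilon> t) *\<^sub>R odd_dir \<epsilon> j t)"
        by (simp only: linear_sum[OF lin] linear_cmul[OF lin] odd_dir_def)
      finally show ?thesis by simp
    qed
    then have "(\<Sum>j\<in>M. \<Sum>t\<in>{1..q}. (snd h $ j \<bullet> \<epsilon> t) *\<^sub>R odd_dir \<epsilon> j t) =
        (\<Sum>j\<in>M. (0 :: ('a, 'n) vec, axis j (snd h $ j)))" by simp
    also have "\<dots> = (0, \<Sum>j\<in>M. axis j (snd h $ j))" by (simp add: sum_prod)
    also have "(\<Sum>j\<in>M. axis j (snd h $ j)) = snd h"
      using h by (auto simp: vec_eq_iff superspace_iff axis_def sum.delta' split: if_splits)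
    finally show ?thesis .
  qed
  finally show ?thesis by simp
qed

lemma even_dir_superspace: "i \<in> N \<Longrightarrow> k \<in> {0..p} \<Longrightarrow> even_dir e i k \<in> superspace L N M"
  using e_L0 subspace_L by (auto simp: superspace_iff even_dir_def axis_def subspace_0)

lemma odd_dir_superspace: "j \<in> M \<Longrightarrow> t \<in> {1..q} \<Longrightarrow> odd_dir \<epsilon> j t \<in> superspace L N M"
  using \<epsilon>_L1 subspace_L by (auto simp: superspace_iff odd_dir_def axis_def subspace_0)

sublocale block_coordinates "L 0" ks Bl E a' lead "superspace L N M"
proof unfold_locales
  show "subspace (L 0)" by (rule subspace_L)
  show "1 \<in> L 0" using e_L0[of 0] e_0 by simp
  have deg: "x * y \<in> L ((i + j) mod 2) \<and> x * y = (- 1) ^ (i * j) * (y * x)"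
    if "i \<in> {0, 1}" "j \<in> {0, 1}" "x \<in> L i" "y \<in> L j" for i j x y
    using csa that unfolding comm_superalgebra_def by blast
  show "x * y \<in> L 0" if "x \<in> L 0" "y \<in> L 0" for x y using conjunct1[OF deg[of 0 0 x y]] that by simp
  \<comment> \<open>The sign exponent i * j is 0 when one factor is even, so x commutes with both
    homogeneous parts of y.\<close>
  show "x * y = y * x" if "x \<in> L 0" for x y
  proof -
    obtain u w where "u \<in> L 0" "w \<in> L 1" "y = u + w" using csa unfolding comm_superalgebra_def by blast
    then show ?thesis using deg[of 0 0 x u] deg[of 0 1 x w] that by (simp add: algebra_simps)
  qed
  show "\<exists>(e :: nat \<Rightarrow> 'a) p. (\<forall>k\<in>{0..p}. e k \<in> L 0) \<and> e 0 = 1 \<and> (\<Sum>k=0..p. e k ^ 2) = 0"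
    by (intro exI[of _ e] exI[of _ p] conjI ballI) (use e_L0 e_0 e_sq in auto)
  show "distinct ks" by (rule distinct_ks)
  show "subspace (superspace L N M)" by (rule subspace_superspace)
  show "h = (\<Sum>\<beta>\<in>set ks. \<Sum>j\<in>Bl \<beta>. (h \<bullet> E \<beta> j) *\<^sub>R E \<beta> j)" if "h \<in> superspace L N M" for h
    using that by (rule superspace_expansion)
  have A1': "a (s k) = 1" "(\<Sum>j\<in>{s k..<s (k + 1)}. a j ^ 2) = 0" if "k \<in> {1..r}" for k
    using A1 that unfolding cond_A1_def by blast+
  have aL: "a j \<in> L 0" if "j \<in> {1..q}" for j using A1 that unfolding cond_A1_def by blast
  fix \<beta> assume \<beta>: "\<beta> \<in> set ks"
  show "finite (Bl \<beta>)" by (auto simp: Bl_def split: sum.split)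
  show "lead \<beta> \<in> Bl \<beta>" using \<beta> s_less by (auto simp: set_ks Bl_def lead_def)
  show "a' \<beta> (lead \<beta>) = 1" using \<beta> A1' e_0 by (auto simp: set_ks lead_def a'_def)
  show "(\<Sum>j\<in>Bl \<beta>. a' \<beta> j ^ 2) = 0" using \<beta> A1' e_sq by (auto simp: set_ks Bl_def a'_def)
  show "E \<beta> j \<in> superspace L N M" if "j \<in> Bl \<beta>" for j
    using \<beta> that by (cases rule: block_cases) (auto simp: E_def even_dir_superspace odd_dir_superspace)
  show "a' \<beta> j \<in> L 0" if "j \<in> Bl \<beta>" for j
    using \<beta> that by (cases rule: block_cases) (auto simp: a'_def e_L0 aL)
  fix \<gamma> i j assume "\<gamma> \<in> set ks" "i \<in> Bl \<beta>" "j \<in> Bl \<gamma>"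
  note \<gamma> = this
  show "E \<beta> i \<bullet> E \<gamma> j = (if \<beta> = \<gamma> \<and> i = j then 1 else 0)"
    using \<beta> \<gamma>(2)
  proof (cases rule: block_cases)
    case \<beta>: (even n)
    show ?thesis using \<gamma>(1,3)
    proof (cases rule: block_cases)
      case (even n')
      then show ?thesis using \<beta> by (auto simp: E_def even_dir_def inner_prod_def inner_axis_axis e_on)
    qed (use \<beta> in \<open>auto simp: E_def even_dir_def odd_dir_def inner_prod_def\<close>)
  next
    case \<beta>: (odd k m)
    show ?thesis using \<gamma>(1,3)
    proof (cases rule: block_cases)
      case (odd l m')
      then show ?thesis
        using \<beta> block_unique[of k l i] by (auto simp: E_def odd_dir_def inner_prod_def inner_axis_axis \<epsilon>_on)
    qed (use \<beta> in \<open>auto simp: E_def even_dir_def odd_dir_def inner_prod_def\<close>)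
  qed
qed

end

section \<open>Translation between superspace and block notation\<close>

lemma multi_power_eq_mon: "multi_power K x I = mon (sorted_list_of_set K) x I"
  by (simp add: multi_power_def mon_def)

definition split_index :: "('n + nat \<times> 'm \<Rightarrow> nat) \<Rightarrow> ('n \<Rightarrow> nat) \<times> (nat \<Rightarrow> 'm \<Rightarrow> nat)" where
  "split_index I = (\<lambda>i. I (Inl i), \<lambda>k j. I (Inr (k, j)))"

context super_coordinates
begin

lemma block_simps:
  "Bl (Inl i) = {0..p}" "Bl (Inr (k, j)) = {s k..<s (k + 1)}"
  "E (Inl i) = even_dir e i" "E (Inr (k, j)) = odd_dir \<epsilon> j"
  "a' (Inl i) = e" "a' (Inr (k, j)) = a" "lead (Inl i) = 0" "lead (Inr (k, j)) = s k"
  by (simp_all add: Bl_def E_def a'_def lead_def)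

lemma ks_iff: "Inl i \<in> set ks \<longleftrightarrow> i \<in> N" "Inr (k, j) \<in> set ks \<longleftrightarrow> k \<in> {1..r} \<and> j \<in> M"
  by (auto simp: set_ks)

lemma bij_split_index: "bij_betw split_index (exponents ks) (multi_indices r N M)"
proof (rule bij_betwI[where g = "\<lambda>(I, J). case_sum I (\<lambda>(k, j). J k j)"])
  show "split_index \<in> exponents ks \<rightarrow> multi_indices r N M"
  proof
    fix I assume "I \<in> exponents ks"
    then have "I \<beta> = 0" if "\<beta> \<notin> set ks" for \<beta> using that by (simp add: exponents_def)
    then show "split_index I \<in> multi_indices r N M"
      by (simp add: multi_indices_def split_index_def ks_iff)
  qed
  show "(\<lambda>(I, J). case_sum I (\<lambda>(k, j). J k j)) \<in> multi_indices r N M \<rightarrow> exponents ks"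
    by (auto simp: exponents_def multi_indices_def ks_iff split: sum.split)
qed (auto simp: split_index_def fun_eq_iff split: sum.split)

lemma Z_Inl:
  assumes "h \<in> superspace L N M" "i \<in> N"
  shows "Z (Inl i) h = fst h $ i"
proof -
  have "fst h $ i \<in> L 0" using assms by (auto simp: superspace_iff split: if_splits)
  from e_coord(2)[OF _ _ this] show ?thesis
    by (simp add: Z_def block_simps inner_even_dir)
qed

lemma Z_Inr:
  assumes "h \<in> superspace L N M" "k \<in> {1..r}" "j \<in> M"
  shows "Z (Inr (k, j)) h = Z_map q \<epsilon> s a k (snd h $ j)"
proof -
  have h: "snd h $ j \<in> L 1" using assms by (auto simp: superspace_iff split: if_splits)
  have eq: "coord \<epsilon> {1..q} (snd h $ j) t = snd h $ j \<bullet> \<epsilon> t" if "t \<in> {s k..<s (k + 1)}" for t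
    by (rule \<epsilon>_coord(1)[OF _ _ h]) (use that block_subset[OF assms(2)] in auto)
  show ?thesis
    unfolding Z_def Z_map_def block_simps inner_odd_dir by (intro sum.cong refl) (simp only: eq)
qed

lemma super_term_split_index:
  assumes "x \<in> superspace L N M" "c \<in> superspace L N M"
  shows "super_term q \<epsilon> r s a N M A c x (split_index I) = series_term (\<lambda>I. A (split_index I)) (x - c) I"
proof -
  have xc: "x - c \<in> superspace L N M" using assms by (intro subspace_diff subspace_superspace)
  have "mon (sorted_list_of_set N) (\<lambda>i. fst x $ i - fst c $ i) (\<lambda>i. I (Inl i)) =
      mon (map Inl (sorted_list_of_set N)) (\<lambda>\<beta>. Z \<beta> (x - c)) I"
    unfolding mon_map by (rule mon_cong) (auto simp: Z_Inl[OF xc])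
  moreover have "prod_list (map (\<lambda>k. mon (sorted_list_of_set M)
        (\<lambda>j. Z_map q \<epsilon> s a k (snd x $ j - snd c $ j)) (\<lambda>j. I (Inr (k, j)))) [1..<r + 1]) =
      mon (concat (map (\<lambda>k. map (\<lambda>j. Inr (k, j)) (sorted_list_of_set M)) [1..<r + 1])) (\<lambda>\<beta>. Z \<beta> (x - c)) I"
    unfolding mon_concat map_map o_def mon_map
    by (intro arg_cong[where f = prod_list] map_cong mon_cong refl) (auto simp: Z_Inr[OF xc])
  ultimately show ?thesis
    unfolding series_term_def unfolding ks_def
    by (simp add: super_term_def split_index_def mon_append multi_power_eq_mon mult.assoc
        del: upt_Suc)
qed

lemma converges_absolutely_iff:
  assumes "x \<in> superspace L N M" "c \<in> superspace L N M"
  shows "converges_absolutely_at q \<epsilon> r s a N M A c x \<longleftrightarrow>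
    (\<lambda>I. norm (series_term (\<lambda>I. A (split_index I)) (x - c) I)) summable_on exponents ks"
  unfolding converges_absolutely_at_def super_term_split_index[OF assms, symmetric]
  by (rule summable_on_reindex_bij_betw[OF bij_split_index, symmetric])

lemma has_sum_super_term_iff:
  assumes "x \<in> superspace L N M" "c \<in> superspace L N M"
  shows "(super_term q \<epsilon> r s a N M A c x has_sum y) (multi_indices r N M) \<longleftrightarrow>
    (series_term (\<lambda>I. A (split_index I)) (x - c) has_sum y) (exponents ks)"
proof -
  have "series_term (\<lambda>I. A (split_index I)) (x - c) = (\<lambda>I. super_term q \<epsilon> r s a N M A c x (split_index I))"
    using super_term_split_index[OF assms] by (simp add: fun_eq_iff)
  then show ?thesis using has_sum_reindex_bij_betw[OF bij_split_index, of "super_term q \<epsilon> r s a N M A c x"] by simp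
qed

lemma v_eq: "v (Inl i) = even_dir e i 0" "v (Inr (k, j)) = odd_dir \<epsilon> j (s k)"
  by (simp_all add: v_def block_simps)

lemma concat_map_concat: "concat (map f (concat xss)) = concat (map (\<lambda>xs. concat (map f xs)) xss)"
  by (induction xss) auto

lemma map_concat_replicate:
  "map g (concat (map (\<lambda>\<beta>. replicate (I \<beta>) \<beta>) ls)) = concat (map (\<lambda>\<beta>. replicate (I \<beta>) (g \<beta>)) ls)"
  by (induction ls) auto

lemma deriv_dirs_split_index:
  "deriv_dirs e \<epsilon> r s N M (fst (split_index I)) (snd (split_index I)) = map v (directions I)"
  unfolding directions_def map_concat_replicate
  by (simp add: ks_def deriv_dirs_def split_index_def concat_map_concat o_def v_eq del: upt_Suc)

lemma multi_fact_split_index: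
  "multi_fact N (fst (split_index I)) * (\<Prod>k\<in>{1..r}. multi_fact M (snd (split_index I) k)) =
    (\<Prod>\<beta>\<in>set ks. fact (I \<beta>))"
proof -
  have "(\<Prod>\<beta>\<in>set ks. fact (I \<beta>) :: real) =
      (\<Prod>i\<in>N. fact (I (Inl i))) * (\<Prod>x\<in>{1..r} \<times> M. fact (I (Inr x)))"
    unfolding set_ks by (subst prod.union_disjoint) (auto simp: prod.reindex)
  also have "(\<Prod>x\<in>{1..r} \<times> M. fact (I (Inr x)) :: real) = (\<Prod>k\<in>{1..r}. \<Prod>j\<in>M. fact (I (Inr (k, j))))"
    by (rule trans[OF _ prod.cartesian_product[symmetric]]) (simp add: case_prod_unfold)
  finally show ?thesis by (simp add: multi_fact_def split_index_def)
qed

text \<open>The derivative along each basis vector of a block is \<open>a'\<close> times the one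
  along the lead vector, so every coefficient of d''f vanishes.\<close>

lemma qS_imp_qS_differentiable:
  assumes "qS f D"
  shows "qS_differentiable_on L p e q \<epsilon> r s a N M f D"
  unfolding qS_differentiable_on_def
proof (intro conjI ballI)
  show D: "openin (top_of_set (superspace L N M)) D" using assms by (simp add: qS_def)
  show "f differentiable_on D"
    using assms unfolding qS_def differentiable_on_def differentiable_def by blast
  fix x h assume x: "x \<in> D"
  obtain f' where f': "(f has_derivative f') (at x within D)"
    "\<And>h. h \<in> superspace L N M \<Longrightarrow> f' h = (\<Sum>\<beta>\<in>set ks. Z \<beta> h * f' (v \<beta>))"
    using assms x unfolding qS_def by blast
  have dd: "dir_deriv (E \<beta> t) f x = a' \<beta> t * f' (v \<beta>)" if "\<beta> \<in> set ks" "t \<in> Bl \<beta>" for \<beta> t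
  proof -
    have EX: "E \<beta> t \<in> superspace L N M" using that by (rule E_X)
    have "dir_deriv (E \<beta> t) f x = f' (E \<beta> t)"
      unfolding dir_deriv_def
      by (rule vector_derivative_at has_vector_derivative_along[OF f'(1) D subspace_superspace x EX])+
    also have "\<dots> = a' \<beta> t * f' (v \<beta>)"
      unfolding f'(2)[OF EX] using that
      by (simp add: Z_E if_distrib[of "\<lambda>x. x * _"] sum.delta cong: if_cong sum.cong)
    finally show ?thesis .
  qed
  have dd': "dir_deriv (E \<beta> t) f x = a' \<beta> t * dir_deriv (v \<beta>) f x" if "\<beta> \<in> set ks" "t \<in> Bl \<beta>" for \<beta> t
    using dd[OF that] dd[OF that(1) lead_Bl[OF that(1)]] a_lead[OF that(1)] by (simp add: v_def)
  have ev: "dir_deriv (even_dir e i t) f x - e t * dir_deriv (even_dir e i 0) f x = 0" if "i \<in> N" "t \<in> {0..p}" for i t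
    using dd'[of "Inl i" t] that unfolding v_eq by (simp add: ks_iff block_simps)
  have od: "dir_deriv (odd_dir \<epsilon> j t) f x - a t * dir_deriv (odd_dir \<epsilon> j (s k)) f x = 0"
    if "k \<in> {1..r}" "j \<in> M" "t \<in> {s k..<s (k + 1)}" for k j t
    using dd'[of "Inr (k, j)" t] that unfolding v_eq by (simp add: ks_iff block_simps)
  show "d_second p e q \<epsilon> r s a N M f x h = 0"
    unfolding d_second_def by (simp add: ev od)
qed

text \<open>Evaluating d''f at a single basis vector leaves one summand, which relates the
  derivative along that vector to the one along the lead vector. Lead vectors are absent from d''
  and satisfy their relation trivially, since there a = 1. The orthonormal expansion extends the
  relations to the superspace.\<close>

lemma qS_differentiable_imp_qS:
  assumes "qS_differentiable_on L p e q \<epsilon> r s a N M f D"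
  shows "qS f D"
  unfolding qS_def
proof (intro conjI ballI)
  show D: "openin (top_of_set (superspace L N M)) D" using assms by (simp add: qS_differentiable_on_def)
  fix x assume x: "x \<in> D"
  obtain f' where f': "(f has_derivative f') (at x within D)"
    using assms x unfolding qS_differentiable_on_def differentiable_on_def differentiable_def by blast
  have ds: "d_second p e q \<epsilon> r s a N M f x h = 0" if "h \<in> superspace L N M" for h
    using assms x that unfolding qS_differentiable_on_def by blast
  have dd: "dir_deriv w f x = f' w" if "w \<in> superspace L N M" for w
    unfolding dir_deriv_def
    by (rule vector_derivative_at has_vector_derivative_along[OF f' D subspace_superspace x that])+
  have coord_e: "coord e {0..p} y k = y \<bullet> e k" if "y \<in> L 0" "k \<in> {0..p}" for y k
    by (rule e_coord(1)[OF _ _ that(1)]) (use that in auto)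
  have coord_\<epsilon>: "coord \<epsilon> {1..q} y k = y \<bullet> \<epsilon> k" if "y \<in> L 1" "k \<in> {1..q}" for y k
    by (rule \<epsilon>_coord(1)[OF _ _ that(1)]) (use that in auto)
  have main: "f' (E \<beta> t) = a' \<beta> t * f' (v \<beta>)" if "\<beta> \<in> set ks" "t \<in> Bl \<beta>" for \<beta> t
    using that
  proof (cases rule: block_cases)
    case (even i)
    have X: "even_dir e i t \<in> superspace L N M" "even_dir e i 0 \<in> superspace L N M"
      using even by (auto intro!: even_dir_superspace)
    show ?thesis
    proof (cases "t = 0")
      case True
      then show ?thesis using even by (simp add: block_simps v_eq e_0)
    next
      case False
      define T where "T i' j = dir_deriv (even_dir e i' j) f x - e j * dir_deriv (even_dir e i' 0) f x" for i' j
      have c: "coord e {0..p} (axis i (e t) $ i') j = (if i' = i \<and> j = t then 1 else 0)"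
        if "i' \<in> N" "j \<in> {1..p}" for i' j
        using that even e_L0[of t] subspace_0[OF subspace_L(1)] e_on[of t j]
        by (subst coord_e) (auto simp: axis_def)
      have o: "coord \<epsilon> {1..q} 0 u = 0" if "u \<in> {1..q}" for u
        by (simp only: coord_\<epsilon>[OF subspace_0[OF subspace_L(2)] that] inner_zero_left)
      have "d_second p e q \<epsilon> r s a N M f x (even_dir e i t) =
          (\<Sum>i'\<in>N. \<Sum>j\<in>{1..p}. (if i' = i \<and> j = t then 1 else 0) *\<^sub>R T i' j) + 0"
        unfolding d_second_def T_def even_dir_def fst_conv snd_conv
      proof (intro arg_cong2[where f = "(+)"] sum.cong refl sum.neutral ballI)
        fix j k u assume "j \<in> M" "k \<in> {1..r}" "u \<in> {s k<..<s (k + 1)}"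
        then have "u \<in> {s k..<s (k + 1)}" "k \<in> {1..r}" by auto
        then have "u \<in> {1..q}" using block_subset by blast
        then show "coord \<epsilon> {1..q} (0 $ j) u *\<^sub>R (dir_deriv (odd_dir \<epsilon> j u) f x - a u * dir_deriv (odd_dir \<epsilon> j (s k)) f x) = 0"
          using o by simp
      qed (simp only: c)
      also have "\<dots> = (\<Sum>i'\<in>N. if i' = i then T i t else 0)"
        unfolding add_0_right
      proof (intro sum.cong refl)
        fix i'
        show "(\<Sum>j\<in>{1..p}. (if i' = i \<and> j = t then 1 else 0) *\<^sub>R T i' j) = (if i' = i then T i t else 0)"
          using False even
          by (cases "i' = i") (auto simp: if_distrib[of "\<lambda>x. x *\<^sub>R _"] sum.delta cong: if_cong)
      qed
      also have "\<dots> = T i t" using even by simp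
      finally have "T i t = 0" using ds[OF X(1)] by simp
      then show ?thesis using even X by (simp add: T_def dd block_simps v_eq)
    qed
  next
    case (odd k j)
    have sk: "s k \<in> {1..q}" using block_subset[OF odd(2)] s_less[OF odd(2)] by auto
    have X: "odd_dir \<epsilon> j t \<in> superspace L N M" "odd_dir \<epsilon> j (s k) \<in> superspace L N M"
      using odd sk by (auto intro!: odd_dir_superspace)
    show ?thesis
    proof (cases "t = s k")
      case True
      then show ?thesis using odd a_lead[OF that(1)] by (simp add: v_eq block_simps)
    next
      case False
      define T where "T j' k' u = dir_deriv (odd_dir \<epsilon> j' u) f x - a u * dir_deriv (odd_dir \<epsilon> j' (s k')) f x" for j' k' u
      have c: "coord \<epsilon> {1..q} (axis j (\<epsilon> t) $ j') u = (if j' = j \<and> u = t then 1 else 0)"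
        if "j' \<in> M" "u \<in> {1..q}" for j' u
        using that odd \<epsilon>_L1[of t] subspace_0[OF subspace_L(2)] \<epsilon>_on[of t u]
        by (subst coord_\<epsilon>) (auto simp: axis_def)
      have o: "coord e {0..p} 0 u = 0" if "u \<in> {0..p}" for u
        using that subspace_0[OF subspace_L(1)] by (simp add: coord_e)
      have "d_second p e q \<epsilon> r s a N M f x (odd_dir \<epsilon> j t) =
          0 + (\<Sum>j'\<in>M. \<Sum>k'\<in>{1..r}. \<Sum>u\<in>{s k'<..<s (k' + 1)}. (if j' = j \<and> u = t then 1 else 0) *\<^sub>R T j' k' u)"
        unfolding d_second_def T_def odd_dir_def fst_conv snd_conv
      proof (intro arg_cong2[where f = "(+)"] sum.cong refl sum.neutral ballI)
        fix j' k' u assume "j' \<in> M" "k' \<in> {1..r}" "u \<in> {s k'<..<s (k' + 1)}"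
        moreover from this have "u \<in> {s k'..<s (k' + 1)}" by auto
        then have "u \<in> {1..q}" using block_subset calculation by blast
        ultimately show "coord \<epsilon> {1..q} (axis j (\<epsilon> t) $ j') u *\<^sub>R
            (dir_deriv (0, axis j' (\<epsilon> u)) f x - a u * dir_deriv (0, axis j' (\<epsilon> (s k'))) f x) =
          (if j' = j \<and> u = t then 1 else 0) *\<^sub>R
            (dir_deriv (0, axis j' (\<epsilon> u)) f x - a u * dir_deriv (0, axis j' (\<epsilon> (s k'))) f x)"
          by (simp only: c)
      qed (simp add: o)
      also have "\<dots> = (\<Sum>j'\<in>M. \<Sum>k'\<in>{1..r}. if j' = j \<and> k' = k then T j k t else 0)"
      proof -
        have "(\<Sum>u\<in>{s k'<..<s (k' + 1)}. (if j' = j \<and> u = t then 1 else 0) *\<^sub>R T j' k' u) =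
            (if j' = j \<and> k' = k then T j k t else 0)" if k': "k' \<in> {1..r}" for j' k'
        proof -
          \<comment> \<open>The open interval leaves out the lead index; as t differs from s k, it
            lies in exactly one of these intervals.\<close>
          have "t \<in> {s k'<..<s (k' + 1)} \<longleftrightarrow> k' = k"
            using False odd block_unique[of k' k t] k' by auto
          then show ?thesis
            by (cases "j' = j") (auto simp: if_distrib[of "\<lambda>x. x *\<^sub>R _"] sum.delta' cong: if_cong)
        qed
        then show ?thesis by simp
      qed
      also have "\<dots> = (\<Sum>j'\<in>M. if j' = j then T j k t else 0)"
        using odd by (intro sum.cong) auto
      also have "\<dots> = T j k t" using odd by simp
      finally have "T j k t = 0" using ds[OF X(1)] by simp
      then show ?thesis using odd X by (simp add: T_def dd block_simps v_eq)
    qed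
  qed
  have lin: "linear f'" using f' by (rule has_derivative_linear)
  have "f' h = (\<Sum>\<beta>\<in>set ks. Z \<beta> h * f' (v \<beta>))" if "h \<in> superspace L N M" for h
  proof -
    have "f' h = (\<Sum>\<beta>\<in>set ks. \<Sum>t\<in>Bl \<beta>. (h \<bullet> E \<beta> t) *\<^sub>R f' (E \<beta> t))"
      by (subst superspace_expansion[OF that]) (simp add: linear_sum[OF lin] linear_cmul[OF lin])
    also have "\<dots> = (\<Sum>\<beta>\<in>set ks. Z \<beta> h * f' (v \<beta>))"
      unfolding Z_def sum_distrib_right by (intro sum.cong refl) (simp add: main)
    finally show ?thesis .
  qed
  with f' show "\<exists>f'. (f has_derivative f') (at x within D) \<and>
      (\<forall>h\<in>superspace L N M. f' h = (\<Sum>\<beta>\<in>set ks. Z \<beta> h * f' (v \<beta>)))" by blast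
qed

section \<open>Polydiscs and block balls\<close>

lemma norm_fst_eq:
  assumes "h \<in> superspace L N M" "i \<in> N"
  shows "norm (fst h $ i) = block_norm (Inl i) h"
proof -
  have "fst h $ i \<in> L 0" using assms by (auto simp: superspace_iff split: if_splits)
  then have "(norm (fst h $ i))\<^sup>2 = (\<Sum>k\<in>{0..p}. (fst h $ i \<bullet> e k)\<^sup>2)" by (rule e_coord(3)[rotated 2])
  then show ?thesis
    by (simp add: block_norm_def L2_set_def block_simps inner_even_dir real_sqrt_unique)
qed

text \<open>The blocks of an odd variable share one Euclidean ball, whose radius constrains only the
  sum of their squared norms.\<close>

lemma norm_snd_eq:
  assumes "h \<in> superspace L N M" "j \<in> M"
  shows "(norm (snd h $ j))\<^sup>2 = (\<Sum>k\<in>{1..r}. (block_norm (Inr (k, j)) h)\<^sup>2)"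
proof -
  have "snd h $ j \<in> L 1" using assms by (auto simp: superspace_iff split: if_splits)
  then have "(norm (snd h $ j))\<^sup>2 = (\<Sum>k\<in>{1..q}. (snd h $ j \<bullet> \<epsilon> k)\<^sup>2)" by (rule \<epsilon>_coord(3)[rotated 2])
  moreover have "(\<Sum>k\<in>{1..r}. (block_norm (Inr (k, j)) h)\<^sup>2) =
      (\<Sum>k\<in>{1..r}. \<Sum>t\<in>{s k..<s (k + 1)}. (snd h $ j \<bullet> \<epsilon> t)\<^sup>2)"
    by (simp add: block_norm_def L2_set_def block_simps inner_odd_dir sum_nonneg)
  ultimately show ?thesis by (simp only: sum_blocks)
qed

text \<open>A ball in \<open>\<Lambda>\<^sub>1\<close> is the union of the products of block balls whose squared radii add up to at
  most the squared radius.\<close>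

lemma polydisc_block_ball:
  assumes c: "c \<in> superspace L N M" and x: "x \<in> polydisc L N M c R S"
  obtains T where "\<And>\<beta>. \<beta> \<in> set ks \<Longrightarrow> 0 < T \<beta>" "x - c \<in> block_ball T"
    "\<And>h. h \<in> block_ball T \<Longrightarrow> c + h \<in> polydisc L N M c R S"
proof -
  have xX: "x \<in> superspace L N M" and xR: "\<And>i. i \<in> N \<Longrightarrow> norm (fst x $ i - fst c $ i) < R i"
    and xS: "\<And>j. j \<in> M \<Longrightarrow> norm (snd x $ j - snd c $ j) < S j"
    using x by (auto simp: polydisc_def)
  have X: "x - c \<in> superspace L N M" using xX c by (intro subspace_diff subspace_superspace)
  define \<tau> where "\<tau> \<beta> = block_norm \<beta> (x - c)" for \<beta>
  \<comment> \<open>The slack in the squared radius is divided by r + 1 instead of r, so that r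
    enlarged blocks still leave a strict inequality, also for r = 0.\<close>
  define \<eta> where "\<eta> j = ((S j)\<^sup>2 - (norm (snd (x - c) $ j))\<^sup>2) / (real r + 1)" for j
  have \<eta>: "\<eta> j > 0" if "j \<in> M" for j
  proof -
    have "(norm (snd (x - c) $ j))\<^sup>2 < (S j)\<^sup>2" using xS[OF that] by (intro power_strict_mono) auto
    then show ?thesis by (simp add: \<eta>_def)
  qed
  \<comment> \<open>An even ball is already a block ball. Each odd block radius exceeds the block
    norm of x - c by a share \<open>\<eta> j\<close> of the slack, measured in squares.\<close>
  define T where "T = case_sum R (\<lambda>(k, j). sqrt ((\<tau> (Inr (k, j)))\<^sup>2 + \<eta> j))"
  have \<tau>T: "\<tau> \<beta> < T \<beta>" if "\<beta> \<in> set ks" for \<beta>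
    using that unfolding set_ks
  proof (elim UnE imageE)
    fix i assume "\<beta> = Inl i" "i \<in> N"
    then show ?thesis using xR norm_fst_eq[OF X] by (simp add: T_def \<tau>_def)
  next
    fix y assume y: "\<beta> = Inr y" "y \<in> {1..r} \<times> M"
    then obtain k j where kj: "y = (k, j)" "j \<in> M" by auto
    show ?thesis using y kj \<eta>[OF kj(2)] by (simp add: T_def real_less_rsqrt)
  qed
  show ?thesis
  proof (rule that[of T])
    show "0 < T \<beta>" if "\<beta> \<in> set ks" for \<beta>
      using \<tau>T[OF that] block_norm_nonneg[of \<beta> "x - c"] by (simp add: \<tau>_def)
    show "x - c \<in> block_ball T" using X \<tau>T by (simp add: block_ball_def \<tau>_def)
    fix h assume h: "h \<in> block_ball T"
    then have hX: "h \<in> superspace L N M" and hT: "\<And>\<beta>. \<beta> \<in> set ks \<Longrightarrow> block_norm \<beta> h < T \<beta>"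
      by (auto simp: block_ball_def)
    have "norm (fst h $ i) < R i" if "i \<in> N" for i
      using hT[of "Inl i"] that by (simp add: norm_fst_eq[OF hX] T_def set_ks)
    moreover have "norm (snd h $ j) < S j" if j: "j \<in> M" for j
    proof -
      have "(norm (snd h $ j))\<^sup>2 \<le> (\<Sum>k\<in>{1..r}. (\<tau> (Inr (k, j)))\<^sup>2 + \<eta> j)"
        unfolding norm_snd_eq[OF hX j]
      proof (rule sum_mono)
        fix k assume k: "k \<in> {1..r}"
        have "block_norm (Inr (k, j)) h < sqrt ((\<tau> (Inr (k, j)))\<^sup>2 + \<eta> j)"
          using hT[of "Inr (k, j)"] k j by (auto simp: T_def set_ks)
        then have "(block_norm (Inr (k, j)) h)\<^sup>2 \<le> (sqrt ((\<tau> (Inr (k, j)))\<^sup>2 + \<eta> j))\<^sup>2"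
          by (intro power_mono block_norm_nonneg) auto
        then show "(block_norm (Inr (k, j)) h)\<^sup>2 \<le> (\<tau> (Inr (k, j)))\<^sup>2 + \<eta> j"
          using \<eta>[OF j] by (simp add: add_nonneg_pos less_imp_le)
      qed
      also have "\<dots> = (norm (snd (x - c) $ j))\<^sup>2 + real r * \<eta> j"
        unfolding norm_snd_eq[OF X j] \<tau>_def by (simp add: sum.distrib)
      also have "\<dots> < (norm (snd (x - c) $ j))\<^sup>2 + (real r + 1) * \<eta> j"
        using \<eta>[OF j] by (simp add: algebra_simps)
      also have "(real r + 1) * \<eta> j = (S j)\<^sup>2 - (norm (snd (x - c) $ j))\<^sup>2"
        by (simp add: \<eta>_def add_nonneg_pos)
      finally have "(norm (snd h $ j))\<^sup>2 < (S j)\<^sup>2" by simp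
      moreover have "0 \<le> S j" using xS[OF j] norm_ge_zero order.trans less_imp_le by metis
      ultimately show ?thesis by (rule power2_less_imp_less)
    qed
    moreover have "c + h \<in> superspace L N M" using c hX by (intro subspace_add subspace_superspace)
    ultimately show "c + h \<in> polydisc L N M c R S" by (simp add: polydisc_def)
  qed
qed

lemma small_polydisc:
  assumes D: "openin (top_of_set (superspace L N M)) D" and c: "c \<in> D"
  obtains \<rho> where "\<rho> > 0" "polydisc L N M c (\<lambda>_. \<rho>) (\<lambda>_. \<rho>) \<subseteq> D"
proof -
  obtain \<epsilon> where \<epsilon>: "\<epsilon> > 0" "ball c \<epsilon> \<inter> superspace L N M \<subseteq> D" using D c by (auto simp: openin_contains_ball)
  have cX: "c \<in> superspace L N M" using D c openin_imp_subset by blast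
  obtain t where t: "t > 0" "\<And>h. h \<in> block_ball (\<lambda>_. t) \<Longrightarrow> norm h < \<epsilon>"
    using small_block_ball[OF \<epsilon>(1)] by blast
  have "x \<in> D" if x: "x \<in> polydisc L N M c (\<lambda>_. t) (\<lambda>_. t)" for x
  proof -
    have xX: "x \<in> superspace L N M" using x by (simp add: polydisc_def)
    have X: "x - c \<in> superspace L N M" using xX cX by (intro subspace_diff subspace_superspace)
    have "block_norm \<beta> (x - c) < t" if "\<beta> \<in> set ks" for \<beta>
      using that unfolding set_ks
    proof (elim UnE imageE)
      fix i assume "\<beta> = Inl i" "i \<in> N"
      then show ?thesis using x norm_fst_eq[OF X] by (simp add: polydisc_def)
    next
      fix y assume y: "\<beta> = Inr y" "y \<in> {1..r} \<times> M"
      then obtain k j where kj: "y = (k, j)" "j \<in> M" "k \<in> {1..r}" by auto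
      have "(block_norm \<beta> (x - c))\<^sup>2 \<le> (norm (snd (x - c) $ j))\<^sup>2"
        unfolding norm_snd_eq[OF X kj(2)] y kj by (rule member_le_sum) (use kj in auto)
      then have "block_norm \<beta> (x - c) \<le> norm (snd (x - c) $ j)" by (rule power2_le_imp_le) simp
      also have "\<dots> < t" using x kj by (simp add: polydisc_def)
      finally show ?thesis .
    qed
    then have "x - c \<in> block_ball (\<lambda>_. t)" using X by (simp add: block_ball_def)
    from t(2)[OF this] have "x \<in> ball c \<epsilon>" by (simp add: dist_norm norm_minus_commute)
    then show ?thesis using \<epsilon> xX by blast
  qed
  then show ?thesis using that t(1) by blast
qed

text \<open>Every point x of the polydisc lies in a block ball around c that fits into the polydisc.
  Its radii T depend on x, but the coefficients from \<open>qS_taylor\<close> do not.\<close>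

lemma taylor_expansion:
  assumes f: "qS_differentiable_on L p e q \<epsilon> r s a N M f D" and c: "c \<in> D"
  shows "\<exists>A. (\<forall>R S. polydisc L N M c R S \<subseteq> D \<longrightarrow> (\<forall>x\<in>polydisc L N M c R S.
      converges_absolutely_at q \<epsilon> r s a N M A c x \<and>
      (super_term q \<epsilon> r s a N M A c x has_sum f x) (multi_indices r N M))) \<and>
    (\<forall>(I, J)\<in>multi_indices r N M. \<exists>g. has_iter_deriv D (deriv_dirs e \<epsilon> r s N M I J) f g \<and>
      (multi_fact N I * (\<Prod>k\<in>{1..r}. multi_fact M (J k))) *\<^sub>R A (I, J) = g c)"
proof -
  have cX: "c \<in> superspace L N M"
    using f c openin_imp_subset unfolding qS_differentiable_on_def by blast
  obtain A where A: "\<And>T h. (\<forall>\<beta>\<in>set ks. 0 < T \<beta>) \<and> (\<forall>h\<in>block_ball T. c + h \<in> D) \<Longrightarrow> h \<in> block_ball T \<Longrightarrow>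
      (\<lambda>I. norm (series_term A h I)) summable_on exponents ks \<and> (series_term A h has_sum f (c + h)) (exponents ks)"
    and coeff: "\<And>I. I \<in> exponents ks \<Longrightarrow> \<exists>g. has_iter_deriv D (map v (directions I)) f g \<and>
      (\<Prod>\<beta>\<in>set ks. fact (I \<beta>)) *\<^sub>R A I = g c"
    using qS_taylor[OF qS_differentiable_imp_qS[OF f] c] by blast
  define A' where "A' K = A (case_sum (fst K) (\<lambda>(k, j). snd K k j))" for K
  have "case_sum (fst (split_index I)) (\<lambda>(k, j). snd (split_index I) k j) = I" for I :: "'n + nat \<times> 'm \<Rightarrow> nat"
    by (auto simp: split_index_def fun_eq_iff split: sum.split)
  then have A': "A' (split_index I) = A I" for I by (simp add: A'_def)
  show ?thesis
  proof (intro exI[of _ A'] conjI allI impI ballI)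
    fix R S x assume P: "polydisc L N M c R S \<subseteq> D" and x: "x \<in> polydisc L N M c R S"
    have xX: "x \<in> superspace L N M" using x by (simp add: polydisc_def)
    obtain T where T: "\<And>\<beta>. \<beta> \<in> set ks \<Longrightarrow> 0 < T \<beta>" "x - c \<in> block_ball T"
      "\<And>h. h \<in> block_ball T \<Longrightarrow> c + h \<in> polydisc L N M c R S"
      using polydisc_block_ball[OF cX x] by blast
    have "(\<lambda>I. norm (series_term A (x - c) I)) summable_on exponents ks \<and>
        (series_term A (x - c) has_sum f (c + (x - c))) (exponents ks)"
      by (rule A[OF _ T(2)]) (use T P in blast)
    then show "converges_absolutely_at q \<epsilon> r s a N M A' c x"
      "(super_term q \<epsilon> r s a N M A' c x has_sum f x) (multi_indices r N M)"
      by (simp_all add: converges_absolutely_iff[OF xX cX] has_sum_super_term_iff[OF xX cX] A')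
  next
    fix K assume "K \<in> multi_indices r N M"
    then obtain I where I: "I \<in> exponents ks" "K = split_index I"
      using bij_split_index by (auto simp: bij_betw_def)
    obtain g where "has_iter_deriv D (map v (directions I)) f g" "(\<Prod>\<beta>\<in>set ks. fact (I \<beta>)) *\<^sub>R A I = g c"
      using coeff[OF I(1)] by blast
    then show "case K of (I, J) \<Rightarrow> \<exists>g. has_iter_deriv D (deriv_dirs e \<epsilon> r s N M I J) f g \<and>
        (multi_fact N I * (\<Prod>k\<in>{1..r}. multi_fact M (J k))) *\<^sub>R A' (I, J) = g c"
      unfolding case_prod_unfold prod.collapse I(2) deriv_dirs_split_index multi_fact_split_index A' by blast
  qed
qed

text \<open>Being an interior, the domain of convergence is relatively open, so
  \<open>qS_of_series\<close> applies to it as a whole.\<close>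

lemma domain_of_convergence_qS:
  assumes c: "c \<in> superspace L N M"
    and f: "\<And>x. x \<in> domain_of_convergence L q \<epsilon> r s a N M A c \<Longrightarrow>
      (super_term q \<epsilon> r s a N M A c x has_sum f x) (multi_indices r N M)"
  shows "qS_differentiable_on L p e q \<epsilon> r s a N M f (domain_of_convergence L q \<epsilon> r s a N M A c)"
proof (rule qS_imp_qS_differentiable, rule qS_of_series[OF _ c])
  show "openin (top_of_set (superspace L N M)) (domain_of_convergence L q \<epsilon> r s a N M A c)"
    by (simp add: domain_of_convergence_def)
  fix x assume x: "x \<in> domain_of_convergence L q \<epsilon> r s a N M A c"
  then have "x \<in> {x \<in> superspace L N M. converges_absolutely_at q \<epsilon> r s a N M A c x}"
    unfolding domain_of_convergence_def by (rule subsetD[OF interior_of_subset])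
  then have xX: "x \<in> superspace L N M" and conv: "converges_absolutely_at q \<epsilon> r s a N M A c x" by auto
  show "(\<lambda>I. norm (series_term (\<lambda>I. A (split_index I)) (x - c) I)) summable_on exponents ks"
    using conv converges_absolutely_iff[OF xX c] by simp
  show "(series_term (\<lambda>I. A (split_index I)) (x - c) has_sum f x) (exponents ks)"
    using f[OF x] has_sum_super_term_iff[OF xX c] by simp
qed

end

theorem proposition4p6:
  fixes L :: "nat \<Rightarrow> 'a::{real_algebra_1,euclidean_space} set"
    and p q r :: nat and e \<epsilon> a :: "nat \<Rightarrow> 'a" and s :: "nat \<Rightarrow> nat"
    and N :: "'n::{finite,linorder} set" and M :: "'m::{finite,linorder} set"
  assumes "comm_superalgebra L"
    and "cond_A0 L p e"
    and "cond_A1 L q \<epsilon> r s a"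
    and "orthonormal_bases p e q \<epsilon>"
  shows
    "(\<forall>D f. qS_differentiable_on L p e q \<epsilon> r s a N M f D \<longrightarrow>
       (\<forall>c\<in>D. \<exists>A.
          (\<exists>\<rho>>0. polydisc L N M c (\<lambda>_. \<rho>) (\<lambda>_. \<rho>) \<subseteq> D \<and>
             (\<forall>x\<in>polydisc L N M c (\<lambda>_. \<rho>) (\<lambda>_. \<rho>).
                converges_absolutely_at q \<epsilon> r s a N M A c x \<and>
                (super_term q \<epsilon> r s a N M A c x has_sum f x) (multi_indices r N M))) \<and>
          (\<forall>(I, J)\<in>multi_indices r N M.
             \<exists>g. has_iter_deriv D (deriv_dirs e \<epsilon> r s N M I J) f g \<and>
                 (multi_fact N I * (\<Prod>k\<in>{1..r}. multi_fact M (J k))) *\<^sub>R A (I, J) = g c) \<and>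
          (\<forall>R S. (\<forall>i\<in>N. R i > 0) \<and> (\<forall>j\<in>M. S j > 0) \<and>
             compact (closure (polydisc L N M c R S)) \<and> closure (polydisc L N M c R S) \<subseteq> D \<longrightarrow>
             (\<forall>x\<in>polydisc L N M c R S.
                converges_absolutely_at q \<epsilon> r s a N M A c x \<and>
                (super_term q \<epsilon> r s a N M A c x has_sum f x) (multi_indices r N M))))) \<and>
     (\<forall>c\<in>superspace L N M. \<forall>A f.
        (\<forall>x\<in>domain_of_convergence L q \<epsilon> r s a N M A c.
           (super_term q \<epsilon> r s a N M A c x has_sum f x) (multi_indices r N M)) \<longrightarrow>
        qS_differentiable_on L p e q \<epsilon> r s a N M f (domain_of_convergence L q \<epsilon> r s a N M A c))"
proof -
  interpret super_coordinates L p q r e \<epsilon> a s N M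
    using assms by unfold_locales
  show ?thesis
  proof (intro conjI allI impI ballI, goal_cases)
    case (1 D f c)
    note f = 1(1) and c = 1(2)
    obtain A where A: "\<forall>R S. polydisc L N M c R S \<subseteq> D \<longrightarrow> (\<forall>x\<in>polydisc L N M c R S.
        converges_absolutely_at q \<epsilon> r s a N M A c x \<and>
        (super_term q \<epsilon> r s a N M A c x has_sum f x) (multi_indices r N M))"
      and coeff: "\<forall>(I, J)\<in>multi_indices r N M. \<exists>g. has_iter_deriv D (deriv_dirs e \<epsilon> r s N M I J) f g \<and>
        (multi_fact N I * (\<Prod>k\<in>{1..r}. multi_fact M (J k))) *\<^sub>R A (I, J) = g c"
      using taylor_expansion[OF f c] by (elim exE conjE) (rule that)
    note A = A[THEN spec, THEN spec, THEN mp]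
    obtain \<rho> where \<rho>: "\<rho> > 0" "polydisc L N M c (\<lambda>_. \<rho>) (\<lambda>_. \<rho>) \<subseteq> D"
      using small_polydisc[OF _ c] f unfolding qS_differentiable_on_def by blast
    have sub: "polydisc L N M c R S \<subseteq> D" if "closure (polydisc L N M c R S) \<subseteq> D" for R S
      using that closure_subset by (rule order.trans[rotated])
    show ?case
      using \<rho> A[OF \<rho>(2)] coeff A[OF sub] by (intro exI[of _ A] conjI exI[of _ \<rho>] allI impI) blast+
  next
    case (2 c A f)
    then show ?case by (intro domain_of_convergence_qS) auto
  qed
qed

end
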